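(* Let $(M^n,g)$ be an oriented Riemannian manifold, let $\alpha=\alpha_0,\alpha_1,\dots,\alpha_N$ be differential forms on $M$ such that the $k$-form $\alpha$ is a parallel-compliant calibration (with respect to the collection $\alpha_0,\dots,\alpha_N$), and let $L^k\subset M$ be an $\alpha$-calibrated submanifold. For $u\in\Gamma(TL)$ let $\widehat\nabla_u$ and $B_u$ be the operators on sections of $TM|_L=TL\oplus NL$ given by $$\widehat\nabla_u(v,\xi)=(\nabla_u v,\,D_u\xi),\qquad B_u(v,\xi)=(-A_u^*\xi,\;A_u v).$$ Then, along $L$, $$\widehat\nabla\alpha_j=0\quad\text{and}\quad B_u\diamond\alpha_j=0\qquad\text{for all } 0\le j\le N \text{ and all } u\in\Gamma(TL).$$ Consequently $\mathrm{Hol}^0(\widehat\nabla)\subset \mathrm{H}$ (so $\mathfrak{hol}(\widehat\nabla)\subset\mathfrak h$), and $B_u\in\mathfrak g$; that is, for every $x\in L$ the restricted holonomy group of $\widehat\nabla$ based at $x$ lies in $\mathrm{H}_x$, its holonomy algebra at $x$ lies in $\mathfrak h_x$, and $(B_u)_x\in\mathfrak g_x$ for all $u\in\Gamma(TL)$.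
   Context: Vectors and covectors are identified using the metric, so $\Lambda^2(T_xM)=\mathfrak{so}(T_xM)$. Calibrations. A closed $k$-form $\alpha$ on $(M,g)$ is a calibration if for every $x\in M$ and every oriented $k$-plane $W\subset T_xM$ we have $\alpha|_W\le \mathrm{vol}_W$, with equality for at least one $W$ at each $x$; such $W$ with $\alpha|_W=\mathrm{vol}_W$ is called calibrated, and $\mathrm{Gr}_{\alpha_x}$ is the set of calibrated $k$-planes in $T_xM$. An oriented $k$-dimensional submanifold $L$ (with induced metric) is $\alpha$-calibrated if $T_xL$ is calibrated for all $x\in L$, i.e. $\alpha|_L=\mathrm{vol}_L$. Structure group. Let $\alpha_0=\alpha$ and let $\alpha_1,\dots,\alpha_N$ be further differential forms on $M$ (of possibly various degrees). They are assumed to define a $\mathrm{G}$-structure: there are fixed forms on $\mathbb R^n$ with common stabilizer $\mathrm{G}\subset\mathrm{SO}(n)$ such that around each point of $M$ there are local oriented orthonormal frames in which the $\alpha_j$ agree with these fixed forms; so $\mathrm{G}_x=\{P\in\mathrm{SO}(T_xM): P^*\alpha_j|_x=\alpha_j|_x,\ 0\le j\le N\}$ corresponds to the conjugacy class of $\mathrm{G}$ for all $x\in M$. It is assumed that $\mathrm{G}_x$ acts transitively on $\mathrm{Gr}_{\alpha_x}$. Let $\mathfrak g_x\subset\mathfrak{so}(T_xM)$ be the Lie algebra of $\mathrm{G}_x$. Compliant. For $W\in\mathrm{Gr}_{\alpha_x}$ let $\mathrm{H}_W=\{P\in\mathrm{G}_x:P(W)=W\}$, with Lie algebra $\mathfrak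 h_W=\mathfrak g_x\cap(\Lambda^2W\oplus\Lambda^2W^\perp)$, and let $\mathfrak h_W^{\perp_{\mathfrak g}}$ be its orthogonal complement in $\mathfrak g_x$ (for the standard inner product on $\mathfrak{so}(T_xM)=\Lambda^2(T_xM)$). $\alpha$ is compliant if for every $x$ and $W\in\mathrm{Gr}_{\alpha_x}$ one has $\mathfrak h_W^{\perp_{\mathfrak g}}=\mathfrak g_x\cap(W\otimes W^\perp)$, where $\Lambda^2(T_xM)=(\Lambda^2W\oplus\Lambda^2W^\perp)\oplus(W\otimes W^\perp)$. $\alpha$ is parallel-compliant if it is compliant and $\overline\nabla\alpha_j=0$ for all $0\le j\le N$, where $\overline\nabla$ is the Levi-Civita connection of $g$. For $x\in L$, put $\mathrm{H}_x=\mathrm{H}_{T_xL}=\mathrm{G}_x\cap(\mathrm{SO}(T_xL)\times\mathrm{SO}(N_xL))$ and $\mathfrak h_x=\mathfrak h_{T_xL}$. Extrinsic geometry. $NL$ is the normal bundle of $L$, $TM|_L=TL\oplus NL$; $\nabla=\pi_{TL}\circ\overline\nabla$ is the induced (Levi-Civita) connection on $TL$; $D=\pi_{NL}\circ\overline\nabla$ is the normal connection on $NL$; $A_uv=\pi_{NL}(\overline\nabla_uv)$ for $u,v\in\Gamma(TL)$ is the second fundamental form, and $A_u^*:NL\to TL$ is the adjoint of $A_u:TL\to NL$. $\widehat\nabla=\nabla\oplus D$ is extended to forms on $TM|_L$ in the usual way, and $\alpha_j$ is regarded along $L$ as a section of the appropriate exterior power of $(TM|_L)^*$ (not pulled back to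 a form on $L$). $B_u$ is a skew-adjoint endomorphism of $TM|_L$. The infinitesimal action is $(B_u\diamond\beta)(X_1,\dots,X_m)=\beta(B_uX_1,X_2,\dots,X_m)+\cdots+\beta(X_1,\dots,X_{m-1},B_uX_m)$ for an $m$-form $\beta$. *)

theory Defs
  imports "HOL-Analysis.Analysis"
begin

section \<open>Smooth maps between normed spaces\<close>

text \<open>For open sets of a finite-dimensional space, having continuous iterated directional
  derivatives of all orders is the usual notion of being smooth.\<close>

primrec Ck_on :: "nat \<Rightarrow> ('a::real_normed_vector \<Rightarrow> 'b::real_normed_vector) \<Rightarrow> 'a set \<Rightarrow> bool" where
  "Ck_on 0 f S \<longleftrightarrow> continuous_on S f"
| "Ck_on (Suc k) f S \<longleftrightarrow>
     f differentiable_on S \<and> (\<forall>v. Ck_on k (\<lambda>x. frechet_derivative f (at x) v) S)"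

definition smooth_on :: "('a::real_normed_vector \<Rightarrow> 'b::real_normed_vector) \<Rightarrow> 'a set \<Rightarrow> bool" where
  "smooth_on f S \<longleftrightarrow> open S \<and> (\<forall>k. Ck_on k f S)"


section \<open>Oriented manifolds, tangent spaces, smooth sections\<close>

type_synonym ('m, 'n) chart = "'m set \<times> ('m \<Rightarrow> real ^ 'n)"

abbreviation cdom :: "('m, 'n) chart \<Rightarrow> 'm set" where "cdom \<equiv> fst"

abbreviation cmap :: "('m, 'n) chart \<Rightarrow> 'm \<Rightarrow> real ^ 'n" where "cmap \<equiv> snd"

abbreviation crange :: "('m, 'n) chart \<Rightarrow> (real ^ 'n) set" where "crange c \<equiv> cmap c ` cdom c"

definition cinv :: "('m, 'n) chart \<Rightarrow> real ^ 'n \<Rightarrow> 'm" where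
  "cinv c = inv_into (cdom c) (cmap c)"

definition transition :: "('m, 'n) chart \<Rightarrow> ('m, 'n) chart \<Rightarrow> real ^ 'n \<Rightarrow> real ^ 'n" where
  "transition c c' = cmap c' \<circ> cinv c"

definition oriented_atlas ::
    "('m::{t2_space, second_countable_topology}, 'n::finite) chart set \<Rightarrow> bool" where
  "oriented_atlas A \<longleftrightarrow>
     (\<Union>c\<in>A. cdom c) = UNIV \<and>
     (\<forall>c\<in>A. open (cdom c) \<and> open (crange c) \<and>
        homeomorphism (cdom c) (crange c) (cmap c) (cinv c)) \<and>
     (\<forall>c\<in>A. \<forall>c'\<in>A. smooth_on (transition c c') (cmap c ` (cdom c \<inter> cdom c')) \<and>
        (\<forall>x\<in>cdom c \<inter> cdom c'.
           0 < det (matrix (frechet_derivative (transition c c') (at (cmap c x))))))"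

text \<open>Each point \<open>x\<close> gets a preferred chart, and the tangent space at \<open>x\<close> is the vector space
  \<open>real ^ 'n\<close>, identified by means of that chart.  Tensors at \<open>x\<close> are thus tensors on
  \<open>real ^ 'n\<close>, and the orientation of the tangent space is the standard one.
  The preferred chart changes with \<open>x\<close> in an uncontrolled way, so smoothness and derivatives
  always refer to the components with respect to one fixed chart.
  \<open>to_chart A c x\<close> sends a tangent vector at \<open>x\<close> to its components in the chart \<open>c\<close>, and
  \<open>of_chart A c x\<close> is the inverse map.\<close>

definition chart_at :: "('m, 'n) chart set \<Rightarrow> 'm \<Rightarrow> ('m, 'n) chart" where
  "chart_at A x = (SOME c. c \<in> A \<and> x \<in> cdom c)"

definition to_chart ::
    "('m, 'n::finite) chart set \<Rightarrow> ('m, 'n) chart \<Rightarrow> 'm \<Rightarrow> real ^ 'n \<Rightarrow> real ^ 'n" where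
  "to_chart A c x =
     frechet_derivative (transition (chart_at A x) c) (at (cmap (chart_at A x) x))"

definition of_chart ::
    "('m, 'n::finite) chart set \<Rightarrow> ('m, 'n) chart \<Rightarrow> 'm \<Rightarrow> real ^ 'n \<Rightarrow> real ^ 'n" where
  "of_chart A c x = frechet_derivative (transition c (chart_at A x)) (at (cmap c x))"

text \<open>The differential at \<open>p\<close> of a map \<open>F\<close> from a normed space to the manifold.\<close>

definition differential ::
    "('m, 'n::finite) chart set \<Rightarrow> ('p::real_normed_vector \<Rightarrow> 'm) \<Rightarrow> 'p \<Rightarrow> 'p \<Rightarrow> real ^ 'n" where
  "differential A F p = frechet_derivative (cmap (chart_at A (F p)) \<circ> F) (at p)"

definition smooth_map ::
    "('l::topological_space, 'k::finite) chart set \<Rightarrow> ('m::topological_space, 'n::finite) chart set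
      \<Rightarrow> ('l \<Rightarrow> 'm) \<Rightarrow> bool" where
  "smooth_map B A f \<longleftrightarrow> continuous_on UNIV f \<and>
     (\<forall>c\<in>B. \<forall>c'\<in>A. smooth_on (cmap c' \<circ> f \<circ> cinv c) (cmap c ` (cdom c \<inter> f -` cdom c')))"

text \<open>Smooth sections over the open set \<open>V\<close> of the pullback of the tangent bundle along \<open>f\<close>.
  For \<open>f = id\<close> these are the smooth vector fields on \<open>V\<close>.\<close>

definition smooth_section ::
    "('l, 'k::finite) chart set \<Rightarrow> ('m, 'n::finite) chart set \<Rightarrow> ('l \<Rightarrow> 'm)
      \<Rightarrow> 'l set \<Rightarrow> ('l \<Rightarrow> real ^ 'n) \<Rightarrow> bool" where
  "smooth_section B A f V X \<longleftrightarrow>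
     (\<forall>c\<in>B. \<forall>c'\<in>A. smooth_on (\<lambda>p. to_chart A c' (f (cinv c p)) (X (cinv c p)))
        (cmap c ` (V \<inter> cdom c \<inter> f -` cdom c')))"


section \<open>Differential forms\<close>

text \<open>An \<open>m\<close>-form takes a sequence of vectors, of which only the first \<open>m\<close> matter.\<close>

type_synonym 'v form = "(nat \<Rightarrow> 'v) \<Rightarrow> real"

definition alternating_form :: "nat \<Rightarrow> 'v::real_vector form \<Rightarrow> bool" where
  "alternating_form m \<beta> \<longleftrightarrow>
     (\<forall>X Y. (\<forall>i<m. X i = Y i) \<longrightarrow> \<beta> X = \<beta> Y) \<and>
     (\<forall>X. \<forall>i<m. linear (\<lambda>v. \<beta> (X(i := v)))) \<and>
     (\<forall>X i j. i < j \<longrightarrow> j < m \<longrightarrow> X i = X j \<longrightarrow> \<beta> X = 0)"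

definition form_in_chart ::
    "('m, 'n::finite) chart set \<Rightarrow> ('m \<Rightarrow> (real ^ 'n) form) \<Rightarrow> ('m, 'n) chart
      \<Rightarrow> real ^ 'n \<Rightarrow> (real ^ 'n) form" where
  "form_in_chart A \<beta> c p X = \<beta> (cinv c p) (\<lambda>i. of_chart A c (cinv c p) (X i))"

definition differential_form ::
    "('m, 'n::finite) chart set \<Rightarrow> nat \<Rightarrow> ('m \<Rightarrow> (real ^ 'n) form) \<Rightarrow> bool" where
  "differential_form A m \<beta> \<longleftrightarrow>
     (\<forall>x. alternating_form m (\<beta> x)) \<and>
     (\<forall>c\<in>A. \<forall>X. smooth_on (\<lambda>p. form_in_chart A \<beta> c p X) (crange c))"

text \<open>The exterior derivative in a chart, evaluated on the constant fields \<open>X 0, \<dots>, X m\<close>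
  (whose brackets vanish); the inner function omits the \<open>i\<close>-th one.\<close>

definition exterior_derivative_in_chart ::
    "('m, 'n::finite) chart set \<Rightarrow> nat \<Rightarrow> ('m \<Rightarrow> (real ^ 'n) form) \<Rightarrow> ('m, 'n) chart
      \<Rightarrow> real ^ 'n \<Rightarrow> (real ^ 'n) form" where
  "exterior_derivative_in_chart A m \<beta> c p X =
     (\<Sum>i\<le>m. (- 1) ^ i * frechet_derivative
        (\<lambda>q. form_in_chart A \<beta> c q (\<lambda>j. if j < i then X j else X (Suc j))) (at p) (X i))"

definition closed_form ::
    "('m, 'n::finite) chart set \<Rightarrow> nat \<Rightarrow> ('m \<Rightarrow> (real ^ 'n) form) \<Rightarrow> bool" where
  "closed_form A m \<beta> \<longleftrightarrow>
     (\<forall>c\<in>A. \<forall>p\<in>crange c. \<forall>X. exterior_derivative_in_chart A m \<beta> c p X = 0)"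

definition diamond :: "nat \<Rightarrow> ('v \<Rightarrow> 'v) \<Rightarrow> 'v form \<Rightarrow> 'v form" where
  "diamond m T \<beta> X = (\<Sum>i<m. \<beta> (X(i := T (X i))))"


section \<open>Riemannian metrics and the Levi-Civita connection\<close>

definition inner_product :: "('v::real_vector \<Rightarrow> 'v \<Rightarrow> real) \<Rightarrow> bool" where
  "inner_product b \<longleftrightarrow>
     (\<forall>v. linear (b v)) \<and> (\<forall>v w. b v w = b w v) \<and> (\<forall>v. v \<noteq> 0 \<longrightarrow> 0 < b v v)"

definition metric_in_chart ::
    "('m, 'n::finite) chart set \<Rightarrow> ('m \<Rightarrow> real ^ 'n \<Rightarrow> real ^ 'n \<Rightarrow> real) \<Rightarrow> ('m, 'n) chart
      \<Rightarrow> real ^ 'n \<Rightarrow> real ^ 'n \<Rightarrow> real ^ 'n \<Rightarrow> real" where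
  "metric_in_chart A g c p v w =
     g (cinv c p) (of_chart A c (cinv c p) v) (of_chart A c (cinv c p) w)"

definition riemannian_metric ::
    "('m, 'n::finite) chart set \<Rightarrow> ('m \<Rightarrow> real ^ 'n \<Rightarrow> real ^ 'n \<Rightarrow> real) \<Rightarrow> bool" where
  "riemannian_metric A g \<longleftrightarrow>
     (\<forall>x. inner_product (g x)) \<and>
     (\<forall>c\<in>A. \<forall>v w. smooth_on (\<lambda>p. metric_in_chart A g c p v w) (crange c))"

text \<open>The Christoffel symbols of a chart as a bilinear map: \<open>christoffel A g c p v w\<close> has the
  components \<open>\<Gamma>\<^sup>i\<^sub>j\<^sub>l v\<^sup>j w\<^sup>l\<close>.  The defining equation is the Koszul formula for constant fields.\<close>

definition christoffel ::
    "('m, 'n::finite) chart set \<Rightarrow> ('m \<Rightarrow> real ^ 'n \<Rightarrow> real ^ 'n \<Rightarrow> real) \<Rightarrow> ('m, 'n) chart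
      \<Rightarrow> real ^ 'n \<Rightarrow> real ^ 'n \<Rightarrow> real ^ 'n \<Rightarrow> real ^ 'n" where
  "christoffel A g c p v w =
     (THE y. \<forall>z. metric_in_chart A g c p y z =
        (frechet_derivative (\<lambda>q. metric_in_chart A g c q w z) (at p) v
         + frechet_derivative (\<lambda>q. metric_in_chart A g c q v z) (at p) w
         - frechet_derivative (\<lambda>q. metric_in_chart A g c q v w) (at p) z) / 2)"

text \<open>The Levi-Civita covariant derivative, at the parameter \<open>p\<close> and in the direction \<open>w\<close>, of a
  vector field \<open>s\<close> along a map \<open>F\<close> from a normed space to the manifold (so \<open>s q\<close> is tangent at
  \<open>F q\<close>).  It is computed in the preferred chart \<open>c\<close> of \<open>F p\<close>, for which \<open>to_chart A c (F p)\<close>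
  is the identity.  Taking for \<open>F\<close> an inverse chart, a parametrised submanifold or a
  curve gives the connection on the manifold and its pullbacks.\<close>

definition levi_civita ::
    "('m, 'n::finite) chart set \<Rightarrow> ('m \<Rightarrow> real ^ 'n \<Rightarrow> real ^ 'n \<Rightarrow> real)
      \<Rightarrow> ('p::real_normed_vector \<Rightarrow> 'm) \<Rightarrow> ('p \<Rightarrow> real ^ 'n) \<Rightarrow> 'p \<Rightarrow> 'p \<Rightarrow> real ^ 'n" where
  "levi_civita A g F s p w =
     (let c = chart_at A (F p)
      in frechet_derivative (\<lambda>q. to_chart A c (F q) (s q)) (at p) w
         + christoffel A g c (cmap c (F p)) (differential A F p w) (s p))"

text \<open>The covariant derivative of an \<open>m\<close>-form in the direction \<open>u\<close> (tangent at \<open>x\<close>),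
  evaluated on local vector fields \<open>Y 0, \<dots>, Y (m - 1)\<close>.\<close>

definition nabla_form ::
    "('m, 'n::finite) chart set \<Rightarrow> ('m \<Rightarrow> real ^ 'n \<Rightarrow> real ^ 'n \<Rightarrow> real)
      \<Rightarrow> nat \<Rightarrow> ('m \<Rightarrow> (real ^ 'n) form) \<Rightarrow> 'm \<Rightarrow> real ^ 'n \<Rightarrow> (nat \<Rightarrow> 'm \<Rightarrow> real ^ 'n) \<Rightarrow> real" where
  "nabla_form A g m \<beta> x u Y =
     (let c = chart_at A x
      in frechet_derivative (\<lambda>p. \<beta> (cinv c p) (\<lambda>i. Y i (cinv c p))) (at (cmap c x)) u
         - (\<Sum>i<m. \<beta> x ((\<lambda>l. Y l x)
              (i := levi_civita A g (cinv c) (Y i \<circ> cinv c) (cmap c x) u))))"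

definition parallel_form ::
    "('m::topological_space, 'n::finite) chart set \<Rightarrow> ('m \<Rightarrow> real ^ 'n \<Rightarrow> real ^ 'n \<Rightarrow> real)
      \<Rightarrow> nat \<Rightarrow> ('m \<Rightarrow> (real ^ 'n) form) \<Rightarrow> bool" where
  "parallel_form A g m \<beta> \<longleftrightarrow>
     (\<forall>V Y x u. open V \<longrightarrow> x \<in> V \<longrightarrow> (\<forall>i<m. smooth_section A A id V (Y i)) \<longrightarrow>
        nabla_form A g m \<beta> x u Y = 0)"


section \<open>Calibrations\<close>

text \<open>Oriented \<open>k\<close>-planes are given by bases \<open>X\<close> indexed by a type of cardinality \<open>k\<close>, ordered by
  a fixed enumeration of the index type.  For the plane \<open>W\<close> oriented by the basis \<open>X\<close> one has
  \<open>vol_W X = gram_vol b X\<close>, the square root of the Gram determinant.  Two \<open>k\<close>-forms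
  on \<open>W\<close> are compared by evaluating them on one positively oriented basis.\<close>

definition coord_enum :: "nat \<Rightarrow> 'k::finite" where
  "coord_enum = (SOME f. bij_betw f {..<CARD('k)} UNIV)"

definition eval_basis :: "'v form \<Rightarrow> ('k::finite \<Rightarrow> 'v) \<Rightarrow> real" where
  "eval_basis \<beta> X = \<beta> (\<lambda>i. X (coord_enum i))"

definition gram_vol :: "('v \<Rightarrow> 'v \<Rightarrow> real) \<Rightarrow> ('k::finite \<Rightarrow> 'v) \<Rightarrow> real" where
  "gram_vol b X = sqrt (det (\<chi> i j. b (X i) (X j) :: real ^ 'k ^ 'k))"

definition plane_basis :: "('k \<Rightarrow> 'v::real_vector) \<Rightarrow> bool" where
  "plane_basis X \<longleftrightarrow> inj X \<and> independent (range X)"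

definition calibrated ::
    "('v::real_vector \<Rightarrow> 'v \<Rightarrow> real) \<Rightarrow> 'v form \<Rightarrow> ('k::finite \<Rightarrow> 'v) \<Rightarrow> bool" where
  "calibrated b \<beta> X \<longleftrightarrow> plane_basis X \<and> eval_basis \<beta> X = gram_vol b X"

text \<open>A calibrated plane is recorded as a subspace: only one of its two orientations is
  calibrated.\<close>

definition calibrated_planes ::
    "'k::finite itself \<Rightarrow> ('v::real_vector \<Rightarrow> 'v \<Rightarrow> real) \<Rightarrow> 'v form \<Rightarrow> 'v set set" where
  "calibrated_planes _ b \<beta> = {span (range X) | X :: 'k \<Rightarrow> 'v. calibrated b \<beta> X}"

definition calibration ::
    "'k::finite itself \<Rightarrow> ('m, 'n::finite) chart set \<Rightarrow> ('m \<Rightarrow> real ^ 'n \<Rightarrow> real ^ 'n \<Rightarrow> real)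
      \<Rightarrow> ('m \<Rightarrow> (real ^ 'n) form) \<Rightarrow> bool" where
  "calibration K A g \<alpha> \<longleftrightarrow>
     differential_form A CARD('k) \<alpha> \<and> closed_form A CARD('k) \<alpha> \<and>
     (\<forall>x. (\<forall>X :: 'k \<Rightarrow> real ^ 'n. plane_basis X \<longrightarrow> eval_basis (\<alpha> x) X \<le> gram_vol (g x) X) \<and>
          calibrated_planes K (g x) (\<alpha> x) \<noteq> {})"


section \<open>Structure groups and compliance\<close>

text \<open>The operator exponential, evaluated pointwise.\<close>

definition op_exp :: "('v::real_normed_vector \<Rightarrow> 'v) \<Rightarrow> 'v \<Rightarrow> 'v" where
  "op_exp T v = (\<Sum>i. (T ^^ i) v /\<^sub>R fact i)"

text \<open>The Lie algebra of a Lie subgroup of the general linear group.\<close>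

definition lie_algebra :: "('v::real_normed_vector \<Rightarrow> 'v) set \<Rightarrow> ('v \<Rightarrow> 'v) set" where
  "lie_algebra G = {T. linear T \<and> (\<forall>t::real. op_exp (\<lambda>v. t *\<^sub>R T v) \<in> G)}"

definition SO :: "(real ^ 'n::finite \<Rightarrow> real ^ 'n \<Rightarrow> real) \<Rightarrow> (real ^ 'n \<Rightarrow> real ^ 'n) set" where
  "SO b = {P. linear P \<and> (\<forall>v w. b (P v) (P w) = b v w) \<and> det (matrix P) = 1}"

definition stabilizer ::
    "(real ^ 'n::finite \<Rightarrow> real ^ 'n \<Rightarrow> real) \<Rightarrow> nat \<Rightarrow> (nat \<Rightarrow> (real ^ 'n) form)
      \<Rightarrow> (real ^ 'n \<Rightarrow> real ^ 'n) set" where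
  "stabilizer b N \<phi> = {P \<in> SO b. \<forall>j\<le>N. \<forall>X. \<phi> j (\<lambda>i. P (X i)) = \<phi> j X}"

definition plane_stabilizer ::
    "(real ^ 'n::finite \<Rightarrow> real ^ 'n \<Rightarrow> real) \<Rightarrow> nat \<Rightarrow> (nat \<Rightarrow> (real ^ 'n) form)
      \<Rightarrow> (real ^ 'n) set \<Rightarrow> (real ^ 'n \<Rightarrow> real ^ 'n) set" where
  "plane_stabilizer b N \<phi> W = {P \<in> stabilizer b N \<phi>. P ` W = W}"

text \<open>The fixed forms on the model space are \<open>\<phi>\<close>, and the columns of \<open>E y\<close> are a smooth oriented
  orthonormal frame.  The structure group itself is the stabilizer of \<open>\<phi>\<close> in the
  special orthogonal group of the standard inner product.\<close>

definition G_structure ::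
    "('m::topological_space, 'n::finite) chart set \<Rightarrow> ('m \<Rightarrow> real ^ 'n \<Rightarrow> real ^ 'n \<Rightarrow> real)
      \<Rightarrow> nat \<Rightarrow> (nat \<Rightarrow> nat) \<Rightarrow> (nat \<Rightarrow> 'm \<Rightarrow> (real ^ 'n) form) \<Rightarrow> bool" where
  "G_structure A g N d \<alpha> \<longleftrightarrow>
     (\<exists>\<phi> :: nat \<Rightarrow> (real ^ 'n) form. (\<forall>j\<le>N. alternating_form (d j) (\<phi> j)) \<and>
       (\<forall>x. \<exists>V E. open V \<and> x \<in> V \<and>
          (\<forall>v. smooth_section A A id V (\<lambda>y. E y v)) \<and>
          (\<forall>y\<in>V. linear (E y) \<and> (\<forall>v w. g y (E y v) (E y w) = v \<bullet> w) \<and> 0 < det (matrix (E y)) \<and>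
             (\<forall>j\<le>N. \<forall>X. \<alpha> j y (\<lambda>i. E y (X i)) = \<phi> j X))))"

definition transitive_on_calibrated ::
    "'k::finite itself \<Rightarrow> ('m \<Rightarrow> real ^ 'n::finite \<Rightarrow> real ^ 'n \<Rightarrow> real)
      \<Rightarrow> nat \<Rightarrow> (nat \<Rightarrow> 'm \<Rightarrow> (real ^ 'n) form) \<Rightarrow> bool" where
  "transitive_on_calibrated K g N \<alpha> \<longleftrightarrow>
     (\<forall>x. \<forall>W \<in> calibrated_planes K (g x) (\<alpha> 0 x). \<forall>W' \<in> calibrated_planes K (g x) (\<alpha> 0 x).
        \<exists>P \<in> stabilizer (g x) N (\<lambda>j. \<alpha> j x). P ` W = W')"

definition perp :: "('v \<Rightarrow> 'v \<Rightarrow> real) \<Rightarrow> 'v set \<Rightarrow> 'v set" where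
  "perp b W = {v. \<forall>w\<in>W. b v w = 0}"

text \<open>The standard inner product on skew-adjoint endomorphisms, identified with bivectors; it is
  independent of the basis used to form the trace.\<close>

definition so_inner :: "(real ^ 'n::finite \<Rightarrow> real ^ 'n) \<Rightarrow> (real ^ 'n \<Rightarrow> real ^ 'n) \<Rightarrow> real" where
  "so_inner S T = - trace (matrix (S \<circ> T)) / 2"

text \<open>The summand \<open>W \<otimes> W\<^sup>\<bottom>\<close> of the bivectors: the skew-adjoint endomorphisms interchanging
  \<open>W\<close> and its orthogonal complement.\<close>

definition mixed_part :: "('v::real_vector \<Rightarrow> 'v \<Rightarrow> real) \<Rightarrow> 'v set \<Rightarrow> ('v \<Rightarrow> 'v) set" where
  "mixed_part b W =
     {T. linear T \<and> (\<forall>v w. b (T v) w = - b v (T w)) \<and> T ` W \<subseteq> perp b W \<and> T ` perp b W \<subseteq> W}"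

definition compliant ::
    "'k::finite itself \<Rightarrow> ('m \<Rightarrow> real ^ 'n::finite \<Rightarrow> real ^ 'n \<Rightarrow> real)
      \<Rightarrow> nat \<Rightarrow> (nat \<Rightarrow> 'm \<Rightarrow> (real ^ 'n) form) \<Rightarrow> bool" where
  "compliant K g N \<alpha> \<longleftrightarrow>
     (\<forall>x. \<forall>W \<in> calibrated_planes K (g x) (\<alpha> 0 x).
        {S \<in> lie_algebra (stabilizer (g x) N (\<lambda>j. \<alpha> j x)).
           \<forall>T \<in> lie_algebra (plane_stabilizer (g x) N (\<lambda>j. \<alpha> j x) W). so_inner S T = 0}
        = lie_algebra (stabilizer (g x) N (\<lambda>j. \<alpha> j x)) \<inter> mixed_part (g x) W)"

definition parallel_compliant ::
    "'k::finite itself \<Rightarrow> ('m::topological_space, 'n::finite) chart set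
      \<Rightarrow> ('m \<Rightarrow> real ^ 'n \<Rightarrow> real ^ 'n \<Rightarrow> real)
      \<Rightarrow> nat \<Rightarrow> (nat \<Rightarrow> nat) \<Rightarrow> (nat \<Rightarrow> 'm \<Rightarrow> (real ^ 'n) form) \<Rightarrow> bool" where
  "parallel_compliant K A g N d \<alpha> \<longleftrightarrow>
     compliant K g N \<alpha> \<and> (\<forall>j\<le>N. parallel_form A g (d j) (\<alpha> j))"


section \<open>Submanifolds and their extrinsic geometry\<close>

text \<open>The submanifold is a manifold \<open>'l\<close> with atlas \<open>B\<close> and inclusion \<open>\<iota>\<close>.
  \<open>tangent_map A B \<iota> y\<close> is the differential of the inclusion at \<open>y\<close>; it goes
  from \<open>real ^ 'k\<close>, the tangent space of \<open>'l\<close> at \<open>y\<close>, to the tangent space at \<open>\<iota> y\<close>.\<close>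

definition tangent_map ::
    "('m, 'n::finite) chart set \<Rightarrow> ('l, 'k::finite) chart set \<Rightarrow> ('l \<Rightarrow> 'm)
      \<Rightarrow> 'l \<Rightarrow> real ^ 'k \<Rightarrow> real ^ 'n" where
  "tangent_map A B \<iota> y = differential A (\<iota> \<circ> cinv (chart_at B y)) (cmap (chart_at B y) y)"

definition submanifold ::
    "('m::topological_space, 'n::finite) chart set \<Rightarrow> ('l::topological_space, 'k::finite) chart set
      \<Rightarrow> ('l \<Rightarrow> 'm) \<Rightarrow> bool" where
  "submanifold A B \<iota> \<longleftrightarrow> smooth_map B A \<iota> \<and> inj \<iota> \<and> (\<forall>y. inj (tangent_map A B \<iota> y))"

definition tangent_space ::
    "('m, 'n::finite) chart set \<Rightarrow> ('l, 'k::finite) chart set \<Rightarrow> ('l \<Rightarrow> 'm)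
      \<Rightarrow> 'l \<Rightarrow> (real ^ 'n) set" where
  "tangent_space A B \<iota> y = range (tangent_map A B \<iota> y)"

definition calibrated_submanifold ::
    "('m, 'n::finite) chart set \<Rightarrow> ('m \<Rightarrow> real ^ 'n \<Rightarrow> real ^ 'n \<Rightarrow> real)
      \<Rightarrow> ('l, 'k::finite) chart set \<Rightarrow> ('l \<Rightarrow> 'm) \<Rightarrow> ('m \<Rightarrow> (real ^ 'n) form) \<Rightarrow> bool" where
  "calibrated_submanifold A g B \<iota> \<alpha> \<longleftrightarrow>
     (\<forall>y. calibrated (g (\<iota> y)) (\<alpha> (\<iota> y)) (\<lambda>i. tangent_map A B \<iota> y (axis i 1)))"

definition proj :: "('v::real_vector \<Rightarrow> 'v \<Rightarrow> real) \<Rightarrow> 'v set \<Rightarrow> 'v \<Rightarrow> 'v" where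
  "proj b W v = (THE w. w \<in> W \<and> v - w \<in> perp b W)"

definition proj_T ::
    "('m, 'n::finite) chart set \<Rightarrow> ('m \<Rightarrow> real ^ 'n \<Rightarrow> real ^ 'n \<Rightarrow> real)
      \<Rightarrow> ('l, 'k::finite) chart set \<Rightarrow> ('l \<Rightarrow> 'm) \<Rightarrow> 'l \<Rightarrow> real ^ 'n \<Rightarrow> real ^ 'n" where
  "proj_T A g B \<iota> y = proj (g (\<iota> y)) (tangent_space A B \<iota> y)"

definition proj_N ::
    "('m, 'n::finite) chart set \<Rightarrow> ('m \<Rightarrow> real ^ 'n \<Rightarrow> real ^ 'n \<Rightarrow> real)
      \<Rightarrow> ('l, 'k::finite) chart set \<Rightarrow> ('l \<Rightarrow> 'm) \<Rightarrow> 'l \<Rightarrow> real ^ 'n \<Rightarrow> real ^ 'n" where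
  "proj_N A g B \<iota> y v = v - proj_T A g B \<iota> y v"

text \<open>The connection on the tangent bundle plus the normal connection, for a section \<open>s\<close>
  of the restricted tangent bundle along a map \<open>\<kappa>\<close> from a normed space to the submanifold.\<close>

definition hat_nabla ::
    "('m, 'n::finite) chart set \<Rightarrow> ('m \<Rightarrow> real ^ 'n \<Rightarrow> real ^ 'n \<Rightarrow> real)
      \<Rightarrow> ('l, 'k::finite) chart set \<Rightarrow> ('l \<Rightarrow> 'm)
      \<Rightarrow> ('p::real_normed_vector \<Rightarrow> 'l) \<Rightarrow> ('p \<Rightarrow> real ^ 'n) \<Rightarrow> 'p \<Rightarrow> 'p \<Rightarrow> real ^ 'n" where
  "hat_nabla A g B \<iota> \<kappa> s p w =
     proj_T A g B \<iota> (\<kappa> p)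
       (levi_civita A g (\<iota> \<circ> \<kappa>) (\<lambda>q. proj_T A g B \<iota> (\<kappa> q) (s q)) p w)
     + proj_N A g B \<iota> (\<kappa> p)
       (levi_civita A g (\<iota> \<circ> \<kappa>) (\<lambda>q. proj_N A g B \<iota> (\<kappa> q) (s q)) p w)"

text \<open>The induced derivative of a form on the restricted tangent bundle in the direction \<open>u\<close>
  (tangent to \<open>'l\<close> at \<open>y\<close>), evaluated on local sections \<open>X 0, \<dots>, X (m - 1)\<close>.\<close>

definition hat_nabla_form ::
    "('m, 'n::finite) chart set \<Rightarrow> ('m \<Rightarrow> real ^ 'n \<Rightarrow> real ^ 'n \<Rightarrow> real)
      \<Rightarrow> ('l, 'k::finite) chart set \<Rightarrow> ('l \<Rightarrow> 'm) \<Rightarrow> nat \<Rightarrow> ('l \<Rightarrow> (real ^ 'n) form)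
      \<Rightarrow> 'l \<Rightarrow> real ^ 'k \<Rightarrow> (nat \<Rightarrow> 'l \<Rightarrow> real ^ 'n) \<Rightarrow> real" where
  "hat_nabla_form A g B \<iota> m \<beta> y u X =
     (let c = chart_at B y
      in frechet_derivative (\<lambda>p. \<beta> (cinv c p) (\<lambda>i. X i (cinv c p))) (at (cmap c y)) u
         - (\<Sum>i<m. \<beta> y ((\<lambda>l. X l y)
              (i := hat_nabla A g B \<iota> (cinv c) (X i \<circ> cinv c) (cmap c y) u))))"

definition hat_parallel_form ::
    "('m, 'n::finite) chart set \<Rightarrow> ('m \<Rightarrow> real ^ 'n \<Rightarrow> real ^ 'n \<Rightarrow> real)
      \<Rightarrow> ('l::topological_space, 'k::finite) chart set \<Rightarrow> ('l \<Rightarrow> 'm)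
      \<Rightarrow> nat \<Rightarrow> ('l \<Rightarrow> (real ^ 'n) form) \<Rightarrow> bool" where
  "hat_parallel_form A g B \<iota> m \<beta> \<longleftrightarrow>
     (\<forall>V X y u. open V \<longrightarrow> y \<in> V \<longrightarrow> (\<forall>i<m. smooth_section B A \<iota> V (X i)) \<longrightarrow>
        hat_nabla_form A g B \<iota> m \<beta> y u X = 0)"

text \<open>The second fundamental form at \<open>y\<close>, with both arguments in the tangent space
  \<open>real ^ 'k\<close> of \<open>'l\<close> at \<open>y\<close>.  Being tensorial, it may be computed by extending
  \<open>v\<close> to the field with constant components in the preferred chart of \<open>y\<close>.\<close>

definition second_fundamental_form ::
    "('m, 'n::finite) chart set \<Rightarrow> ('m \<Rightarrow> real ^ 'n \<Rightarrow> real ^ 'n \<Rightarrow> real)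
      \<Rightarrow> ('l, 'k::finite) chart set \<Rightarrow> ('l \<Rightarrow> 'm) \<Rightarrow> 'l \<Rightarrow> real ^ 'k \<Rightarrow> real ^ 'k \<Rightarrow> real ^ 'n" where
  "second_fundamental_form A g B \<iota> y u v =
     (let F = \<iota> \<circ> cinv (chart_at B y)
      in proj_N A g B \<iota> y
           (levi_civita A g F (\<lambda>q. differential A F q v) (cmap (chart_at B y) y) u))"

definition shape_adjoint ::
    "('m, 'n::finite) chart set \<Rightarrow> ('m \<Rightarrow> real ^ 'n \<Rightarrow> real ^ 'n \<Rightarrow> real)
      \<Rightarrow> ('l, 'k::finite) chart set \<Rightarrow> ('l \<Rightarrow> 'm) \<Rightarrow> 'l \<Rightarrow> real ^ 'k \<Rightarrow> real ^ 'n \<Rightarrow> real ^ 'n" where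
  "shape_adjoint A g B \<iota> y u \<xi> =
     (THE \<tau>. \<tau> \<in> tangent_space A B \<iota> y \<and>
        (\<forall>v. g (\<iota> y) \<tau> (tangent_map A B \<iota> y v)
               = g (\<iota> y) \<xi> (second_fundamental_form A g B \<iota> y u v)))"

definition B_op ::
    "('m, 'n::finite) chart set \<Rightarrow> ('m \<Rightarrow> real ^ 'n \<Rightarrow> real ^ 'n \<Rightarrow> real)
      \<Rightarrow> ('l, 'k::finite) chart set \<Rightarrow> ('l \<Rightarrow> 'm) \<Rightarrow> 'l \<Rightarrow> real ^ 'k \<Rightarrow> real ^ 'n \<Rightarrow> real ^ 'n" where
  "B_op A g B \<iota> y u X =
     - shape_adjoint A g B \<iota> y u (proj_N A g B \<iota> y X)
     + second_fundamental_form A g B \<iota> y u (inv (tangent_map A B \<iota> y) (proj_T A g B \<iota> y X))"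


section \<open>Restricted holonomy\<close>

definition smooth_curve :: "('l, 'k::finite) chart set \<Rightarrow> real set \<Rightarrow> (real \<Rightarrow> 'l) \<Rightarrow> bool" where
  "smooth_curve B I \<sigma> \<longleftrightarrow> (\<forall>c\<in>B. smooth_on (cmap c \<circ> \<sigma>) (I \<inter> \<sigma> -` cdom c))"

text \<open>Every piece is smooth up to and including its end points.\<close>

definition piecewise_smooth :: "('l, 'k::finite) chart set \<Rightarrow> (real \<Rightarrow> 'l) \<Rightarrow> bool" where
  "piecewise_smooth B \<gamma> \<longleftrightarrow>
     (\<exists>(r::nat) a. a 0 = 0 \<and> a r = (1::real) \<and>
        (\<forall>i<r. a i < a (Suc i) \<and>
           (\<exists>e \<sigma>. 0 < e \<and> smooth_curve B {a i - e <..< a (Suc i) + e} \<sigma> \<and>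
              (\<forall>t\<in>{a i..a (Suc i)}. \<gamma> t = \<sigma> t))))"

definition parallel_along ::
    "('m, 'n::finite) chart set \<Rightarrow> ('m \<Rightarrow> real ^ 'n \<Rightarrow> real ^ 'n \<Rightarrow> real)
      \<Rightarrow> ('l, 'k::finite) chart set \<Rightarrow> ('l \<Rightarrow> 'm)
      \<Rightarrow> (real \<Rightarrow> 'l) \<Rightarrow> (real \<Rightarrow> real ^ 'n) \<Rightarrow> bool" where
  "parallel_along A g B \<iota> \<gamma> s \<longleftrightarrow>
     (\<forall>c\<in>A. continuous_on {t \<in> {0..1}. \<iota> (\<gamma> t) \<in> cdom c} (\<lambda>t. to_chart A c (\<iota> (\<gamma> t)) (s t))) \<and>
     (\<exists>S. finite S \<and> (\<forall>t\<in>{0<..<1} - S.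
        (\<lambda>q. to_chart A (chart_at A (\<iota> (\<gamma> t))) (\<iota> (\<gamma> q)) (s q)) differentiable (at t) \<and>
        hat_nabla A g B \<iota> \<gamma> s t 1 = 0))"

text \<open>The parallel transport maps around null-homotopic loops at \<open>y\<close>.\<close>

definition restricted_holonomy ::
    "('m, 'n::finite) chart set \<Rightarrow> ('m \<Rightarrow> real ^ 'n \<Rightarrow> real ^ 'n \<Rightarrow> real)
      \<Rightarrow> ('l::topological_space, 'k::finite) chart set \<Rightarrow> ('l \<Rightarrow> 'm)
      \<Rightarrow> 'l \<Rightarrow> (real ^ 'n \<Rightarrow> real ^ 'n) set" where
  "restricted_holonomy A g B \<iota> y =
     {P. linear P \<and>
        (\<exists>\<gamma>. piecewise_smooth B \<gamma> \<and> \<gamma> 0 = y \<and> \<gamma> 1 = y \<and> homotopic_paths UNIV \<gamma> (\<lambda>_. y) \<and>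
           (\<forall>v. \<exists>s. parallel_along A g B \<iota> \<gamma> s \<and> s 0 = v \<and> s 1 = P v))}"

end

(*
Near a point x of M an adapted orthonormal frame identifies all tangent spaces with T_xM,
preserving the metric and the forms.  Its connection form is skew-adjoint and, since the forms are
parallel and constant in the frame, annihilates them: it lies in g_x.  Under this identification
the tangent planes of L move inside Gr_{alpha_x}, a single orbit of G_x, and their velocity,
corrected by the connection form, is the second fundamental form A_u.  So A_u is the restriction to
T_xL of an element of g_x.

To see this without using that orbits are submanifolds, write the planes near W = T_xL as P_n(W)
with P_n in G_x of maximal trace.  Maximality makes P_n orthogonal to h_W and forces P_n to tend
to the identity, so the rescaled differences P_n - 1 subconverge to an element of g_x orthogonal to
h_W; by compliance it exchanges W and its complement, hence equals B_u up to scale.  That G_x is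
cut out by equations replaces the closed subgroup theorem: g_x consists of the skew-adjoint T with
T<>alpha_j = 0 for all j.

Hence B_u lies in g_x, and the hat connection, which is the Levi-Civita connection minus B_u, makes
the forms parallel.  Along a curve in L the metric, the forms and the length of the normal part
are then constant on parallel sections, and the orientation is preserved by continuity.
*)

theory Submission
  imports Defs
begin

section \<open>Multilinear forms and the operator exponential\<close>

text \<open>A curve of planes in an orbit comes without a curve of group elements: each
  \<open>P_n\<close> may be altered by any element of the plane stabilizer H_W. The trace removes
  this freedom. Its derivative along right translations by H_W is the trace pairing with h_W, so a
  maximum is orthogonal to h_W. Moreover, a limit P of the \<open>P_n\<close> preserves W, so
  \<open>P_n\<close> composed with the inverse of P is a competitor; passing to the limit gives n <=
  trace P, and among isometries only the identity has trace at least n.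

  The speed of \<open>P_n\<close> is unknown as well, so differences are divided by time plus
  distance to the identity. If the limit had no time component, it would map the complement of W
  into itself, while compliance makes it exchange W with its complement; it would vanish, against
  the normalisation.

  For the holonomy, no solution theory of differential equations enters. The parallel sections are
  given together with the transport map, and each condition defining H_x is the conservation of a
  quantity along them: inner products, forms, the sign of a determinant, and the length of the
  normal part, which vanishes exactly on tangent vectors.\<close>

lemma alternating_form_expand:
  fixes \<beta> :: "'v::euclidean_space form"
  assumes "alternating_form m \<beta>" and "i < m"
  shows "\<beta> (X(i := v)) = (\<Sum>b\<in>Basis. (v \<bullet> b) * \<beta> (X(i := b)))"
proof -
  have lin: "linear (\<lambda>v. \<beta> (X(i := v)))"
    using assms by (auto simp: alternating_form_def)
  have "\<beta> (X(i := v)) = \<beta> (X(i := (\<Sum>b\<in>Basis. (v \<bullet> b) *\<^sub>R b)))"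
    by (simp add: euclidean_representation)
  also have "\<dots> = (\<Sum>b\<in>Basis. (v \<bullet> b) * \<beta> (X(i := b)))"
    using linear_sum[OF lin, of "\<lambda>b. (v \<bullet> b) *\<^sub>R b" Basis] linear_scale[OF lin] by simp
  finally show ?thesis .
qed

lemma alternating_form_cong:
  "alternating_form m \<beta> \<Longrightarrow> (\<And>i. i < m \<Longrightarrow> X i = Y i) \<Longrightarrow> \<beta> X = \<beta> Y"
  by (auto simp: alternating_form_def)

lemma alternating_form_linear:
  "alternating_form m \<beta> \<Longrightarrow> i < m \<Longrightarrow> linear (\<lambda>v. \<beta> (X(i := v)))"
  by (auto simp: alternating_form_def)

text \<open>This is the Leibniz rule. A form is a bare function on infinite sequences, so it is
  obtained from separate linearity, by expanding one slot at a time in a basis.\<close>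

lemma alternating_form_has_derivative:
  fixes \<beta> :: "'v::euclidean_space form"
  assumes alt: "alternating_form m \<beta>"
    and der: "\<And>i. i < m \<Longrightarrow> ((\<lambda>q. X q i) has_derivative X' i) (at p within S)"
  shows "((\<lambda>q. \<beta> (X q)) has_derivative (\<lambda>w. \<Sum>i<m. \<beta> ((X p)(i := X' i w)))) (at p within S)"
proof -
  define Y where "Y k Z q = (\<lambda>i. if i < k then X q i else Z i)" for k and Z :: "nat \<Rightarrow> 'v" and q
  have step: "((\<lambda>q. \<beta> (Y k Z q)) has_derivative (\<lambda>w. \<Sum>i<k. \<beta> ((Y k Z p)(i := X' i w))))
      (at p within S)" if "k \<le> m" for k Z
    using that
  proof (induction k arbitrary: Z)
    case 0
    then show ?case by (simp add: Y_def)
  next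
    case (Suc k)
    have km: "k < m" using Suc.prems by simp
    have Y_Suc: "Y (Suc k) Z q = (Y k Z q)(k := X q k)" for q
      by (auto simp: Y_def fun_eq_iff)
    have Y_upd: "(Y k Z q)(k := v) = Y k (Z(k := v)) q" for q v
      by (auto simp: Y_def fun_eq_iff)
    have eq: "\<beta> (Y (Suc k) Z q) = (\<Sum>b\<in>Basis. (X q k \<bullet> b) * \<beta> (Y k (Z(k := b)) q))" for q
      using alternating_form_expand[OF alt km, of "Y k Z q" "X q k"] unfolding Y_Suc Y_upd .
    have "((\<lambda>q. \<Sum>b\<in>Basis. (X q k \<bullet> b) * \<beta> (Y k (Z(k := b)) q)) has_derivative
        (\<lambda>w. \<Sum>b\<in>Basis. (X p k \<bullet> b) * (\<Sum>i<k. \<beta> ((Y k (Z(k := b)) p)(i := X' i w)))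
            + (X' k w \<bullet> b) * \<beta> (Y k (Z(k := b)) p))) (at p within S)"
      by (intro has_derivative_sum has_derivative_mult has_derivative_inner_left der[OF km]
        Suc.IH[OF less_imp_le[OF km]])
    moreover have "(\<Sum>b\<in>Basis. (X p k \<bullet> b) * (\<Sum>i<k. \<beta> ((Y k (Z(k := b)) p)(i := X' i w)))
            + (X' k w \<bullet> b) * \<beta> (Y k (Z(k := b)) p))
         = (\<Sum>i<Suc k. \<beta> ((Y (Suc k) Z p)(i := X' i w)))" for w
    proof -
      have "(\<Sum>b\<in>Basis. (X' k w \<bullet> b) * \<beta> (Y k (Z(k := b)) p)) = \<beta> ((Y (Suc k) Z p)(k := X' k w))"
        using alternating_form_expand[OF alt km, of "Y k Z p" "X' k w"]
        unfolding Y_Suc fun_upd_upd by (simp only: Y_upd)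
      moreover have "(\<Sum>b\<in>Basis. (X p k \<bullet> b) * \<beta> ((Y k (Z(k := b)) p)(i := X' i w)))
          = \<beta> ((Y (Suc k) Z p)(i := X' i w))" if "i < k" for i
      proof -
        have "(Y (Suc k) Z p)(i := X' i w) = ((Y k Z p)(i := X' i w))(k := X p k)"
          using that by (auto simp: Y_Suc fun_upd_twist)
        moreover have "(Y k (Z(k := b)) p)(i := X' i w) = ((Y k Z p)(i := X' i w))(k := b)" for b
          unfolding Y_upd[symmetric] using that by (auto simp: fun_upd_twist)
        ultimately show ?thesis
          using alternating_form_expand[OF alt km, of "(Y k Z p)(i := X' i w)" "X p k"] by simp
      qed
      ultimately show ?thesis
        by (simp add: sum.distrib sum_distrib_left sum.swap[of _ "{..<k}"])
    qed
    ultimately show ?case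
      unfolding eq by (simp only:)
  qed
  have "\<beta> (X q) = \<beta> (Y m (\<lambda>_. 0) q)" for q
    by (rule alternating_form_cong[OF alt]) (simp add: Y_def)
  moreover have "\<beta> ((X p)(i := v)) = \<beta> ((Y m (\<lambda>_. 0) p)(i := v))" for i v
    by (rule alternating_form_cong[OF alt]) (simp add: Y_def)
  ultimately show ?thesis
    using step[of m "\<lambda>_. 0"] by simp
qed

lemma linear_expand:
  fixes f :: "real ^ 'n::finite \<Rightarrow> 'b::real_vector"
  assumes "linear f"
  shows "f v = (\<Sum>i\<in>UNIV. (v $ i) *\<^sub>R f (axis i 1))"
  using linear_sum[OF assms, of "\<lambda>i. (v $ i) *\<^sub>R axis i 1" UNIV] linear_scale[OF assms]
    basis_expansion[of v] by (simp add: scalar_mult_eq_scaleR)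

section \<open>The operator exponential and its derivative\<close>

lemma op_exp_summable:
  fixes T :: "'v::euclidean_space \<Rightarrow> 'v"
  assumes "linear T"
  shows "summable (\<lambda>i. norm ((T ^^ i) v /\<^sub>R fact i))"
proof -
  obtain K where K: "\<And>v. norm (T v) \<le> norm v * K" "K \<ge> 0"
    using bounded_linear.nonneg_bounded[OF linear_conv_bounded_linear[THEN iffD1, OF assms]] by
        blast
  have pow: "norm ((T ^^ i) v) \<le> norm v * K ^ i" for i
  proof (induction i)
    case (Suc i)
    have "norm ((T ^^ Suc i) v) \<le> norm ((T ^^ i) v) * K" using K(1) by simp
    also have "\<dots> \<le> (norm v * K ^ i) * K" using Suc K(2) by (rule mult_right_mono)
    finally show ?case by (simp add: mult_ac)
  qed simp
  have "summable (\<lambda>i. norm v * (inverse (fact i) * K ^ i))"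
    by (intro summable_mult summable_exp)
  then show ?thesis
  proof (rule summable_comparison_test'[where N = 0])
    show "norm (norm ((T ^^ i) v /\<^sub>R fact i)) \<le> norm v * (inverse (fact i) * K ^ i)" for i
      using pow[of i] by (simp add: field_simps)
  qed
qed

lemma linear_funpow:
  fixes T :: "'v::real_vector \<Rightarrow> 'v"
  assumes "linear T"
  shows "linear (T ^^ i)"
proof (induction i)
  case 0
  show ?case by (auto intro!: linearI)
next
  case (Suc i)
  then have "linear (T \<circ> T ^^ i)" using assms by (intro linear_compose)
  then show ?case by (simp only: funpow.simps)
qed

lemma funpow_scaleR:
  fixes T :: "'v::real_vector \<Rightarrow> 'v"
  shows "linear T \<Longrightarrow> ((\<lambda>v. t *\<^sub>R T v) ^^ i) v = t ^ i *\<^sub>R (T ^^ i) v"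
  by (induction i) (auto simp: linear_scale)

lemma linear_scaleR_comp: "linear T \<Longrightarrow> linear (\<lambda>v. t *\<^sub>R T v)"
  by (auto intro!: linearI simp: linear_add linear_scale scaleR_right_distrib)

lemma linear_op_exp:
  fixes T :: "'v::euclidean_space \<Rightarrow> 'v"
  assumes "linear T"
  shows "linear (op_exp T)"
proof (rule linearI)
  note sm = summable_norm_cancel[OF op_exp_summable[OF assms]]
  show "op_exp T (v + w) = op_exp T v + op_exp T w" for v w
    unfolding op_exp_def using suminf_add[OF sm sm, of v w] linear_add[OF linear_funpow[OF assms]]
    by (simp add: scaleR_right_distrib)
  show "op_exp T (r *\<^sub>R v) = r *\<^sub>R op_exp T v" for r v
    unfolding op_exp_def using suminf_scaleR_right[OF sm, of r v]
      linear_scale[OF linear_funpow[OF assms]]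
    by (simp add: mult.commute)
qed

lemma op_exp_commute:
  fixes T :: "'v::euclidean_space \<Rightarrow> 'v"
  assumes "linear T"
  shows "op_exp (\<lambda>v. t *\<^sub>R T v) (T v) = T (op_exp (\<lambda>v. t *\<^sub>R T v) v)"
proof -
  note sm = summable_norm_cancel[OF op_exp_summable[OF linear_scaleR_comp[OF assms]]]
  have bl: "bounded_linear T" using assms by (simp add: linear_conv_bounded_linear)
  have "T (op_exp (\<lambda>v. t *\<^sub>R T v) v) = (\<Sum>i. T (((\<lambda>v. t *\<^sub>R T v) ^^ i) v /\<^sub>R fact i))"
    unfolding op_exp_def using bounded_linear.suminf[OF bl sm] by simp
  also have "\<dots> = op_exp (\<lambda>v. t *\<^sub>R T v) (T v)"
    unfolding op_exp_def funpow_scaleR[OF assms]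
    by (simp add: linear_scale[OF assms] funpow_swap1)
  finally show ?thesis ..
qed

lemma op_exp_0: "op_exp (\<lambda>v. 0 *\<^sub>R T v) v = (v :: 'v::real_normed_vector)"
proof -
  have "((\<lambda>v. 0 *\<^sub>R T v) ^^ i) v /\<^sub>R fact i = (if i = 0 then v else 0)" for i
    by (cases i) auto
  then show ?thesis
    unfolding op_exp_def using suminf_finite[of "{0}" "\<lambda>i. if i = 0 then v else 0"] by simp
qed

text \<open>Paired with a basis vector, the exponential is a real power series in t. Its formal
  derivative is the series belonging to \<open>T v\<close>, so differentiation of power series
  applies, and \<open>op_exp_commute\<close> moves T to the outside.\<close>

lemma op_exp_has_vector_derivative:
  fixes T :: "'v::euclidean_space \<Rightarrow> 'v"
  assumes "linear T"
  shows "((\<lambda>t. op_exp (\<lambda>v. t *\<^sub>R T v) v) has_vector_derivative T (op_exp (\<lambda>v. t *\<^sub>R T v) v)) (at t)"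
proof -
  note sm = summable_norm_cancel[OF op_exp_summable[OF linear_scaleR_comp[OF assms]]]
  define c where "c b v i = (((T ^^ i) v) \<bullet> b) / fact i" for b v i
  have summand: "(((\<lambda>v. t *\<^sub>R T v) ^^ i) v /\<^sub>R fact i) \<bullet> b = c b v i * t ^ i" for b v i t
    by (simp add: funpow_scaleR[OF assms] c_def field_simps)
  have sumc: "summable (\<lambda>i. c b v i * t ^ i)" for b v t
    unfolding summand[symmetric] by (rule bounded_linear.summable[OF bounded_linear_inner_left sm])
  have inner: "op_exp (\<lambda>v. t *\<^sub>R T v) v \<bullet> b = (\<Sum>i. c b v i * t ^ i)" for b v t
    unfolding op_exp_def bounded_linear.suminf[OF bounded_linear_inner_left sm] summand ..
  have diffs: "diffs (c b v) i = c b (T v) i" for b i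
  proof -
    have "(T ^^ Suc i) v = (T ^^ i) (T v)" by (simp add: funpow_swap1)
    moreover have "real (Suc i) * (x / fact (Suc i)) = x / fact i" for x
      by (simp add: divide_simps)
    ultimately show ?thesis unfolding diffs_def c_def of_nat_Suc[symmetric] by metis
  qed
  have "((\<lambda>t. op_exp (\<lambda>v. t *\<^sub>R T v) v \<bullet> b) has_real_derivative T (op_exp (\<lambda>v. t *\<^sub>R T v) v) \<bullet> b)
      (at t)" for b
    unfolding op_exp_commute[OF assms, symmetric] inner
    using termdiffs_strong_converges_everywhere[OF sumc, of b v t] unfolding diffs .
  then show ?thesis
    unfolding has_vector_derivative_def
    by (subst has_derivative_componentwise_within) (auto simp: has_field_derivative_def
        mult_commute_abs)
qed

lemma op_exp_has_derivative:
  fixes T :: "'v::euclidean_space \<Rightarrow> 'v"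
  shows "linear T \<Longrightarrow> ((\<lambda>t. op_exp (\<lambda>v. t *\<^sub>R T v) v) has_derivative
     (\<lambda>s. s *\<^sub>R T (op_exp (\<lambda>v. t *\<^sub>R T v) v))) (at t)"
  using op_exp_has_vector_derivative[of T v t] by (simp add: has_vector_derivative_def)

text \<open>The derivative is needed at every t: a vanishing \<open>diamond\<close> then makes the
  form constant along the whole one-parameter group, while at t = 0 the derivative is
  \<open>diamond\<close> itself.\<close>

lemma op_exp_form_has_derivative:
  fixes \<beta> :: "'v::euclidean_space form"
  assumes "linear T" "alternating_form m \<beta>"
  shows "((\<lambda>t. \<beta> (\<lambda>i. op_exp (\<lambda>v. t *\<^sub>R T v) (X i))) has_real_derivative
     diamond m T \<beta> (\<lambda>i. op_exp (\<lambda>v. t *\<^sub>R T v) (X i))) (at t)"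
  unfolding has_field_derivative_def
proof (rule has_derivative_eq_rhs[OF alternating_form_has_derivative[OF assms(2)]])
  show "(\<lambda>s. \<Sum>i<m. \<beta> ((\<lambda>i. op_exp (\<lambda>v. t *\<^sub>R T v) (X i))
          (i := s *\<^sub>R T (op_exp (\<lambda>v. t *\<^sub>R T v) (X i)))))
      = (*) (diamond m T \<beta> (\<lambda>i. op_exp (\<lambda>v. t *\<^sub>R T v) (X i)))"
    using linear_scale[OF alternating_form_linear[OF assms(2)]]
    by (auto simp: fun_eq_iff diamond_def sum_distrib_left mult.commute intro!: sum.cong)
qed (rule op_exp_has_derivative[OF assms(1)])

section \<open>Stabilizers and their Lie algebras\<close>

lemma perpD: "v \<in> perp b W \<Longrightarrow> w \<in> W \<Longrightarrow> b v w = 0"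
  by (simp add: perp_def)

text \<open>These are the linearised equations of the stabilizer. Later membership proofs use this
  form; \<open>lie_algebra_stabilizer\<close> translates it to one-parameter groups.\<close>

definition infinitesimal_stabilizer ::
    "('v::real_vector \<Rightarrow> 'v \<Rightarrow> real) \<Rightarrow> nat \<Rightarrow> (nat \<Rightarrow> nat) \<Rightarrow> (nat \<Rightarrow> 'v form) \<Rightarrow> ('v \<Rightarrow> 'v) set" where
  "infinitesimal_stabilizer b N d \<phi> =
     {T. linear T \<and> (\<forall>v w. b (T v) w = - b v (T w)) \<and> (\<forall>j\<le>N. \<forall>X. diamond (d j) T (\<phi> j) X = 0)}"

lemma continuous_on_det_matrix:
  fixes P :: "'t::topological_space \<Rightarrow> real ^ 'n::finite \<Rightarrow> real ^ 'n"
  assumes "\<And>v. continuous_on S (\<lambda>t. P t v)"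
  shows "continuous_on S (\<lambda>t. det (matrix (P t)))"
  unfolding det_def matrix_def
  by (auto intro!: continuous_intros continuous_on_vec_lambda continuous_on_component assms)

section \<open>Euclidean geometry seen through an orthonormal frame\<close>

locale orthonormal_frame =
  fixes b :: "real ^ 'n::finite \<Rightarrow> real ^ 'n \<Rightarrow> real" and E :: "real ^ 'n \<Rightarrow> real ^ 'n"
  assumes linear_E: "linear E"
    and frame_isometry: "b (E v) (E w) = v \<bullet> w"
begin

lemma inj_E: "inj E"
proof (rule injI)
  fix v w assume "E v = E w"
  then have "E (v - w) = E 0" by (simp add: linear_diff[OF linear_E] linear_0[OF linear_E])
  then have "(v - w) \<bullet> (v - w) = 0"
    using frame_isometry[of "v - w" "v - w"] frame_isometry[of 0 0] by simp
  then show "v = w" by simp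
qed

lemma surj_E: "surj E"
  using linear_injective_imp_surjective[OF linear_E inj_E] by simp

lemma E_inv [simp]: "E (inv E v) = v"
  by (rule surj_f_inv_f[OF surj_E])

lemma inv_E [simp]: "inv E (E v) = v"
  by (rule inv_f_f[OF inj_E])

lemma linear_inv_E: "linear (inv E)"
  by (rule linearI)
    (metis E_inv inv_E linear_add[OF linear_E], metis E_inv inv_E linear_scale[OF linear_E])

lemma b_eq: "b v w = inv E v \<bullet> inv E w"
  using frame_isometry[of "inv E v" "inv E w"] by simp

text \<open>Nothing is assumed of \<open>b\<close> beyond the frame identity. Bilinearity, symmetry
  and positivity are all inherited from the dot product by way of the bijection
  \<open>E\<close>.\<close>

sublocale bb: bounded_bilinear b
proof -
  have bl: "bounded_linear (inv E)"
    using linear_inv_E by (simp add: linear_conv_bounded_linear)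
  show "bounded_bilinear b"
    using bounded_bilinear.comp[OF bounded_bilinear_inner bl bl]
    by (simp add: b_eq[abs_def])
qed

lemma b_commute: "b v w = b w v"
  by (simp add: b_eq inner_commute)

lemma b_self_nonneg: "0 \<le> b v v"
  by (simp add: b_eq)

lemma b_self_eq_0 [simp]: "b v v = 0 \<longleftrightarrow> v = 0"
proof
  assume "b v v = 0"
  then have "inv E v = 0" by (simp add: b_eq)
  then show "v = 0" by (metis E_inv linear_0[OF linear_E])
qed (simp add: bb.zero_left)

lemma b_eqI: "(\<And>z. b v z = b w z) \<Longrightarrow> v = w"
  using b_self_eq_0[of "v - w"] by (simp add: bb.diff_left)

lemma subspace_perp: "subspace (perp b W)"
  by (rule subspaceI) (auto simp: perp_def bb.zero_left bb.add_left bb.scaleR_left)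

lemma perp_span: "perp b (span S) = perp b S"
proof
  show "perp b S \<subseteq> perp b (span S)"
  proof
    fix v assume v: "v \<in> perp b S"
    have "b v w = 0" if "w \<in> span S" for w
      using that
      by (induction rule: span_induct_alt) (use v in \<open>auto simp: perp_def bb.zero_right
          bb.add_right bb.scaleR_right\<close>)
    then show "v \<in> perp b (span S)" by (simp add: perp_def)
  qed
qed (auto simp: perp_def span_base)

lemma perp_decomp:
  assumes "subspace W"
  obtains w z where "w \<in> W" "z \<in> perp b W" "v = w + z"
proof -
  have sub: "subspace (inv E ` W)"
    by (rule linear_subspace_image[OF linear_inv_E assms])
  obtain y z where yz: "y \<in> span (inv E ` W)" "\<And>w. w \<in> span (inv E ` W) \<Longrightarrow> orthogonal z w"
      "inv E v = y + z"
    by (rule orthogonal_subspace_decomp_exists[of "inv E ` W" "inv E v"]) auto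
  have "y \<in> inv E ` W" using yz(1) sub by (simp add: span_eq_iff[THEN iffD2])
  then have "E y \<in> W" by auto
  moreover have "E z \<in> perp b W"
    using yz(2) by (auto simp: perp_def b_eq orthogonal_def span_base)
  moreover have "v = E y + E z"
    by (metis yz(3) E_inv linear_add[OF linear_E])
  ultimately show ?thesis by (rule that)
qed

lemma eq_0_if_in_perp: "w \<in> W \<Longrightarrow> w \<in> perp b W \<Longrightarrow> w = 0"
  using perpD[of w b W w] by simp

lemma perp_perp:
  assumes "subspace W"
  shows "perp b (perp b W) = W"
proof
  show "perp b (perp b W) \<subseteq> W"
  proof
    fix v assume v: "v \<in> perp b (perp b W)"
    obtain w z where wz: "w \<in> W" "z \<in> perp b W" "v = w + z" by (rule perp_decomp[OF assms])
    have "b v z = 0" using v wz(2) by (rule perpD)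
    moreover have "b w z = 0" using perpD[OF wz(2,1)] b_commute by metis
    ultimately have "z = 0" using wz(3) by (simp add: bb.add_left)
    then show "v \<in> W" using wz by simp
  qed
qed (auto simp: perp_def b_commute)

lemma skew_self: "(\<And>v w. b (T v) w = - b v (T w)) \<Longrightarrow> b v (T v) = 0"
  by (metis b_commute equal_neg_zero)

text \<open>By cyclicity of the trace, P may be replaced by its conjugate under E. This makes the
  coordinate trace accessible to arguments about \<open>b\<close>: skewness kills it, and isometries
  bound each summand.\<close>

lemma trace_frame:
  assumes "linear P"
  shows "trace (matrix P) = (\<Sum>i\<in>UNIV. b (E (axis i 1)) (P (E (axis i 1))))"
proof -
  have P_eq: "P = E \<circ> (inv E \<circ> P)" by (simp add: fun_eq_iff)
  have lin: "linear (inv E \<circ> P)" by (rule linear_compose[OF assms linear_inv_E])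
  have "matrix P = matrix E ** matrix (inv E \<circ> P)"
    by (metis matrix_compose[OF lin linear_E] P_eq)
  then have "trace (matrix P) = trace (matrix (inv E \<circ> P) ** matrix E)"
    using trace_mul_sym[of "matrix E" "matrix (inv E \<circ> P)"] by simp
  also have "\<dots> = trace (matrix (inv E \<circ> P \<circ> E))"
    by (simp only: matrix_compose[OF linear_E lin])
  also have "\<dots> = (\<Sum>i\<in>UNIV. b (E (axis i 1)) (P (E (axis i 1))))"
    by (simp add: trace_def matrix_def b_eq inner_axis')
  finally show ?thesis .
qed

lemma isometry_inj:
  assumes "linear P" and iso: "\<And>v w. b (P v) (P w) = b v w"
  shows "inj P"
proof (rule injI)
  fix v w assume "P v = P w"
  then have "P (v - w) = 0" by (simp add: linear_diff[OF assms(1)])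
  then have "b (v - w) (v - w) = 0" using iso[of "v - w" "v - w"] by (simp add: bb.zero_left)
  then show "v = w" by simp
qed

text \<open>For a unit vector e, the squared length of P e - e is 2 (1 - b e (P e)), so every
  diagonal coefficient is at most 1. A trace of at least n forces equality throughout, hence P e = e
  on the frame.\<close>

lemma isometry_trace_id:
  assumes "linear P" and iso: "\<And>v w. b (P v) (P w) = b v w"
    and tr: "real CARD('n) \<le> trace (matrix P)"
  shows "P v = v"
proof -
  define e :: "'n \<Rightarrow> real ^ 'n" where "e i = E (axis i 1)" for i
  have dist: "b (P (e i) - e i) (P (e i) - e i) = 2 * (1 - b (e i) (P (e i)))" for i
    using iso[of "e i" "e i"] b_commute[of "P (e i)" "e i"]
    by (simp add: bb.diff_left bb.diff_right e_def frame_isometry inner_axis')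
  then have nonneg: "0 \<le> 1 - b (e i) (P (e i))" for i
    using b_self_nonneg[of "P (e i) - e i"] by simp
  have "(\<Sum>i\<in>UNIV. 1 - b (e i) (P (e i))) \<le> 0"
    using tr unfolding trace_frame[OF assms(1)] by (simp add: sum_subtractf e_def)
  then have "(\<Sum>i\<in>UNIV. 1 - b (e i) (P (e i))) = 0"
    using sum_nonneg[of UNIV "\<lambda>i. 1 - b (e i) (P (e i))", OF nonneg] by linarith
  then have "1 - b (e i) (P (e i)) = 0" for i
    using sum_nonneg_eq_0_iff[of UNIV "\<lambda>i. 1 - b (e i) (P (e i))"] nonneg by auto
  then have Pe: "P (e i) = e i" for i using dist[of i] by simp
  have "P (E u) = E u" for u
    using linear_expand[OF linear_compose[OF linear_E assms(1)], of u] linear_expand[OF linear_E,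
        of u] Pe
    by (simp add: e_def)
  then show ?thesis by (metis E_inv)
qed

lemma isometry_det:
  assumes "linear P" and iso: "\<And>v w. b (P v) (P w) = b v w"
  shows "det (matrix P) = 1 \<or> det (matrix P) = - 1"
proof -
  define Q where "Q = inv E \<circ> P \<circ> E"
  have linQ: "linear Q" unfolding Q_def
    by (intro linear_compose linear_E linear_inv_E assms(1))
  have "orthogonal_transformation Q"
    using linQ iso by (auto simp: orthogonal_transformation_def Q_def b_eq)
  then have dQ: "det (matrix Q) = 1 \<or> det (matrix Q) = - 1"
    by (simp add: det_orthogonal_matrix orthogonal_transformation_matrix)
  have "E \<circ> Q = P \<circ> E" by (simp add: Q_def fun_eq_iff)
  then have "det (matrix E) * det (matrix Q) = det (matrix P) * det (matrix E)"
    by (metis det_mul matrix_compose linQ linear_E assms(1))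
  moreover have "det (matrix E) \<noteq> 0"
    using det_nz_iff_inj[OF linear_E] inj_E by simp
  ultimately show ?thesis using dQ by auto
qed

section \<open>The stabilizer and its Lie algebra\<close>

lemma op_exp_b_has_derivative:
  assumes "linear T"
  shows "((\<lambda>t. b (op_exp (\<lambda>v. t *\<^sub>R T v) v) (op_exp (\<lambda>v. t *\<^sub>R T v) w)) has_real_derivative
     b (T (op_exp (\<lambda>v. t *\<^sub>R T v) v)) (op_exp (\<lambda>v. t *\<^sub>R T v) w)
     + b (op_exp (\<lambda>v. t *\<^sub>R T v) v) (T (op_exp (\<lambda>v. t *\<^sub>R T v) w))) (at t)"
  unfolding has_field_derivative_def
  by (rule has_derivative_eq_rhs[OF bb.FDERIV[OF op_exp_has_derivative[OF assms]
      op_exp_has_derivative[OF assms]]])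
    (auto simp: bb.scaleR_left bb.scaleR_right algebra_simps)

text \<open>The metric and the forms are preserved because their derivatives along the group vanish.
  The orientation comes from connectedness: the determinant of an isometry is 1 or -1, depends
  continuously on t, and is 1 at t = 0.\<close>

lemma op_exp_in_stabilizer:
  assumes alt: "\<And>j. j \<le> N \<Longrightarrow> alternating_form (d j) (\<phi> j)"
    and T: "T \<in> infinitesimal_stabilizer b N d \<phi>"
  shows "op_exp (\<lambda>v. t *\<^sub>R T v) \<in> stabilizer b N \<phi>"
proof -
  have lin: "linear T" and skew: "b (T v) w = - b v (T w)"
    and dia: "j \<le> N \<Longrightarrow> diamond (d j) T (\<phi> j) X = 0" for v w j X
    using T by (auto simp: infinitesimal_stabilizer_def)
  define e where "e t = op_exp (\<lambda>v. t *\<^sub>R T v)" for t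
  have e0: "e 0 v = v" for v unfolding e_def by (rule op_exp_0)
  have line: "linear (e t)" for t
    unfolding e_def by (intro linear_op_exp linear_scaleR_comp lin)
  have iso: "b (e t v) (e t w) = b v w" for t v w
    using DERIV_isconst_all[of "\<lambda>t. b (e t v) (e t w)" t 0] op_exp_b_has_derivative[OF lin, of v w]
    by (simp add: e_def[symmetric] e0 skew)
  have "\<phi> j (\<lambda>i. e t (X i)) = \<phi> j X" if "j \<le> N" for j X
    using DERIV_isconst_all[of "\<lambda>t. \<phi> j (\<lambda>i. e t (X i))" t 0]
      op_exp_form_has_derivative[OF lin alt[OF that], of X]
    by (simp add: e_def[symmetric] e0 dia[OF that])
  moreover have "det (matrix (e t)) = 1"
  proof -
    have "continuous_on UNIV (\<lambda>t. e t v)" for v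
      unfolding e_def using op_exp_has_derivative[OF lin]
      by (auto intro!: has_derivative_continuous_on simp: has_derivative_at_withinI)
    then have "continuous_on UNIV (\<lambda>t. det (matrix (e t)))"
      by (rule continuous_on_det_matrix)
    moreover have "(\<lambda>t. det (matrix (e t))) ` UNIV \<subseteq> {1, - 1}"
      using isometry_det[OF line iso] by auto
    ultimately have "(\<lambda>t. det (matrix (e t))) constant_on UNIV"
      by (intro continuous_finite_range_constant connected_UNIV) (auto intro: finite_subset)
    then have "det (matrix (e t)) = det (matrix (e 0))"
      by (auto simp: constant_on_def)
    also have "e 0 = id" by (auto simp: e0)
    finally show ?thesis by (simp only: matrix_id_mat_1 det_I)
  qed
  ultimately show ?thesis
    using line iso by (auto simp: stabilizer_def SO_def e_def)
qed

text \<open>One inclusion differentiates the equations of the group at t = 0, the other integrates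
  them along the one-parameter group by \<open>op_exp_in_stabilizer\<close>.\<close>

lemma lie_algebra_stabilizer:
  assumes alt: "\<And>j. j \<le> N \<Longrightarrow> alternating_form (d j) (\<phi> j)"
  shows "lie_algebra (stabilizer b N \<phi>) = infinitesimal_stabilizer b N d \<phi>"
proof
  show "infinitesimal_stabilizer b N d \<phi> \<subseteq> lie_algebra (stabilizer b N \<phi>)"
    using op_exp_in_stabilizer[OF alt]
    by (auto simp: lie_algebra_def infinitesimal_stabilizer_def)
  show "lie_algebra (stabilizer b N \<phi>) \<subseteq> infinitesimal_stabilizer b N d \<phi>"
  proof
    fix T assume T: "T \<in> lie_algebra (stabilizer b N \<phi>)"
    define e where "e t = op_exp (\<lambda>v. t *\<^sub>R T v)" for t
    have lin: "linear T" and e: "e t \<in> stabilizer b N \<phi>" for t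
      using T by (auto simp: lie_algebra_def e_def)
    have e0: "e 0 v = v" for v unfolding e_def by (rule op_exp_0)
    have "b (T v) w + b v (T w) = 0" for v w
    proof (rule DERIV_unique)
      show "((\<lambda>t. b (e t v) (e t w)) has_real_derivative b (T v) w + b v (T w)) (at 0)"
        using op_exp_b_has_derivative[OF lin, of v w 0] unfolding e_def[symmetric] e0 .
      have "b (e t v) (e t w) = b v w" for t using e[of t] by (auto simp: stabilizer_def SO_def)
      then show "((\<lambda>t. b (e t v) (e t w)) has_real_derivative 0) (at 0)" by simp
    qed
    then have "b (T v) w = - b v (T w)" for v w by (simp add: eq_neg_iff_add_eq_0)
    moreover have "diamond (d j) T (\<phi> j) X = 0" if "j \<le> N" for j X
    proof (rule DERIV_unique)
      show "((\<lambda>t. \<phi> j (\<lambda>i. e t (X i))) has_real_derivative diamond (d j) T (\<phi> j) X) (at 0)"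
        using op_exp_form_has_derivative[OF lin alt[OF that], of X 0] unfolding e_def[symmetric]
            e0 .
      have "\<phi> j (\<lambda>i. e t (X i)) = \<phi> j X" for t using e[of t] that by (auto simp: stabilizer_def)
      then show "((\<lambda>t. \<phi> j (\<lambda>i. e t (X i))) has_real_derivative 0) (at 0)" by simp
    qed
    ultimately show "T \<in> infinitesimal_stabilizer b N d \<phi>"
      using lin by (auto simp: infinitesimal_stabilizer_def)
  qed
qed

lemma stabilizer_compose:
  assumes "P \<in> stabilizer b N \<phi>" "Q \<in> stabilizer b N \<phi>"
  shows "P \<circ> Q \<in> stabilizer b N \<phi>"
  using assms
  by (auto simp: stabilizer_def SO_def linear_compose matrix_compose det_mul)

lemma stabilizer_bij: "P \<in> stabilizer b N \<phi> \<Longrightarrow> bij P"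
  using isometry_inj linear_injective_imp_surjective
  by (auto simp: stabilizer_def SO_def bij_def)

lemma stabilizer_inv:
  assumes "P \<in> stabilizer b N \<phi>"
  shows "inv P \<in> stabilizer b N \<phi>"
proof -
  note bij = stabilizer_bij[OF assms]
  have P: "linear P" "b (P v) (P w) = b v w" "det (matrix P) = 1"
      "j \<le> N \<Longrightarrow> \<phi> j (\<lambda>i. P (X i)) = \<phi> j X" for v w j X
    using assms by (auto simp: stabilizer_def SO_def)
  have Pinv: "P (inv P v) = v" for v using bij by (simp add: bij_is_surj surj_f_inv_f)
  have lin: "linear (inv P)"
    by (rule inj_linear_imp_inv_linear[OF P(1) bij_is_inj[OF bij]])
  have "P \<circ> inv P = id" using Pinv by auto
  then have "det (matrix P) * det (matrix (inv P)) = 1"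
    by (metis P(1) lin det_mul matrix_compose matrix_id_mat_1 det_I)
  moreover have "b (inv P v) (inv P w) = b v w" for v w
    using P(2)[of "inv P v" "inv P w"] by (simp add: Pinv)
  moreover have "\<phi> j (\<lambda>i. inv P (X i)) = \<phi> j X" if "j \<le> N" for j X
    using P(4)[OF that, of "\<lambda>i. inv P (X i)"] by (simp add: Pinv)
  ultimately show ?thesis
    using lin P(3) by (auto simp: stabilizer_def SO_def)
qed

end

section \<open>Curves in the orbit of a plane\<close>

text \<open>The remainder term of the derivative is, with HOL's convention \<open>x / 0 = 0\<close>, a function that
  is continuous at the base point and vanishes there, so no case distinction is needed when the
  sequence meets the base point.\<close>

lemma has_derivative_sequence_limit:
  fixes f :: "'a::real_normed_vector \<Rightarrow> real"
  assumes der: "(f has_derivative f') (at a)" and x: "x \<longlonglongrightarrow> a"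
    and fx: "\<And>n. f (x n) = f a" and pos: "\<And>n. 0 < \<rho> n"
    and lim: "(\<lambda>n. (x n - a) /\<^sub>R \<rho> n) \<longlonglongrightarrow> z"
  shows "f' z = 0"
proof -
  have bl: "bounded_linear f'" using der by (rule has_derivative_bounded_linear)
  define e where "e y = (f y - f a - f' (y - a)) / norm (y - a)" for y
  have "(e \<longlongrightarrow> 0) (at a)"
    using der unfolding has_derivative_at_within e_def by (simp add: divide_inverse_commute)
  then have "isCont e a" by (simp add: isCont_def e_def)
  then have ex: "(\<lambda>n. e (x n)) \<longlonglongrightarrow> 0"
    using isCont_tendsto_compose[OF _ x, of e] by (simp add: e_def)
  have eq: "f' ((x n - a) /\<^sub>R \<rho> n) = - (e (x n) * norm ((x n - a) /\<^sub>R \<rho> n))" for n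
    using fx[of n] pos[of n] linear_0[OF bounded_linear.linear[OF bl]]
    by (cases "x n = a") (simp_all add: e_def linear_scale[OF bounded_linear.linear[OF bl]])
  have "(\<lambda>n. f' ((x n - a) /\<^sub>R \<rho> n)) \<longlonglongrightarrow> f' z"
    by (rule bounded_linear.tendsto[OF bl lim])
  moreover have "(\<lambda>n. - (e (x n) * norm ((x n - a) /\<^sub>R \<rho> n))) \<longlonglongrightarrow> - (0 * norm z)"
    by (intro tendsto_intros ex lim)
  ultimately show ?thesis
    unfolding eq using LIMSEQ_unique by fastforce
qed

section \<open>Compactness of the stabilizer and endomorphisms exchanging a plane with its
  complement\<close>

lemma bounded_linear_mult_vec: "bounded_linear (\<lambda>A :: real ^ 'a::finite ^ 'c::finite. A *v v)"
  by (rule linear_conv_bounded_linear[THEN iffD1])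
    (auto intro!: linearI simp: matrix_vector_mult_add_rdistrib scaleR_matrix_vector_assoc)

lemma matrix_diff_mult:
  fixes A B :: "real ^ 'a::finite ^ 'c::finite" and C :: "real ^ 'd::finite ^ 'a"
  shows "(A - B) ** C = A ** C - B ** C"
  by (simp add: matrix_matrix_mult_def vec_eq_iff left_diff_distrib sum_subtractf)

lemma scaleR_matrix_mult:
  fixes A :: "real ^ 'a::finite ^ 'c::finite" and C :: "real ^ 'd::finite ^ 'a"
  shows "(r *\<^sub>R A) ** C = r *\<^sub>R (A ** C)"
  by (simp add: matrix_matrix_mult_def vec_eq_iff sum_distrib_left mult.assoc)

lemma continuous_on_mult_vec: "continuous_on S (\<lambda>A :: real ^ 'a::finite ^ 'c::finite. A *v v)"
  by (rule bounded_linear.continuous_on[OF bounded_linear_mult_vec continuous_on_id])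

lemma continuous_on_form_mult_vec:
  assumes "alternating_form m (\<beta> :: (real ^ 'n::finite) form)"
  shows "continuous_on S (\<lambda>A. \<beta> (\<lambda>i. A *v X i))"
proof -
  have "((\<lambda>A. \<beta> (\<lambda>i. A *v X i)) has_derivative
      (\<lambda>H. \<Sum>i<m. \<beta> ((\<lambda>i. A *v X i)(i := H *v X i)))) (at A within S)" for A
    by (rule alternating_form_has_derivative[OF assms])
      (use bounded_linear_imp_has_derivative[OF bounded_linear_mult_vec] in auto)
  then show ?thesis by (rule has_derivative_continuous_on)
qed

context orthonormal_frame
begin

text \<open>All conditions are closed, and isometries of \<open>b\<close> are bounded in terms of
  bounds for \<open>E\<close> and its inverse. With a plane W this set carries the maximum of the
  trace; with W empty it is the whole stabilizer and provides convergent subsequences.\<close>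

lemma compact_stabilizer_into:
  assumes alt: "\<And>j. j \<le> N \<Longrightarrow> alternating_form (d j) (\<phi> j)" and W': "subspace W'"
  shows "compact {A. (*v) A \<in> stabilizer b N \<phi> \<and> (\<forall>w\<in>W. A *v w \<in> W')}" (is "compact ?K")
proof -
  have "closed ?K"
  proof -
    have 1: "continuous_on UNIV (\<lambda>A. b (A *v v) (A *v w))" for v w
      by (rule bb.continuous_on[OF continuous_on_mult_vec continuous_on_mult_vec])
    have 2: "continuous_on UNIV (\<lambda>A :: real ^ 'n ^ 'n. det A)"
      using continuous_on_det_matrix[of UNIV "\<lambda>A v. A *v v", OF continuous_on_mult_vec] by simp
    have "closed {A. A *v w \<in> W'}" for w :: "real ^ 'n"
    proof -
      have "closed ((\<lambda>A. A *v w) -` W')"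
        by (rule continuous_closed_vimage[OF closed_subspace[OF W'] linear_continuous_at[OF
            bounded_linear_mult_vec]])
      then show ?thesis by (simp add: vimage_def)
    qed
    then have 3: "closed (\<Inter>w\<in>W. {A. A *v w \<in> W'})" by auto
    have eq: "?K = {A. \<forall>v w. b (A *v v) (A *v w) = b v w} \<inter> {A. det A = 1}
        \<inter> (\<Inter>j\<in>{..N}. {A. \<forall>X. \<phi> j (\<lambda>i. A *v X i) = \<phi> j X}) \<inter> (\<Inter>w\<in>W. {A. A *v w \<in> W'})"
      by (auto simp: stabilizer_def SO_def)
    show ?thesis unfolding eq
      by (intro closed_Int 3 closed_INT ballI closed_Collect_all closed_Collect_eq 1 2
          continuous_on_const continuous_on_form_mult_vec[OF alt]) auto
  qed
  moreover have "bounded ?K"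
  proof -
    obtain K1 where K1: "\<And>v. norm (E v) \<le> norm v * K1" "K1 \<ge> 0"
      using bounded_linear.nonneg_bounded[OF linear_conv_bounded_linear[THEN iffD1, OF linear_E]]
          by blast
    obtain K2 where K2: "\<And>v. norm (inv E v) \<le> norm v * K2" "K2 \<ge> 0"
      using bounded_linear.nonneg_bounded[OF linear_conv_bounded_linear[THEN iffD1, OF
          linear_inv_E]] by blast
    have "norm A \<le> (\<Sum>i::'n\<in>UNIV. \<Sum>j::'n\<in>UNIV. K2 * K1)" if "A \<in> ?K" for A
    proof -
      have iso: "b (A *v v) (A *v v) = b v v" for v
        using that by (auto simp: stabilizer_def SO_def)
      have "norm (A *v v) \<le> norm v * (K2 * K1)" for v
      proof -
        have "norm (inv E (A *v v)) = norm (inv E v)"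
          using iso[of v] by (simp add: b_eq norm_eq_sqrt_inner)
        then have "norm (E (inv E (A *v v))) \<le> norm (inv E v) * K1" using K1(1) by metis
        also have "\<dots> \<le> (norm v * K2) * K1" using K2(1) K1(2) by (intro mult_right_mono)
        finally show ?thesis by (simp add: mult_ac)
      qed
      then have col: "norm (A *v axis j 1) \<le> K2 * K1" for j
        by (metis mult_1 norm_axis_1)
      have "\<bar>A $ i $ j\<bar> \<le> K2 * K1" for i j
        using component_le_norm_cart[of "A *v axis j 1" i] col[of j]
        by (simp add: matrix_vector_mult_basis column_def)
      moreover have "norm A \<le> (\<Sum>i\<in>UNIV. \<Sum>j\<in>UNIV. \<bar>A $ i $ j\<bar>)"
        unfolding norm_vec_def[of A]
        by (rule order_trans[OF L2_set_le_sum]) (auto intro!: sum_mono norm_le_l1_cart)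
      ultimately show ?thesis
        by (meson order_trans sum_mono)
    qed
    then show ?thesis by (rule boundedI)
  qed
  ultimately show ?thesis by (simp add: compact_eq_bounded_closed)
qed

lemma isometry_image_eq:
  fixes P :: "'a::euclidean_space \<Rightarrow> 'c::euclidean_space"
  assumes "linear P" "inj P" "subspace W" "subspace W'" "P ` W \<subseteq> W'" "dim W = dim W'"
  shows "P ` W = W'"
  by (rule subspace_dim_equal)
    (use assms in \<open>auto simp: linear_subspace_image dim_image_eq linear_inj_on_iff_eq_0\<close>)

lemma infinitesimal_stabilizer_scaleR:
  assumes alt: "\<And>j. j \<le> N \<Longrightarrow> alternating_form (d j) (\<phi> j)"
    and Z: "Z \<in> infinitesimal_stabilizer b N d \<phi>"
  shows "(\<lambda>v. c *\<^sub>R Z v) \<in> infinitesimal_stabilizer b N d \<phi>"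
proof -
  have "diamond (d j) (\<lambda>v. c *\<^sub>R Z v) (\<phi> j) X = c * diamond (d j) Z (\<phi> j) X" if "j \<le> N" for j X
    using linear_scale[OF alternating_form_linear[OF alt[OF that]]]
    by (simp add: diamond_def sum_distrib_left)
  then show ?thesis
    using Z by (auto simp: infinitesimal_stabilizer_def linear_scaleR_comp bb.scaleR_left
        bb.scaleR_right)
qed

lemma mixed_part_scaleR:
  assumes "Z \<in> mixed_part b W" "subspace W"
  shows "(\<lambda>v. c *\<^sub>R Z v) \<in> mixed_part b W"
  using assms subspace_perp[of W]
  by (auto simp: mixed_part_def linear_scaleR_comp bb.scaleR_left bb.scaleR_right subspace_scale
      image_subset_iff)

text \<open>By skewness the two off-diagonal blocks are negative adjoints of each other, so the
  block from the complement of W to W decides. Testing against \<open>Z z\<close> and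
  \<open>Z w\<close> themselves gives zero lengths.\<close>

lemma mixed_part_eq_0:
  assumes Z: "Z \<in> mixed_part b W" and W: "subspace W"
    and 0: "\<And>w z. w \<in> W \<Longrightarrow> z \<in> perp b W \<Longrightarrow> b w (Z z) = 0"
  shows "Z v = 0"
proof -
  have lin: "linear Z" and skew: "\<And>v w. b (Z v) w = - b v (Z w)"
    and WZ: "\<And>w. w \<in> W \<Longrightarrow> Z w \<in> perp b W" and PZ: "\<And>z. z \<in> perp b W \<Longrightarrow> Z z \<in> W"
    using Z by (auto simp: mixed_part_def)
  obtain w z where wz: "w \<in> W" "z \<in> perp b W" "v = w + z" by (rule perp_decomp[OF W])
  have "b (Z z) (Z z) = 0" using 0 PZ wz by blast
  moreover have "b (Z w) (Z w) = 0" using 0 WZ wz skew by fastforce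
  ultimately show ?thesis using wz(3) by (simp add: linear_add[OF lin])
qed

text \<open>Here a first-order statement is extracted from the bare fact that the planes lie in one
  orbit. Only components normal to W are claimed: the tangential part of \<tau>' depends on the
  choice of spanning vectors and not on the planes.\<close>

lemma orbit_tangent:
  fixes \<tau> :: "real \<Rightarrow> 'i \<Rightarrow> real ^ 'n"
  assumes alt: "\<And>j. j \<le> N \<Longrightarrow> alternating_form (d j) (\<phi> j)"
    and W_def: "W = span (range (\<tau> 0))"
    and compliance: "{S \<in> lie_algebra (stabilizer b N \<phi>).
        \<forall>T\<in>lie_algebra (plane_stabilizer b N \<phi> W). so_inner S T = 0} \<subseteq> mixed_part b W"
    and der: "\<And>i. ((\<lambda>t. \<tau> t i) has_vector_derivative \<tau>' i) (at 0)"
    and orbit: "\<forall>\<^sub>F t in at_right 0. \<exists>P\<in>stabilizer b N \<phi>. P ` W = span (range (\<tau> t))"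
  obtains M where "M \<in> infinitesimal_stabilizer b N d \<phi>" "M \<in> mixed_part b W"
    "\<And>i z. z \<in> perp b W \<Longrightarrow> b (M (\<tau> 0 i)) z = b (\<tau>' i) z"
proof -
  define S where "S = stabilizer b N \<phi>"
  have Slin: "linear P" and Siso: "b (P v) (P w) = b v w" if "P \<in> S" for P v w
    using that by (auto simp: S_def stabilizer_def SO_def)
  have subW: "subspace W" by (simp add: W_def)
  obtain e where e: "e > 0" "\<And>t. 0 < t \<Longrightarrow> t < e \<Longrightarrow> \<exists>P\<in>S. P ` W = span (range (\<tau> t))"
    using orbit unfolding eventually_at_right_field S_def by blast
  \<comment> \<open>With the offset 2 even the first time e / 2 is strictly below e.\<close>
  define t where "t n = e / real (n + 2)" for n
  have t: "0 < t n" "t n < e" for n using e(1) by (auto simp: t_def field_simps intro!: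
      add_pos_nonneg)
  have t0: "t \<longlonglongrightarrow> 0"
    unfolding t_def using LIMSEQ_ignore_initial_segment[OF lim_const_over_n[of e], of 2] by simp
  define V where "V n = span (range (\<tau> (t n)))" for n
  have subV: "subspace (V n)" for n by (simp add: V_def)
  \<comment> \<open>Inclusion of the image in \<open>V n\<close> is a closed condition; that the
    image is all of \<open>V n\<close> follows by dimension where it is needed.\<close>
  define K where "K n = {A. (*v) A \<in> S \<and> (\<forall>w\<in>W. A *v w \<in> V n)}" for n
  have K_matrix: "matrix P \<in> K n" if "P \<in> S" "P ` W \<subseteq> V n" for P n
    using that Slin[OF that(1)] by (auto simp: K_def matrix_works[unfolded matrix_works]
        image_subset_iff)
  have "\<exists>A\<in>K n. \<forall>A'\<in>K n. trace A' \<le> trace A" for n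
  proof (rule continuous_attains_sup)
    show "compact (K n)"
      unfolding K_def S_def by (rule compact_stabilizer_into[OF alt subV])
    show "K n \<noteq> {}" using e(2)[OF t] K_matrix[of _ n] by (fastforce simp: V_def)
    show "continuous_on (K n) trace"
      unfolding trace_def by (intro continuous_intros continuous_on_component)
  qed
  then obtain A where A: "\<And>n. A n \<in> K n" and Amax: "\<And>n A'. A' \<in> K n \<Longrightarrow> trace A' \<le> trace (A n)"
    by metis
  have AS: "(*v) (A n) \<in> S" for n using A by (auto simp: K_def)
  \<comment> \<open>Isometries carry the complement of W to the complement of \<open>V n\<close>.
    This is the constraint linking the group element to the time; it is differentiated at the
    end.\<close>
  have orth: "b (\<tau> (t n) i) (A n *v z) = 0" if "z \<in> perp b W" for n i z
  proof -
    obtain P where P: "P \<in> S" "P ` W = V n" unfolding V_def using e(2)[OF t] by blast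
    have "dim W = dim (V n)"
      using dim_image_eq[OF Slin[OF P(1)], of W] isometry_inj[OF Slin[OF P(1)] Siso[OF P(1)]] P(2)
      by (metis inj_on_subset subset_UNIV)
    then have "(*v) (A n) ` W = V n"
      using A[of n] isometry_inj[OF Slin[OF AS] Siso[OF AS]]
      by (intro isometry_image_eq Slin[OF AS] subW subV) (auto simp: K_def)
    moreover have "\<tau> (t n) i \<in> V n" by (simp add: V_def span_base)
    ultimately obtain w where "w \<in> W" "\<tau> (t n) i = A n *v w" by auto
    then show ?thesis using Siso[OF AS, of n w z] that b_commute perpD by metis
  qed
  \<comment> \<open>The one-parameter group of T preserves W, so multiplying \<open>A n\<close> by
    it on the right stays in \<open>K n\<close>, and s = 0 is a maximum of the trace.\<close>
  have crit: "trace (A n ** matrix T) = 0" if T: "T \<in> lie_algebra (plane_stabilizer b N \<phi> W)" for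
      n T
  proof -
    define f where "f s = trace (A n ** matrix (op_exp (\<lambda>v. s *\<^sub>R T v)))" for s
    have lin: "linear T" and ex: "op_exp (\<lambda>v. s *\<^sub>R T v) \<in> plane_stabilizer b N \<phi> W" for s
      using T by (auto simp: lie_algebra_def)
    have exS: "op_exp (\<lambda>v. s *\<^sub>R T v) \<in> S" and exW: "op_exp (\<lambda>v. s *\<^sub>R T v) ` W = W" for s
      using ex by (auto simp: plane_stabilizer_def S_def)
    have comp: "A n ** matrix P = matrix (\<lambda>v. A n *v P v)" if "linear P" for P
      using matrix_compose[OF that matrix_vector_mul_linear[of "A n"]] by (simp add: o_def)
    have lin2: "linear (\<lambda>v. A n *v P v)" if "linear P" for P
      using linear_compose[OF that matrix_vector_mul_linear[of "A n"]] by (simp add: o_def)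
    have f: "f s = (\<Sum>i\<in>UNIV. b (E (axis i 1)) (A n *v op_exp (\<lambda>v. s *\<^sub>R T v) (E (axis i 1))))" for s
      unfolding f_def comp[OF Slin[OF exS]] trace_frame[OF lin2[OF Slin[OF exS]]] ..
    have "f s \<le> f 0" for s
    proof -
      have "(*v) (A n) \<circ> op_exp (\<lambda>v. s *\<^sub>R T v) \<in> S"
        unfolding S_def by (rule stabilizer_compose) (use AS exS in \<open>auto simp: S_def\<close>)
      moreover have "((*v) (A n) \<circ> op_exp (\<lambda>v. s *\<^sub>R T v)) ` W \<subseteq> V n"
        using A[of n] exW[of s] by (auto simp: K_def)
      ultimately have "trace (matrix ((*v) (A n) \<circ> op_exp (\<lambda>v. s *\<^sub>R T v))) \<le> trace (A n)"
        by (intro Amax K_matrix)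
      moreover have "op_exp (\<lambda>v. 0 *\<^sub>R T v) = id" by (rule ext) (simp only: op_exp_0 id_apply)
      then have "f 0 = trace (A n)" by (simp only: f_def matrix_id_mat_1 matrix_mul_rid)
      ultimately show ?thesis by (simp add: f_def comp[OF Slin[OF exS]] o_def)
    qed
    moreover have "(f has_real_derivative trace (A n ** matrix T)) (at 0)"
    proof -
      have "((\<lambda>s. A n *v op_exp (\<lambda>v. s *\<^sub>R T v) u) has_derivative (\<lambda>s. A n *v (s *\<^sub>R T u))) (at
          0)" for u
        using bounded_linear.has_derivative[OF matrix_vector_mul_bounded_linear
            op_exp_has_derivative[OF lin, of u 0], of "A n"]
        unfolding op_exp_0 .
      then have "((\<lambda>s. \<Sum>i\<in>UNIV. b (E (axis i 1)) (A n *v op_exp (\<lambda>v. s *\<^sub>R T v) (E (axis i 1))))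
          has_derivative (\<lambda>s. \<Sum>i\<in>UNIV. b (E (axis i 1)) (A n *v (s *\<^sub>R T (E (axis i 1)))))) (at 0)"
        by (intro has_derivative_sum bounded_linear.has_derivative[OF bb.bounded_linear_right])
      then show ?thesis
        unfolding f[abs_def] comp[OF lin] trace_frame[OF lin2[OF lin]] has_field_derivative_def
        by (rule has_derivative_eq_rhs)
          (auto simp: fun_eq_iff matrix_vector_mult_scaleR bb.scaleR_right sum_distrib_left
              mult.commute)
    qed
    ultimately show ?thesis
      by (intro DERIV_local_max[of f _ 0 1]) auto
  qed
  \<comment> \<open>Without a condition on planes this is the stabilizer itself. The planes
    \<open>V n\<close> vary, so the individual sets \<open>K n\<close> could not provide a
    convergent subsequence.\<close>
  have "compact {A. (*v) A \<in> S \<and> (\<forall>w\<in>{}. A *v w \<in> UNIV)}"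
    unfolding S_def by (rule compact_stabilizer_into[OF alt subspace_UNIV])
  then have "\<exists>A0 r. A0 \<in> {A. (*v) A \<in> S} \<and> strict_mono (r :: nat \<Rightarrow> nat) \<and> (A \<circ> r) \<longlonglongrightarrow> A0"
    using AS unfolding compact_def by auto
  then obtain A0 r where A0S: "(*v) A0 \<in> S" and r: "strict_mono r" and A0: "(\<lambda>n. A (r n)) \<longlonglongrightarrow> A0"
    by (auto simp: o_def)
  have tr0: "(\<lambda>n. t (r n)) \<longlonglongrightarrow> 0"
    using LIMSEQ_subseq_LIMSEQ[OF t0 r] by (simp add: o_def)
  have \<tau>lim: "(\<lambda>n. \<tau> (t (r n)) i) \<longlonglongrightarrow> \<tau> 0 i" for i
    by (rule isCont_tendsto_compose[OF has_vector_derivative_continuous[OF der] tr0])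
  \<comment> \<open>The constraint \<open>orth\<close> passes to the limit, since \<tau> is
    continuous at 0.\<close>
  have A0perp: "A0 *v z \<in> perp b W" if z: "z \<in> perp b W" for z
  proof -
    have "b (\<tau> 0 i) (A0 *v z) = 0" for i
    proof (rule LIMSEQ_unique)
      show "(\<lambda>n. b (\<tau> (t (r n)) i) (A (r n) *v z)) \<longlonglongrightarrow> b (\<tau> 0 i) (A0 *v z)"
        by (intro bb.tendsto \<tau>lim bounded_linear.tendsto[OF bounded_linear_mult_vec A0])
      show "(\<lambda>n. b (\<tau> (t (r n)) i) (A (r n) *v z)) \<longlonglongrightarrow> 0"
        by (simp add: orth[OF z])
    qed
    then show ?thesis unfolding W_def perp_span by (auto simp: perp_def b_commute)
  qed
  \<comment> \<open>The limit preserves the complement of W, so its inverse \<open>Q\<close>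
    preserves W, and \<open>A (r n)\<close> composed with \<open>Q\<close> competes for the maximal
    trace. In the limit this reads n <= trace \<open>A0\<close>, hence \<open>A0\<close> is the
    identity.\<close>
  define Q where "Q = inv ((*v) A0)"
  have QS: "Q \<in> S" using stabilizer_inv A0S unfolding Q_def S_def by blast
  have A0Q: "A0 *v Q v = v" for v
    unfolding Q_def using surj_f_inv_f[OF bij_is_surj[OF stabilizer_bij[OF A0S[unfolded S_def]]]] .
  have QW: "Q w \<in> W" if w: "w \<in> W" for w
  proof -
    have "b (Q w) z = 0" if "z \<in> perp b W" for z
      using Siso[OF A0S, of "Q w" z] perpD[OF A0perp[OF that] w] by (simp add: A0Q b_commute)
    then have "Q w \<in> perp b (perp b W)" by (simp add: perp_def)
    then show ?thesis by (simp add: perp_perp[OF subW])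
  qed
  have "A (r n) ** matrix Q \<in> K (r n)" for n
  proof -
    have "(*v) (A (r n)) \<circ> Q \<in> S"
      unfolding S_def by (rule stabilizer_compose) (use AS QS in \<open>auto simp: S_def\<close>)
    moreover have "((*v) (A (r n)) \<circ> Q) ` W \<subseteq> V (r n)"
      using A[of "r n"] QW by (auto simp: K_def)
    ultimately have "matrix ((*v) (A (r n)) \<circ> Q) \<in> K (r n)" by (rule K_matrix)
    then show ?thesis
      using matrix_compose[OF Slin[OF QS] matrix_vector_mul_linear[of "A (r n)"]] by simp
  qed
  then have Amax': "trace (A (r n) ** matrix Q) \<le> trace (A (r n))" for n by (rule Amax)
  have trace_lim: "(\<lambda>n. trace (C n)) \<longlonglongrightarrow> trace C0" if "C \<longlonglongrightarrow> C0" for C :: "nat \<Rightarrow> real ^ 'n ^ 'n" and C0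
    unfolding trace_def by (intro tendsto_sum tendsto_vec_nth that)
  have mult_lim: "(\<lambda>n. C n ** D) \<longlonglongrightarrow> C0 ** D" if "C \<longlonglongrightarrow> C0" for C :: "nat \<Rightarrow> real ^ 'n ^ 'n" and C0 D
    unfolding matrix_matrix_mult_def
    by (intro tendsto_vec_lambda tendsto_sum tendsto_mult tendsto_vec_nth that tendsto_const)
  have "trace (A0 ** matrix Q) \<le> trace A0"
    by (rule LIMSEQ_le[OF trace_lim[OF mult_lim[OF A0]] trace_lim[OF A0]]) (use Amax' in auto)
  moreover have "A0 ** matrix Q = mat 1"
  proof -
    have "A0 ** matrix Q = matrix ((*v) A0 \<circ> Q)"
      using matrix_compose[OF Slin[OF QS] matrix_vector_mul_linear[of A0]] by simp
    also have "(*v) A0 \<circ> Q = id" using A0Q by auto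
    finally show ?thesis by (simp only: matrix_id_mat_1)
  qed
  ultimately have "real CARD('n) \<le> trace (matrix ((*v) A0))" by (simp add: trace_I)
  then have "A0 *v v = v" for v by (rule isometry_trace_id[OF Slin[OF A0S] Siso[OF A0S]])
  then have A1: "A0 = mat 1" by (simp add: matrix_eq)
  \<comment> \<open>Either time or distance may be the larger one. Dividing by their sum keeps both
    components bounded and normalises the limit to \<open>norm Z + c = 1\<close>, so that it cannot
    be zero. The time term also makes \<open>\<rho>\<close> positive when \<open>A (r n)\<close> is
    the identity.\<close>
  define \<rho> where "\<rho> n = t (r n) + norm (A (r n) - mat 1)" for n
  have \<rho>: "\<rho> n > 0" for n using t(1)[of "r n"] by (simp add: \<rho>_def add_pos_nonneg)
  define Y where "Y n = ((A (r n), t (r n)) - (mat 1, 0)) /\<^sub>R \<rho> n" for n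
  have norm_Y: "norm (fst (Y n)) + snd (Y n) = 1" for n
  proof -
    have "norm (fst (Y n)) = norm (A (r n) - mat 1) / \<rho> n" "snd (Y n) = t (r n) / \<rho> n"
      using \<rho>[of n] by (simp_all add: Y_def divide_inverse_commute)
    then have "norm (fst (Y n)) + snd (Y n) = \<rho> n / \<rho> n"
      unfolding \<rho>_def by (simp only: add_divide_distrib add.commute)
    then show ?thesis using \<rho>[of n] by simp
  qed
  have Y_snd: "0 \<le> snd (Y n)" for n using \<rho>[of n] t(1)[of "r n"] by (simp add: Y_def)
  have "Y n \<in> cball 0 1 \<times> {0..1}" for n
    using norm_Y[of n] Y_snd[of n] norm_ge_zero[of "fst (Y n)"]
    by (auto simp: mem_Times_iff simp del: norm_ge_zero)
  moreover have "compact (cball (0 :: real ^ 'n ^ 'n) 1 \<times> {0..1::real})" by (intro compact_Times)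
      auto
  ultimately obtain y q where q: "strict_mono (q :: nat \<Rightarrow> nat)" and y: "(Y \<circ> q) \<longlonglongrightarrow> y"
    unfolding compact_def by metis
  define Z c where "Z = fst y" and "c = snd y"
  have ylim: "(\<lambda>n. Y (q n)) \<longlonglongrightarrow> (Z, c)" using y by (simp add: o_def Z_def c_def)
  have Zlim: "(\<lambda>n. fst (Y (q n))) \<longlonglongrightarrow> Z" and clim: "(\<lambda>n. snd (Y (q n))) \<longlonglongrightarrow> c"
    using tendsto_fst[OF ylim] tendsto_snd[OF ylim] by simp_all
  have Zc: "norm Z + c = 1"
  proof (rule LIMSEQ_unique)
    show "(\<lambda>n. norm (fst (Y (q n))) + snd (Y (q n))) \<longlonglongrightarrow> norm Z + c"
      by (intro tendsto_intros Zlim clim)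
    show "(\<lambda>n. norm (fst (Y (q n))) + snd (Y (q n))) \<longlonglongrightarrow> 1" by (simp add: norm_Y)
  qed
  have c0: "0 \<le> c" by (rule LIMSEQ_le_const[OF clim]) (use Y_snd in auto)
  have xlim: "(\<lambda>n. (A (r (q n)), t (r (q n)))) \<longlonglongrightarrow> (mat 1, 0)"
    using LIMSEQ_subseq_LIMSEQ[OF tendsto_Pair[OF A0[unfolded A1] tr0] q] by (simp add: o_def)
  \<comment> \<open>Any differentiable function that is constant on the pairs (matrix, time), with
    the same value at (identity, 0), has a differential that vanishes on the limit direction. It is
    applied to the metric, to the forms and to the constraint \<open>orth\<close>.\<close>
  have key: "f' (Z, c) = 0"
    if "(f has_derivative f') (at (mat 1 :: real ^ 'n ^ 'n, 0::real))" "\<And>n. f (A (r n), t (r n)) =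
        f (mat 1, 0)"
    for f :: "(real ^ 'n ^ 'n) \<times> real \<Rightarrow> real" and f'
    using has_derivative_sequence_limit[OF that(1) xlim that(2) \<rho> ylim[unfolded Y_def]] .
  have dmul: "((\<lambda>x. fst x *v v) has_derivative (\<lambda>h. fst h *v v)) (at a)" for v and a :: "(real ^
      'n ^ 'n) \<times> real"
    by (intro bounded_linear_imp_has_derivative bounded_linear_compose[OF bounded_linear_mult_vec
        bounded_linear_fst])
  have skew: "b (Z *v v) w = - b v (Z *v w)" for v w
  proof -
    have "((\<lambda>x. b (fst x *v v) (fst x *v w)) has_derivative
        (\<lambda>h. b (fst (mat 1 :: real ^ 'n ^ 'n, 0::real) *v v) (fst h *v w) + b (fst h *v v) (fst
            (mat 1 :: real ^ 'n ^ 'n, 0::real) *v w))) (at (mat 1 :: real ^ 'n ^ 'n, 0::real))"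
      by (rule bb.FDERIV[OF dmul dmul])
    from key[OF this] show ?thesis by (simp add: Siso[OF AS])
  qed
  have dia: "diamond (d j) ((*v) Z) (\<phi> j) X = 0" if j: "j \<le> N" for j X
  proof -
    have "((\<lambda>x. \<phi> j (\<lambda>i. fst x *v X i)) has_derivative
       (\<lambda>h. \<Sum>i<d j. \<phi> j ((\<lambda>i. fst (mat 1 :: real ^ 'n ^ 'n, 0::real) *v X i)(i := fst h *v X i))))
           (at (mat 1 :: real ^ 'n ^ 'n, 0::real))"
      by (rule alternating_form_has_derivative[OF alt[OF j] dmul])
    from key[OF this] AS j show ?thesis by (auto simp: diamond_def S_def stabilizer_def)
  qed
  have Zg: "(*v) Z \<in> infinitesimal_stabilizer b N d \<phi>"
    using skew dia by (auto simp: infinitesimal_stabilizer_def)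
  \<comment> \<open>The constraint \<open>orth\<close> is differentiated at (identity, 0); its value
    there is zero because \<open>z\<close> is normal to W.\<close>
  have Z\<tau>: "c * b (\<tau>' i) z + b (\<tau> 0 i) (Z *v z) = 0" if z: "z \<in> perp b W" for i z
  proof -
    have d1: "((\<lambda>x. \<tau> (snd x) i) has_derivative (\<lambda>h. snd h *\<^sub>R \<tau>' i)) (at (mat 1 :: real ^ 'n ^
        'n, 0::real))"
      using has_derivative_compose[OF bounded_linear_imp_has_derivative[OF bounded_linear_snd, of
          "at (mat 1, 0)"],
          of "\<lambda>t. \<tau> t i" "\<lambda>h. h *\<^sub>R \<tau>' i"] der[of i]
      by (simp add: has_vector_derivative_def)
    have d2: "((\<lambda>x. b (\<tau> (snd x) i) (fst x *v z)) has_derivative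
        (\<lambda>h. b (\<tau> (snd (mat 1 :: real ^ 'n ^ 'n, 0::real)) i) (fst h *v z) + b (snd h *\<^sub>R \<tau>' i)
            (fst (mat 1 :: real ^ 'n ^ 'n, 0::real) *v z)))
        (at (mat 1 :: real ^ 'n ^ 'n, 0::real))"
      by (rule bb.FDERIV[OF d1 dmul])
    have "b (\<tau> 0 i) z = 0"
      using perpD[OF z, of "\<tau> 0 i"] by (simp add: W_def span_base b_commute)
    then show ?thesis
      using key[OF d2] orth[OF z] by (simp add: bb.scaleR_left)
  qed
  \<comment> \<open>Criticality annihilates the trace against \<open>A n\<close>, skewness
    annihilates the trace of T itself; so the difference of \<open>A n\<close> and the identity
    pairs to zero with T, and so does the rescaled limit.\<close>
  have "so_inner ((*v) Z) T = 0" if T: "T \<in> lie_algebra (plane_stabilizer b N \<phi> W)" for T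
  proof -
    have "T \<in> lie_algebra (stabilizer b N \<phi>)"
      using T by (auto simp: lie_algebra_def plane_stabilizer_def)
    then have "T \<in> infinitesimal_stabilizer b N d \<phi>"
      using lie_algebra_stabilizer[of N d \<phi>, OF alt] by blast
    then have lin: "linear T" and skewT: "\<And>v w. b (T v) w = - b v (T w)"
      by (auto simp: infinitesimal_stabilizer_def)
    have "trace (matrix T) = 0"
      unfolding trace_frame[OF lin] by (simp add: skew_self[OF skewT])
    then have "trace ((A n - mat 1) ** matrix T) = 0" for n
      using crit[OF T, of n] by (simp add: matrix_diff_mult trace_sub)
    then have "trace (fst (Y n) ** matrix T) = 0" for n
      by (simp add: Y_def scaleR_matrix_mult trace_def flip: sum_distrib_left)
    then have "trace (Z ** matrix T) = 0"
      using LIMSEQ_unique[OF trace_lim[OF mult_lim[OF Zlim, of "matrix T"]], of 0] by simp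
    then show ?thesis
      using matrix_compose[OF lin matrix_vector_mul_linear[of Z]] by (simp add: so_inner_def)
  qed
  then have Zm: "(*v) Z \<in> mixed_part b W"
    using compliance Zg lie_algebra_stabilizer[of N d \<phi>, OF alt] by auto
  \<comment> \<open>With c = 0 the differentiated constraint makes \<open>Z z\<close> orthogonal to
    W for every normal \<open>z\<close>. A mixed endomorphism with this property is zero, which
    contradicts \<open>Zc\<close>.\<close>
  have "c \<noteq> 0"
  proof
    assume "c = 0"
    then have "\<tau> 0 i \<in> perp b {Z *v z}" if "z \<in> perp b W" for i z
      using Z\<tau>[OF that] by (simp add: perp_def)
    then have "W \<subseteq> perp b {Z *v z}" if "z \<in> perp b W" for z
      unfolding W_def using that by (intro span_minimal subspace_perp) (auto simp: W_def)
    then have "Z *v v = 0" for v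
      by (intro mixed_part_eq_0[OF Zm subW]) (auto simp: perp_def)
    then have "Z = 0" by (simp add: matrix_eq)
    then show False using Zc \<open>c = 0\<close> by simp
  qed
  then have cpos: "c > 0" using c0 by simp
  show ?thesis
  proof (rule that)
    show "(\<lambda>v. (1 / c) *\<^sub>R (Z *v v)) \<in> infinitesimal_stabilizer b N d \<phi>"
      by (rule infinitesimal_stabilizer_scaleR[OF alt Zg])
    show "(\<lambda>v. (1 / c) *\<^sub>R (Z *v v)) \<in> mixed_part b W"
      by (rule mixed_part_scaleR[OF Zm subW])
    show "b ((1 / c) *\<^sub>R (Z *v \<tau> 0 i)) z = b (\<tau>' i) z" if "z \<in> perp b W" for i z
      using Z\<tau>[OF that, of i] cpos skew[of "\<tau> 0 i" z] by (simp add: bb.scaleR_left field_simps)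
  qed
qed

end

section \<open>Charts\<close>

lemma eventually_nhds_isCont:
  "isCont f p \<Longrightarrow> open U \<Longrightarrow> f p \<in> U \<Longrightarrow> \<forall>\<^sub>F q in nhds p. f q \<in> U"
  by (simp add: eventually_nhds_conv_at isCont_def topological_tendstoD)

lemma has_derivative_transform_nhds:
  assumes "(f has_derivative f') (at p)" "\<forall>\<^sub>F q in nhds p. f q = g q"
  shows "(g has_derivative f') (at p)"
  using assms eventually_nhds_x_imp_x[OF assms(2)]
  by (intro has_derivative_transform_eventually[of f f' p UNIV g]) (auto simp:
      eventually_nhds_conv_at)

lemma differentiable_transform_nhds:
  "f differentiable at p \<Longrightarrow> \<forall>\<^sub>F q in nhds p. f q = g q \<Longrightarrow> g differentiable at p"
  unfolding differentiable_def by (blast intro: has_derivative_transform_nhds)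

lemma frechet_derivative_cong_nhds:
  assumes "\<forall>\<^sub>F q in nhds p. f q = h q"
  shows "frechet_derivative f (at p) = frechet_derivative h (at p)"
proof -
  have "(f has_derivative D) (at p) \<longleftrightarrow> (h has_derivative D) (at p)" for D
    using has_derivative_transform_nhds[of f D p h] has_derivative_transform_nhds[of h D p f] assms
    by (auto simp: eq_commute)
  then show ?thesis by (simp add: frechet_derivative_def)
qed

text \<open>Linearity in v passes from \<open>H r\<close> to the derivative by uniqueness of
  derivatives.\<close>

lemma linear_family_derivative:
  fixes H :: "'r::real_normed_vector \<Rightarrow> 'v::real_vector \<Rightarrow> 'b::real_normed_vector"
  assumes H: "\<And>v. ((\<lambda>r. H r v) has_derivative H' v) (at p)"
    and lin: "\<forall>\<^sub>F r in nhds p. linear (H r)"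
  shows "linear (\<lambda>v. H' v u)"
proof (rule linearI)
  fix v w and r :: real
  have "((\<lambda>r. H r (v + w)) has_derivative (\<lambda>u. H' v u + H' w u)) (at p)"
    by (rule has_derivative_transform_nhds[OF has_derivative_add[OF H[of v] H[of w]]])
      (use lin in eventually_elim, simp add: linear_add)
  from fun_cong[OF has_derivative_unique[OF H this]] show "H' (v + w) u = H' v u + H' w u" .
  have "((\<lambda>q. H q (r *\<^sub>R v)) has_derivative (\<lambda>u. r *\<^sub>R H' v u)) (at p)"
    by (rule has_derivative_transform_nhds[OF has_derivative_scaleR_right[OF H[of v]]])
      (use lin in eventually_elim, simp add: linear_scale)
  from fun_cong[OF has_derivative_unique[OF H this]] show "H' (r *\<^sub>R v) u = r *\<^sub>R H' v u" .
qed

text \<open>This product rule asks for differentiability of \<open>H\<close> only at each fixed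
  vector; expanding \<open>a r\<close> in the standard basis leaves a finite sum of ordinary
  products.\<close>

lemma has_derivative_linear_family:
  fixes H :: "'r::real_normed_vector \<Rightarrow> real ^ 'k::finite \<Rightarrow> 'b::real_normed_vector"
  assumes H: "\<And>v. ((\<lambda>r. H r v) has_derivative H' v) (at p)"
    and lin: "\<forall>\<^sub>F r in nhds p. linear (H r)"
    and a: "(a has_derivative a') (at p)"
  shows "((\<lambda>r. H r (a r)) has_derivative (\<lambda>w. H p (a' w) + H' (a p) w)) (at p)"
proof -
  have "((\<lambda>r. \<Sum>i\<in>UNIV. (a r $ i) *\<^sub>R H r (axis i 1)) has_derivative
     (\<lambda>w. \<Sum>i\<in>UNIV. (a p $ i) *\<^sub>R H' (axis i 1) w + (a' w $ i) *\<^sub>R H p (axis i 1))) (at p)"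
    by (intro has_derivative_sum has_derivative_scaleR H bounded_linear.has_derivative[OF
        bounded_linear_vec_nth] a)
  also have "(\<lambda>w. \<Sum>i\<in>UNIV. (a p $ i) *\<^sub>R H' (axis i 1) w + (a' w $ i) *\<^sub>R H p (axis i 1))
      = (\<lambda>w. H p (a' w) + H' (a p) w)"
    using linear_expand[OF linear_family_derivative[OF H lin], of "a p"]
      linear_expand[OF eventually_nhds_x_imp_x[OF lin], of "a' _"]
    by (simp add: sum.distrib fun_eq_iff add.commute)
  finally show ?thesis
    by (rule has_derivative_transform_nhds)
      (use lin in eventually_elim, simp add: linear_expand[symmetric])
qed

lemma differentiable_vec_lambda:
  fixes f :: "'p::real_normed_vector \<Rightarrow> real ^ 'k::finite"
  assumes "\<And>k. (\<lambda>q. f q $ k) differentiable at p"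
  shows "f differentiable at p"
  using assms by (subst differentiable_componentwise_within) (auto simp: Basis_vec_def inner_axis)

lemma differentiable_vec_nth:
  "f differentiable at p \<Longrightarrow> (\<lambda>q. f q $ k) differentiable at p"
  unfolding differentiable_def
  by (blast intro: bounded_linear.has_derivative[OF bounded_linear_vec_nth])

lemma differentiable_det:
  fixes M :: "'p::real_normed_vector \<Rightarrow> real ^ 'k::finite ^ 'k"
  assumes "\<And>i j. (\<lambda>q. M q $ i $ j) differentiable at p"
  shows "(\<lambda>q. det (M q)) differentiable at p"
proof -
  have "(\<lambda>q. \<Prod>i\<in>UNIV. M q $ i $ \<pi> i) differentiable at p" for \<pi> :: "'k \<Rightarrow> 'k"
    unfolding differentiable_def
    by (rule exI, rule has_derivative_prod) (use assms in \<open>auto simp: frechet_derivative_works\<close>)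
  then show ?thesis
    unfolding det_def by (intro differentiable_sum ballI differentiable_mult differentiable_const)
        auto
qed

text \<open>By Cramer's rule the solution is a quotient of determinants in the data. It is used
  wherever a frame or a Gram matrix has to be inverted differentiably.\<close>

lemma differentiable_solve:
  fixes M :: "'p::real_normed_vector \<Rightarrow> real ^ 'k::finite ^ 'k"
  assumes M: "\<And>i j. (\<lambda>q. M q $ i $ j) differentiable at p" and det: "det (M p) \<noteq> 0"
    and y: "y differentiable at p" and eq: "\<forall>\<^sub>F q in nhds p. M q *v x q = y q"
  shows "x differentiable at p"
proof -
  define X where "X q = (\<chi> k. det (\<chi> i j. if j = k then y q $ i else M q $ i $ j) / det (M q))"
      for q
  have "isCont (\<lambda>q. det (M q)) p"
    by (rule differentiable_imp_continuous_within[OF differentiable_det[OF M]])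
  then have "\<forall>\<^sub>F q in nhds p. det (M q) \<in> - {0}"
    by (rule eventually_nhds_isCont) (use det in auto)
  with eq have "\<forall>\<^sub>F q in nhds p. X q = x q"
    by eventually_elim (simp add: cramer X_def)
  moreover have "X differentiable at p"
  proof (rule differentiable_vec_lambda)
    fix k
    have "(\<lambda>q. (\<chi> i j. if j = k then y q $ i else M q $ i $ j) $ i $ j) differentiable at p" for i j
      using M[of i j] differentiable_vec_nth[OF y, of i] by (cases "j = k") simp_all
    then show "(\<lambda>q. X q $ k) differentiable at p"
      unfolding X_def by (simp add: differentiable_divide differentiable_det M det)
  qed
  ultimately show ?thesis by (rule differentiable_transform_nhds[rotated])
qed

lemma smooth_on_open: "smooth_on f S \<Longrightarrow> open S"
  by (simp add: smooth_on_def)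

lemma smooth_on_differentiable:
  assumes "smooth_on f S" "x \<in> S"
  shows "f differentiable at x"
proof -
  have "Ck_on (Suc 0) f S" "open S" using assms(1) unfolding smooth_on_def by blast+
  then show ?thesis using assms(2) by (auto simp: differentiable_on_eq_differentiable_at)
qed

lemma smooth_on_differentiable_frechet:
  assumes "smooth_on f S" "x \<in> S"
  shows "(\<lambda>x. frechet_derivative f (at x) v) differentiable at x"
proof -
  have "Ck_on (Suc (Suc 0)) f S" "open S" using assms(1) unfolding smooth_on_def by blast+
  then show ?thesis using assms(2) by (auto simp: differentiable_on_eq_differentiable_at)
qed

section \<open>Transition maps and components of tangent vectors\<close>

locale oriented_manifold =
  fixes A :: "('m::{t2_space, second_countable_topology}, 'n::finite) chart set"
  assumes atlas: "oriented_atlas A"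
begin

lemma chart_at: "chart_at A x \<in> A" "x \<in> cdom (chart_at A x)"
proof -
  have "\<exists>c. c \<in> A \<and> x \<in> cdom c" using atlas unfolding oriented_atlas_def by blast
  then have "chart_at A x \<in> A \<and> x \<in> cdom (chart_at A x)"
    unfolding chart_at_def by (rule someI_ex)
  then show "chart_at A x \<in> A" "x \<in> cdom (chart_at A x)" by auto
qed

abbreviation center :: "'m \<Rightarrow> real ^ 'n" where
  "center x \<equiv> cmap (chart_at A x) x"

lemma open_cdom: "c \<in> A \<Longrightarrow> open (cdom c)"
  and open_crange: "c \<in> A \<Longrightarrow> open (crange c)"
  and homeo: "c \<in> A \<Longrightarrow> homeomorphism (cdom c) (crange c) (cmap c) (cinv c)"
  using atlas unfolding oriented_atlas_def by blast+

lemma cinv_cmap: "c \<in> A \<Longrightarrow> x \<in> cdom c \<Longrightarrow> cinv c (cmap c x) = x"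
  using homeo[of c] by (auto simp: homeomorphism_def)

lemma cmap_cinv: "c \<in> A \<Longrightarrow> p \<in> crange c \<Longrightarrow> cmap c (cinv c p) = p"
  using homeo[of c] by (auto simp: homeomorphism_def)

lemma cinv_in: "c \<in> A \<Longrightarrow> p \<in> crange c \<Longrightarrow> cinv c p \<in> cdom c"
  by (auto simp: cinv_cmap)

lemma isCont_cmap: "c \<in> A \<Longrightarrow> x \<in> cdom c \<Longrightarrow> isCont (cmap c) x"
  using homeo[of c] open_cdom[of c]
  by (auto simp: homeomorphism_def continuous_on_eq_continuous_at)

lemma isCont_cinv: "c \<in> A \<Longrightarrow> p \<in> crange c \<Longrightarrow> isCont (cinv c) p"
  using homeo[of c] open_crange[of c]
  by (auto simp: homeomorphism_def continuous_on_eq_continuous_at)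

lemma transition_apply: "c \<in> A \<Longrightarrow> x \<in> cdom c \<Longrightarrow> transition c c' (cmap c x) = cmap c' x"
  by (simp add: transition_def cinv_cmap)

abbreviation dtransition :: "('m, 'n) chart \<Rightarrow> ('m, 'n) chart \<Rightarrow> 'm \<Rightarrow> real ^ 'n \<Rightarrow> real ^ 'n" where
  "dtransition c c' x \<equiv> frechet_derivative (transition c c') (at (cmap c x))"

lemma transition_has_derivative:
  assumes "c \<in> A" "c' \<in> A" "x \<in> cdom c" "x \<in> cdom c'"
  shows "(transition c c' has_derivative dtransition c c' x) (at (cmap c x))"
proof -
  have "smooth_on (transition c c') (cmap c ` (cdom c \<inter> cdom c'))"
    using atlas assms unfolding oriented_atlas_def by blast
  from smooth_on_differentiable[OF this] show ?thesis
    using assms by (simp add: frechet_derivative_works[symmetric])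
qed

lemma det_dtransition:
  "c \<in> A \<Longrightarrow> c' \<in> A \<Longrightarrow> x \<in> cdom c \<Longrightarrow> x \<in> cdom c' \<Longrightarrow> 0 < det (matrix (dtransition c c' x))"
  using atlas unfolding oriented_atlas_def by blast

lemma dtransition_compose:
  assumes c: "c \<in> A" "c' \<in> A" "c'' \<in> A" and x: "x \<in> cdom c" "x \<in> cdom c'" "x \<in> cdom c''"
  shows "dtransition c c'' x = dtransition c' c'' x \<circ> dtransition c c' x"
proof -
  have "((transition c' c'' \<circ> transition c c') has_derivative (dtransition c' c'' x \<circ> dtransition
      c c' x)) (at (cmap c x))"
    using transition_has_derivative c x
    by (intro diff_chain_at) (simp_all add: transition_apply)
  moreover have "\<forall>\<^sub>F p in nhds (cmap c x). (transition c' c'' \<circ> transition c c') p = transition c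
      c'' p"
  proof -
    have "\<forall>\<^sub>F p in nhds (cmap c x). cinv c p \<in> cdom c'"
      using c x by (intro eventually_nhds_isCont isCont_cinv open_cdom) (auto simp: cinv_cmap)
    then show ?thesis
      by eventually_elim (use c in \<open>simp add: transition_def cinv_cmap\<close>)
  qed
  ultimately have "(transition c c'' has_derivative (dtransition c' c'' x \<circ> dtransition c c' x))
      (at (cmap c x))"
    by (rule has_derivative_transform_nhds)
  then show ?thesis by (rule frechet_derivative_at[symmetric])
qed

lemma dtransition_id:
  assumes c: "c \<in> A" and x: "x \<in> cdom c"
  shows "dtransition c c x = id"
proof -
  have "\<forall>\<^sub>F p in nhds (cmap c x). p \<in> crange c"
    using open_crange[OF c] x by (intro eventually_nhds_in_open) auto
  then have "\<forall>\<^sub>F p in nhds (cmap c x). id p = transition c c p"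
    by eventually_elim (simp add: transition_def cmap_cinv[OF c])
  from has_derivative_transform_nhds[OF has_derivative_id this]
  show ?thesis using frechet_derivative_at by (metis eq_id_iff)
qed

lemma to_chart_eq: "to_chart A c x = dtransition (chart_at A x) c x"
  by (simp add: to_chart_def)

lemma of_chart_eq: "of_chart A c x = dtransition c (chart_at A x) x"
  by (simp add: of_chart_def)

lemma linear_dtransition:
  "c \<in> A \<Longrightarrow> c' \<in> A \<Longrightarrow> x \<in> cdom c \<Longrightarrow> x \<in> cdom c' \<Longrightarrow> linear (dtransition c c' x)"
  using transition_has_derivative has_derivative_linear by blast

lemma linear_to_chart: "c \<in> A \<Longrightarrow> x \<in> cdom c \<Longrightarrow> linear (to_chart A c x)"
  unfolding to_chart_eq using linear_dtransition chart_at by blast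

lemma linear_of_chart: "c \<in> A \<Longrightarrow> x \<in> cdom c \<Longrightarrow> linear (of_chart A c x)"
  unfolding of_chart_eq using linear_dtransition chart_at by blast

lemma of_chart_to_chart: "c \<in> A \<Longrightarrow> x \<in> cdom c \<Longrightarrow> of_chart A c x (to_chart A c x v) = v"
  unfolding to_chart_eq of_chart_eq
  using dtransition_compose[OF chart_at(1) _ chart_at(1) chart_at(2) _ chart_at(2), of c x]
    dtransition_id[OF chart_at, of x]
  by (simp add: fun_eq_iff)

lemma to_chart_self [simp]: "to_chart A (chart_at A x) x = id"
  unfolding to_chart_eq by (rule dtransition_id[OF chart_at])

lemma of_chart_self [simp]: "of_chart A (chart_at A x) x = id"
  unfolding of_chart_eq by (rule dtransition_id[OF chart_at])

lemma det_to_chart: "c \<in> A \<Longrightarrow> x \<in> cdom c \<Longrightarrow> 0 < det (matrix (to_chart A c x))"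
  unfolding to_chart_eq by (intro det_dtransition chart_at)

text \<open>Continuity is a separate requirement: a chart map is an arbitrary function off its
  domain, so differentiability of its composition with F is meaningful only if F stays in that
  domain near p.\<close>

definition map_differentiable :: "('p::real_normed_vector \<Rightarrow> 'm) \<Rightarrow> 'p \<Rightarrow> bool" where
  "map_differentiable F p \<longleftrightarrow> isCont F p \<and> (cmap (chart_at A (F p)) \<circ> F) differentiable at p"

lemma map_has_derivative:
  assumes F: "map_differentiable F p" and c: "c \<in> A" "F p \<in> cdom c"
  shows "((cmap c \<circ> F) has_derivative (\<lambda>w. to_chart A c (F p) (differential A F p w))) (at p)"
proof -
  define c0 where "c0 = chart_at A (F p)"
  have "((cmap c0 \<circ> F) has_derivative differential A F p) (at p)"
    using F by (simp add: map_differentiable_def differential_def c0_def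
        frechet_derivative_works[symmetric])
  moreover have "(transition c0 c has_derivative to_chart A c (F p)) (at ((cmap c0 \<circ> F) p))"
    using transition_has_derivative[OF chart_at(1) c(1) chart_at(2) c(2)]
    by (simp add: to_chart_eq c0_def)
  ultimately have "((transition c0 c \<circ> (cmap c0 \<circ> F)) has_derivative (to_chart A c (F p) \<circ>
      differential A F p)) (at p)"
    by (rule diff_chain_at)
  moreover have "\<forall>\<^sub>F q in nhds p. (transition c0 c \<circ> (cmap c0 \<circ> F)) q = (cmap c \<circ> F) q"
  proof -
    have "\<forall>\<^sub>F q in nhds p. F q \<in> cdom c0"
      using F chart_at[of "F p"]
      by (intro eventually_nhds_isCont open_cdom) (auto simp: map_differentiable_def c0_def)
    then show ?thesis
      by eventually_elim (simp add: transition_apply chart_at c0_def)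
  qed
  ultimately show ?thesis
    by (simp add: o_def has_derivative_transform_nhds)
qed

lemma map_differentiableI:
  assumes "isCont F p" and c: "c \<in> A" "F p \<in> cdom c" and der: "(cmap c \<circ> F) differentiable at p"
  shows "map_differentiable F p"
proof -
  define c0 where "c0 = chart_at A (F p)"
  have "(transition c c0 \<circ> (cmap c \<circ> F)) differentiable at p"
    using der transition_has_derivative[OF c(1) chart_at(1) c(2) chart_at(2)]
    by (intro differentiable_chain_at) (auto simp: c0_def differentiable_def)
  moreover have "\<forall>\<^sub>F q in nhds p. (transition c c0 \<circ> (cmap c \<circ> F)) q = (cmap c0 \<circ> F) q"
  proof -
    have "\<forall>\<^sub>F q in nhds p. F q \<in> cdom c"
      using assms by (intro eventually_nhds_isCont open_cdom)
    then show ?thesis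
      by eventually_elim (simp add: transition_apply c)
  qed
  ultimately show ?thesis
    using assms(1) unfolding map_differentiable_def c0_def by (blast intro:
        differentiable_transform_nhds)
qed

lemma map_differentiable_eventually:
  assumes "map_differentiable F p" "open U" "F p \<in> U"
  shows "\<forall>\<^sub>F q in nhds p. F q \<in> U"
  using assms by (intro eventually_nhds_isCont) (auto simp: map_differentiable_def)

lemma map_differentiable_cinv:
  assumes c: "c \<in> A" and p: "p \<in> crange c"
  shows "map_differentiable (cinv c) p"
proof (rule map_differentiableI[OF isCont_cinv[OF c p] c cinv_in[OF c p]])
  have "\<forall>\<^sub>F q in nhds p. id q = (cmap c \<circ> cinv c) q"
    using eventually_nhds_in_open[OF open_crange[OF c] p]
    by eventually_elim (simp add: cmap_cinv[OF c])
  then show "(cmap c \<circ> cinv c) differentiable at p"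
    using has_derivative_transform_nhds[OF has_derivative_id] differentiable_def by blast
qed

lemma differential_cinv:
  "differential A (cinv (chart_at A x)) (center x) w = w"
proof -
  define c where "c = chart_at A x"
  have c: "c \<in> A" "x \<in> cdom c" by (auto simp: c_def chart_at)
  have "\<forall>\<^sub>F q in nhds (cmap c x). id q = (cmap c \<circ> cinv c) q"
    using eventually_nhds_in_open[OF open_crange[OF c(1)], of "cmap c x"] c(2)
    by (auto elim!: eventually_mono simp: cmap_cinv[OF c(1)])
  from frechet_derivative_at[OF has_derivative_transform_nhds[OF has_derivative_id this]]
  have "frechet_derivative (cmap c \<circ> cinv c) (at (cmap c x)) = id" by (simp add: o_def)
  then show ?thesis using c by (simp add: differential_def cinv_cmap c_def[symmetric])
qed

end

section \<open>The Levi-Civita connection in an adapted frame\<close>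

lemma (in orthonormal_frame) riesz:
  assumes "linear L"
  obtains y where "\<And>z. b y z = L z"
proof -
  define y where "y = E (\<Sum>i\<in>UNIV. L (E (axis i 1)) *\<^sub>R axis i 1)"
  have lin: "linear (L \<circ> E)" by (intro linear_compose linear_E assms)
  have "b y z = L z" for z
  proof -
    have "b y z = (\<Sum>i\<in>UNIV. L (E (axis i 1)) *\<^sub>R axis i 1) \<bullet> inv E z"
      by (simp add: y_def b_eq)
    also have "\<dots> = (L \<circ> E) (inv E z)"
      unfolding linear_expand[OF lin, of "inv E z"] by (simp add: inner_sum_left inner_axis'
          mult.commute)
    finally show ?thesis by simp
  qed
  then show ?thesis by (rule that)
qed

text \<open>\<open>E x z\<close> is the value at \<open>z \<in> V x\<close> of a frame that is chosen separately for each \<open>x\<close>.\<close>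

locale G_manifold = oriented_manifold A
  for A :: "('m::{t2_space, second_countable_topology}, 'n::finite) chart set" +
  fixes g :: "'m \<Rightarrow> real ^ 'n \<Rightarrow> real ^ 'n \<Rightarrow> real"
    and N :: nat and d :: "nat \<Rightarrow> nat" and \<alpha> :: "nat \<Rightarrow> 'm \<Rightarrow> (real ^ 'n) form"
    and \<phi> :: "nat \<Rightarrow> (real ^ 'n) form"
    and V :: "'m \<Rightarrow> 'm set" and E :: "'m \<Rightarrow> 'm \<Rightarrow> real ^ 'n \<Rightarrow> real ^ 'n"
  assumes metric: "riemannian_metric A g"
    and alternating: "j \<le> N \<Longrightarrow> alternating_form (d j) (\<alpha> j x)"
    and parallel: "j \<le> N \<Longrightarrow> parallel_form A g (d j) (\<alpha> j)"
    and open_V: "open (V x)" and in_V: "x \<in> V x"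
    and smooth_frame: "smooth_section A A id (V x) (\<lambda>z. E x z v)"
    and frame: "z \<in> V x \<Longrightarrow> orthonormal_frame (g z) (E x z)"
    and frame_forms: "z \<in> V x \<Longrightarrow> j \<le> N \<Longrightarrow> \<alpha> j z (\<lambda>i. E x z (X i)) = \<phi> j X"
begin

sublocale pt: orthonormal_frame "g x" "E x x" for x
  by (rule frame[OF in_V])

section \<open>Christoffel symbols and the derivative of the metric\<close>

abbreviation chr :: "'m \<Rightarrow> real ^ 'n \<Rightarrow> real ^ 'n \<Rightarrow> real ^ 'n" where
  "chr x \<equiv> christoffel A g (chart_at A x) (center x)"

definition Dmetric :: "'m \<Rightarrow> real ^ 'n \<Rightarrow> real ^ 'n \<Rightarrow> real ^ 'n \<Rightarrow> real" where
  "Dmetric x v w = frechet_derivative (\<lambda>q. metric_in_chart A g (chart_at A x) q v w)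
     (at (center x))"

lemma cmap_in_crange: "center x \<in> crange (chart_at A x)"
  using chart_at by auto

lemma metric_in_chart_at: "metric_in_chart A g (chart_at A x) (center x) v w = g x v w"
  by (simp add: metric_in_chart_def cinv_cmap chart_at)

lemma Dmetric:
  "((\<lambda>q. metric_in_chart A g (chart_at A x) q v w) has_derivative Dmetric x v w)
     (at (center x))"
proof -
  have "smooth_on (\<lambda>p. metric_in_chart A g (chart_at A x) p v w) (crange (chart_at A x))"
    using metric chart_at(1) by (auto simp: riemannian_metric_def)
  from smooth_on_differentiable[OF this cmap_in_crange]
  show ?thesis by (simp add: Dmetric_def frechet_derivative_works[symmetric])
qed

lemma metric_in_chart_commute:
  "metric_in_chart A g c p v w = metric_in_chart A g c p w v"
  by (simp add: metric_in_chart_def pt.b_commute)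

lemma Dmetric_commute: "Dmetric x v w = Dmetric x w v"
  by (simp add: Dmetric_def metric_in_chart_commute)

lemma metric_in_chart_linear:
  assumes "c \<in> A" "p \<in> crange c"
  shows "linear (metric_in_chart A g c p v)"
proof -
  have "linear (of_chart A c (cinv c p))"
    using assms by (intro linear_of_chart cinv_in)
  then show ?thesis
    by (intro linearI) (simp_all add: metric_in_chart_def linear_add linear_scale pt.bb.add_right
        pt.bb.scaleR_right)
qed

lemma eventually_crange:
  "\<forall>\<^sub>F q in nhds (center x). q \<in> crange (chart_at A x)"
  by (rule eventually_nhds_in_open[OF open_crange[OF chart_at(1)] cmap_in_crange])

lemma eventually_metric_linear:
  "\<forall>\<^sub>F q in nhds (center x). linear (metric_in_chart A g (chart_at A x) q v)"
  using eventually_crange by eventually_elim (rule metric_in_chart_linear[OF chart_at(1)])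

lemma Dmetric_linear: "linear (\<lambda>w. Dmetric x v w u)"
  by (rule linear_family_derivative[OF Dmetric eventually_metric_linear])

lemma Dmetric_linear_dir: "linear (Dmetric x v w)"
  by (rule has_derivative_linear[OF Dmetric])

text \<open>The Koszul expression is linear in z, so it is represented by a vector, unique by
  nondegeneracy of the metric. This validates the definite description in
  \<open>christoffel\<close>.\<close>

lemma christoffel_koszul:
  "g x (chr x v w) z = (Dmetric x w z v + Dmetric x v z w - Dmetric x v w z) / 2"
proof -
  define L where "L z = (Dmetric x w z v + Dmetric x v z w - Dmetric x v w z) / 2" for z
  have "linear L"
    by (rule linearI)
      (simp_all add: L_def linear_add[OF Dmetric_linear] linear_add[OF Dmetric_linear_dir]
        linear_scale[OF Dmetric_linear] linear_scale[OF Dmetric_linear_dir] field_simps)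
  then obtain y where y: "\<And>z. g x y z = L z" by (rule pt.riesz) blast
  have "chr x v w = y"
    unfolding christoffel_def Dmetric_def[symmetric] metric_in_chart_at L_def[symmetric]
    by (rule the_equality) (simp add: y, metis pt.b_eqI y)
  then show ?thesis using y by (simp add: L_def)
qed

text \<open>Metric compatibility: in the sum of the Koszul formula and the one with w and z
  exchanged, the other derivatives of the metric cancel.\<close>

lemma christoffel_metric: "Dmetric x w z v = g x (chr x v w) z + g x w (chr x v z)"
  using christoffel_koszul[of x v w z] christoffel_koszul[of x v z w]
  by (simp add: pt.b_commute[of x w] Dmetric_commute[of x z w] Dmetric_commute[of x v])

lemma christoffel_linear: "linear (chr x v)"
proof -
  have l: "linear (\<lambda>w. Dmetric x w z u)" for z u
    unfolding Dmetric_commute[of x _ z] by (rule Dmetric_linear)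
  show ?thesis
    by (intro linearI pt.b_eqI[of x])
      (simp_all add: pt.bb.add_left pt.bb.scaleR_left christoffel_koszul linear_add[OF l]
        linear_add[OF Dmetric_linear] linear_add[OF Dmetric_linear_dir] linear_scale[OF l]
        linear_scale[OF Dmetric_linear] linear_scale[OF Dmetric_linear_dir] field_simps)
qed

lemma metric_in_chart_has_derivative:
  assumes a: "(a has_derivative a') (at (center x))"
    and b: "(b has_derivative b') (at (center x))"
  shows "((\<lambda>q. metric_in_chart A g (chart_at A x) q (a q) (b q)) has_derivative
     (\<lambda>u. g x (a' u) (b (center x)) + (g x (a (center x)) (b' u)
       + Dmetric x (a (center x)) (b (center x)) u)))
     (at (center x))"
proof -
  define c where "c = chart_at A x"
  have d: "((\<lambda>q. metric_in_chart A g c q v (b q)) has_derivative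
      (\<lambda>u. g x v (b' u) + Dmetric x v (b (cmap c x)) u)) (at (cmap c x))" for v
    using has_derivative_linear_family[OF Dmetric eventually_metric_linear b]
    by (simp add: c_def metric_in_chart_at)
  have l: "\<forall>\<^sub>F q in nhds (cmap c x). linear (\<lambda>v. metric_in_chart A g c q v (b q))"
    using eventually_crange unfolding c_def metric_in_chart_commute[of _ _ _ "b _"]
    by eventually_elim (rule metric_in_chart_linear[OF chart_at(1)])
  show ?thesis
    using has_derivative_linear_family[OF d l a[folded c_def]] by (simp add: c_def
        metric_in_chart_at)
qed

text \<open>The factor \<open>inv (E x x)\<close> normalises the frame to the identity at the
  centre, so that its derivative there acts directly on the tangent space at x.\<close>

definition frame_chart :: "'m \<Rightarrow> real ^ 'n \<Rightarrow> real ^ 'n \<Rightarrow> real ^ 'n" where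
  "frame_chart x r v = to_chart A (chart_at A x) (cinv (chart_at A x) r)
     (E x (cinv (chart_at A x) r) (inv (E x x) v))"

definition dframe :: "'m \<Rightarrow> real ^ 'n \<Rightarrow> real ^ 'n \<Rightarrow> real ^ 'n" where
  "dframe x u v = frechet_derivative (\<lambda>r. frame_chart x r v) (at (center x)) u"

text \<open>The connection form at \<open>x\<close>, made an endomorphism of the tangent space by means of the frame.\<close>

definition frame_connection :: "'m \<Rightarrow> real ^ 'n \<Rightarrow> real ^ 'n \<Rightarrow> real ^ 'n" where
  "frame_connection x u v = dframe x u v + chr x u v"

lemma frame_chart_at: "frame_chart x (center x) v = v"
  by (simp add: frame_chart_def cinv_cmap chart_at)

lemma frame_chart_has_derivative:
  "((\<lambda>r. frame_chart x r v) has_derivative (\<lambda>u. dframe x u v)) (at (center x))"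
proof -
  define c where "c = chart_at A x"
  have "smooth_on (\<lambda>p. to_chart A c (id (cinv c p)) (E x (cinv c p) (inv (E x x) v)))
        (cmap c ` (V x \<inter> cdom c \<inter> id -` cdom c))"
    using smooth_frame[of x "inv (E x x) v"] chart_at(1)[of x]
    unfolding smooth_section_def c_def by blast
  from smooth_on_differentiable[OF this, of "cmap c x"]
  have "(\<lambda>r. frame_chart x r v) differentiable at (cmap c x)"
    using in_V chart_at(2) by (auto simp: frame_chart_def c_def)
  then show ?thesis
    by (simp add: dframe_def c_def frechet_derivative_works[symmetric])
qed

lemma eventually_frame:
  "\<forall>\<^sub>F r in nhds (center x). r \<in> crange (chart_at A x) \<and> cinv (chart_at A x) r \<in> V x"
proof (rule eventually_conj[OF eventually_crange])
  show "\<forall>\<^sub>F r in nhds (center x). cinv (chart_at A x) r \<in> V x"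
    by (rule eventually_nhds_isCont[OF isCont_cinv[OF chart_at(1) cmap_in_crange] open_V])
      (simp add: cinv_cmap chart_at in_V)
qed

lemma linear_frame_chart:
  assumes "r \<in> crange (chart_at A x)" "cinv (chart_at A x) r \<in> V x"
  shows "linear (frame_chart x r)"
proof -
  interpret f: orthonormal_frame "g (cinv (chart_at A x) r)" "E x (cinv (chart_at A x) r)"
    by (rule frame[OF assms(2)])
  have "linear (to_chart A (chart_at A x) (cinv (chart_at A x) r))"
    by (intro linear_to_chart chart_at cinv_in assms)
  then have "linear (to_chart A (chart_at A x) (cinv (chart_at A x) r) \<circ> (E x (cinv (chart_at A x)
      r) \<circ> inv (E x x)))"
    by (intro linear_compose pt.linear_inv_E f.linear_E)
  then show ?thesis by (simp add: frame_chart_def[abs_def] o_def)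
qed

lemma eventually_linear_frame_chart:
  "\<forall>\<^sub>F r in nhds (center x). linear (frame_chart x r)"
  using eventually_frame by eventually_elim (auto intro: linear_frame_chart)

lemma linear_dframe: "linear (dframe x u)"
  by (rule linear_family_derivative[OF frame_chart_has_derivative eventually_linear_frame_chart])

lemma linear_frame_connection: "linear (frame_connection x u)"
  by (rule linearI)
    (simp_all add: frame_connection_def linear_add[OF linear_dframe] linear_add[OF
        christoffel_linear]
      linear_scale[OF linear_dframe] linear_scale[OF christoffel_linear] scaleR_right_distrib)

text \<open>Inner products of frame fields are constant. Differentiating them at the centre also
  produces a derivative of the metric, which \<open>christoffel_metric\<close> turns into exactly
  the Christoffel terms of the connection form.\<close>

lemma frame_connection_skew: "g x (frame_connection x u v) w = - g x v (frame_connection x u w)"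
proof -
  define c where "c = chart_at A x"
  have "((\<lambda>r. metric_in_chart A g c r (frame_chart x r v) (frame_chart x r w)) has_derivative
     (\<lambda>u. g x (dframe x u v) w + (g x v (dframe x u w) + Dmetric x v w u))) (at (cmap c x))"
    using metric_in_chart_has_derivative[OF frame_chart_has_derivative[of x v]
        frame_chart_has_derivative[of x w]]
    by (simp add: frame_chart_at c_def)
  moreover have "((\<lambda>r. metric_in_chart A g c r (frame_chart x r v) (frame_chart x r w))
      has_derivative (\<lambda>u. 0)) (at (cmap c x))"
  proof (rule has_derivative_transform_nhds[OF has_derivative_const])
    show "\<forall>\<^sub>F r in nhds (cmap c x). inv (E x x) v \<bullet> inv (E x x) w =
        metric_in_chart A g c r (frame_chart x r v) (frame_chart x r w)"
      using eventually_frame[of x, folded c_def]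
    proof eventually_elim
      case (elim r)
      then interpret f: orthonormal_frame "g (cinv c r)" "E x (cinv c r)" by (intro frame) auto
      have "cinv c r \<in> cdom c" "c \<in> A" using elim chart_at by (auto simp: c_def intro: cinv_in)
      then show ?case
        by (simp add: metric_in_chart_def frame_chart_def c_def[symmetric] of_chart_to_chart
            f.frame_isometry)
    qed
  qed
  ultimately have "(\<lambda>u. g x (dframe x u v) w + (g x v (dframe x u w) + Dmetric x v w u)) = (\<lambda>u. 0)"
    by (rule has_derivative_unique)
  then have "g x (dframe x u v) w + (g x v (dframe x u w) + Dmetric x v w u) = 0" by meson
  then show ?thesis
    by (simp add: frame_connection_def christoffel_metric pt.bb.add_left pt.bb.add_right)
qed

lemma frame_connection_eq_levi_civita:
  "frame_connection x u v = levi_civita A g (cinv (chart_at A x))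
     (\<lambda>r. E x (cinv (chart_at A x) r) (inv (E x x) v)) (center x) u"
  by (simp add: frame_connection_def levi_civita_def cinv_cmap chart_at Let_def differential_cinv
      dframe_def frame_chart_def)

text \<open>The forms are constant on the frame fields, so a parallel form is annihilated by the
  connection form of the frame.\<close>

lemma frame_connection_diamond:
  assumes j: "j \<le> N"
  shows "diamond (d j) (frame_connection x u) (\<alpha> j x) X = 0"
proof -
  define c where "c = chart_at A x"
  define Y where "Y i z = E x z (inv (E x x) (X i))" for i z
  have "nabla_form A g (d j) (\<alpha> j) x u Y = 0"
    by (rule parallel[OF j, unfolded parallel_form_def, rule_format, OF open_V in_V])
      (simp add: Y_def[abs_def] smooth_frame)
  moreover have "frechet_derivative (\<lambda>p. \<alpha> j (cinv c p) (\<lambda>i. Y i (cinv c p))) (at (cmap c x)) =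
      (\<lambda>u. 0)"
  proof -
    have "\<forall>\<^sub>F r in nhds (cmap c x). \<phi> j (\<lambda>i. inv (E x x) (X i)) = \<alpha> j (cinv c r) (\<lambda>i. Y i (cinv c
        r))"
      using eventually_frame[of x, folded c_def]
      by eventually_elim (simp add: Y_def frame_forms[OF _ j])
    from frechet_derivative_at[OF has_derivative_transform_nhds[OF has_derivative_const this]]
    show ?thesis by simp
  qed
  moreover have "levi_civita A g (cinv c) (Y i \<circ> cinv c) (cmap c x) u = frame_connection x u (X
      i)" for i
    unfolding frame_connection_eq_levi_civita by (simp add: o_def Y_def c_def)
  moreover have "Y i x = X i" for i by (simp add: Y_def)
  ultimately show ?thesis
    by (simp add: nabla_form_def Let_def c_def[symmetric] diamond_def)
qed

lemma frame_connection_in_stabilizer: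
  "frame_connection x u \<in> infinitesimal_stabilizer (g x) N d (\<lambda>j. \<alpha> j x)"
  using frame_connection_skew frame_connection_diamond linear_frame_connection
  by (auto simp: infinitesimal_stabilizer_def)

text \<open>The identification of the tangent spaces at \<open>z\<close> and \<open>x\<close> that makes the frame constant.\<close>

definition gauge :: "'m \<Rightarrow> 'm \<Rightarrow> real ^ 'n \<Rightarrow> real ^ 'n" where
  "gauge x z v = E x x (inv (E x z) v)"

lemma gauge_self [simp]: "gauge x x v = v"
  by (simp add: gauge_def)

lemma linear_gauge:
  assumes "z \<in> V x"
  shows "linear (gauge x z)"
proof -
  interpret f: orthonormal_frame "g z" "E x z" by (rule frame[OF assms])
  have "linear (E x x \<circ> inv (E x z))" by (intro linear_compose f.linear_inv_E pt.linear_E)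
  then show ?thesis by (simp add: gauge_def[abs_def] o_def)
qed

lemma gauge_isometry:
  assumes "z \<in> V x"
  shows "g x (gauge x z v) (gauge x z w) = g z v w"
proof -
  interpret f: orthonormal_frame "g z" "E x z" by (rule frame[OF assms])
  show ?thesis by (simp add: gauge_def pt.frame_isometry f.b_eq)
qed

lemma gauge_forms:
  assumes "z \<in> V x" "j \<le> N"
  shows "\<alpha> j x (\<lambda>i. gauge x z (X i)) = \<alpha> j z X"
proof -
  interpret f: orthonormal_frame "g z" "E x z" by (rule frame[OF assms(1)])
  have "\<alpha> j z (\<lambda>i. E x z (inv (E x z) (X i))) = \<phi> j (\<lambda>i. inv (E x z) (X i))"
    by (rule frame_forms[OF assms])
  then show ?thesis
    using frame_forms[OF in_V assms(2), of x "\<lambda>i. inv (E x z) (X i)"] by (simp add: gauge_def)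
qed

lemma gauge_bij:
  assumes "z \<in> V x"
  shows "bij (gauge x z)"
proof -
  interpret f: orthonormal_frame "g z" "E x z" by (rule frame[OF assms])
  have "bij (E x x)" "bij (E x z)"
    using pt.inj_E pt.surj_E f.inj_E f.surj_E by (auto simp: bij_def)
  then have "bij (E x x \<circ> inv (E x z))" by (intro bij_comp bij_imp_bij_inv)
  then show ?thesis by (simp add: gauge_def[abs_def] o_def)
qed

section \<open>Covariant derivatives of sections along a map, computed in the frame\<close>

definition section_differentiable ::
    "('p::real_normed_vector \<Rightarrow> 'm) \<Rightarrow> ('p \<Rightarrow> real ^ 'n) \<Rightarrow> 'p \<Rightarrow> bool" where
  "section_differentiable F s p \<longleftrightarrow>
     (\<lambda>q. to_chart A (chart_at A (F p)) (F q) (s q)) differentiable at p"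

lemma frame_chart_gauge:
  assumes "z \<in> V x" "z \<in> cdom (chart_at A x)"
  shows "frame_chart x (cmap (chart_at A x) z) (gauge x z v) = to_chart A (chart_at A x) z v"
proof -
  interpret f: orthonormal_frame "g z" "E x z" by (rule frame[OF assms(1)])
  show ?thesis by (simp add: frame_chart_def gauge_def cinv_cmap[OF chart_at(1) assms(2)])
qed

lemma eventually_gauge:
  assumes "map_differentiable F p"
  shows "\<forall>\<^sub>F q in nhds p. F q \<in> V (F p) \<and> F q \<in> cdom (chart_at A (F p))"
  using map_differentiable_eventually[OF assms, of "V (F p) \<inter> cdom (chart_at A (F p))"]
    open_V in_V open_cdom[OF chart_at(1)] chart_at(2)
  by (simp add: open_Int)

text \<open>Near \<open>p\<close> the chart components of \<open>s\<close> are
  \<open>frame_chart\<close> applied to its gauge components, so the product rule for linear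
  families gives both terms.\<close>

lemma section_has_derivative:
  assumes F: "map_differentiable F p"
    and \<sigma>: "((\<lambda>q. gauge (F p) (F q) (s q)) has_derivative \<sigma>') (at p)"
  shows "((\<lambda>q. to_chart A (chart_at A (F p)) (F q) (s q)) has_derivative
     (\<lambda>w. \<sigma>' w + dframe (F p) (differential A F p w) (s p))) (at p)"
proof -
  define x c where "x = F p" and "c = chart_at A x"
  define \<sigma> where "\<sigma> q = gauge x (F q) (s q)" for q
  have \<sigma>p: "\<sigma> p = s p" by (simp add: \<sigma>_def x_def)
  have d\<sigma>: "(\<sigma> has_derivative \<sigma>') (at p)"
    using \<sigma> by (simp add: \<sigma>_def[abs_def] x_def)
  have cF: "((cmap c \<circ> F) has_derivative differential A F p) (at p)"
    using map_has_derivative[OF F chart_at(1) chart_at(2)] by (simp add: c_def x_def)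
  have fr: "((\<lambda>q. frame_chart x (cmap c (F q)) v) has_derivative (\<lambda>w. dframe x (differential A F p
      w) v)) (at p)" for v
    using diff_chain_at[OF cF, of "\<lambda>r. frame_chart x r v" "\<lambda>u. dframe x u v"]
        frame_chart_has_derivative[of x v]
    by (simp add: o_def c_def x_def)
  have lin: "\<forall>\<^sub>F q in nhds p. linear (frame_chart x (cmap c (F q)))"
    using eventually_gauge[OF F]
    by eventually_elim (auto intro!: linear_frame_chart simp: c_def x_def cinv_cmap[OF chart_at(1)])
  have "((\<lambda>q. frame_chart x (cmap c (F q)) (\<sigma> q)) has_derivative
     (\<lambda>w. \<sigma>' w + dframe x (differential A F p w) (s p))) (at p)"
    using has_derivative_linear_family[OF fr lin d\<sigma>]
    by (simp add: \<sigma>p c_def x_def[symmetric] frame_chart_at)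
  then show ?thesis
    unfolding x_def[symmetric] c_def[symmetric]
    by (rule has_derivative_transform_nhds)
      (use eventually_gauge[OF F] in eventually_elim, simp add: \<sigma>_def c_def x_def frame_chart_gauge)
qed

text \<open>From gauge to chart this is the product rule; the converse inverts the matrix of the
  frame, which is the identity at \<open>p\<close>.\<close>

lemma section_differentiable_iff:
  assumes F: "map_differentiable F p"
  shows "section_differentiable F s p \<longleftrightarrow> (\<lambda>q. gauge (F p) (F q) (s q)) differentiable at p"
proof
  assume s: "section_differentiable F s p"
  define x c where "x = F p" and "c = chart_at A x"
  have cF: "(cmap c \<circ> F) differentiable at p"
    using F by (simp add: map_differentiable_def c_def x_def)
  have fr: "(\<lambda>q. frame_chart x (cmap c (F q)) v) differentiable at p" for v
    using differentiable_chain_at[OF cF, of "\<lambda>r. frame_chart x r v"] frame_chart_has_derivative[of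
        x v]
    by (auto simp: o_def c_def x_def differentiable_def)
  define M where "M q = matrix (frame_chart x (cmap c (F q)))" for q
  show "(\<lambda>q. gauge (F p) (F q) (s q)) differentiable at p"
  proof (rule differentiable_solve[of M])
    show "(\<lambda>q. M q $ i $ j) differentiable at p" for i j
      unfolding M_def matrix_def using differentiable_vec_nth[OF fr] by simp
    have "frame_chart x (cmap c (F p)) = id"
      by (auto simp: x_def c_def frame_chart_at)
    then show "det (M p) \<noteq> 0" by (simp add: M_def matrix_id_mat_1)
    show "(\<lambda>q. to_chart A c (F q) (s q)) differentiable at p"
      using s by (simp add: section_differentiable_def c_def x_def)
    show "\<forall>\<^sub>F q in nhds p. M q *v gauge (F p) (F q) (s q) = to_chart A c (F q) (s q)"
      using eventually_gauge[OF F] unfolding x_def[symmetric] c_def[symmetric]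
    proof eventually_elim
      case (elim q)
      then have "linear (frame_chart x (cmap c (F q)))"
        by (intro linear_frame_chart) (auto simp: c_def cinv_cmap[OF chart_at(1)])
      then show ?case
        using frame_chart_gauge[of "F q" x "s q"] elim by (simp add: M_def matrix_works c_def)
    qed
  qed
next
  assume "(\<lambda>q. gauge (F p) (F q) (s q)) differentiable at p"
  then show "section_differentiable F s p"
    using section_has_derivative[OF F] unfolding section_differentiable_def differentiable_def by
        blast
qed

text \<open>This moves the calculus into the single vector space at \<open>F p\<close>: there the
  covariant derivative is the ordinary derivative plus the connection form.\<close>

lemma levi_civita_gauge:
  assumes F: "map_differentiable F p" and s: "section_differentiable F s p"
  shows "((\<lambda>q. gauge (F p) (F q) (s q)) has_derivative
     (\<lambda>w. levi_civita A g F s p w - frame_connection (F p) (differential A F p w) (s p))) (at p)"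
proof -
  obtain \<sigma>' where \<sigma>': "((\<lambda>q. gauge (F p) (F q) (s q)) has_derivative \<sigma>') (at p)"
    using s section_differentiable_iff[OF F] by (auto simp: differentiable_def)
  have "levi_civita A g F s p w = \<sigma>' w + frame_connection (F p) (differential A F p w) (s p)" for w
    using frechet_derivative_at[OF section_has_derivative[OF F \<sigma>']]
    by (simp add: levi_civita_def Let_def frame_connection_def fun_eq_iff)
  then show ?thesis using \<sigma>' by simp
qed

text \<open>The gauge makes the metric constant, and the two connection terms cancel by
  skewness.\<close>

lemma metric_has_derivative:
  assumes F: "map_differentiable F p" and s: "section_differentiable F s p"
      "section_differentiable F s' p"
  shows "((\<lambda>q. g (F q) (s q) (s' q)) has_derivative
     (\<lambda>w. g (F p) (levi_civita A g F s p w) (s' p) + g (F p) (s p) (levi_civita A g F s' p w)))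
         (at p)"
proof -
  have "((\<lambda>q. g (F p) (gauge (F p) (F q) (s q)) (gauge (F p) (F q) (s' q))) has_derivative
     (\<lambda>w. g (F p) (levi_civita A g F s p w) (s' p) + g (F p) (s p) (levi_civita A g F s' p w)))
         (at p)"
    by (rule has_derivative_eq_rhs[OF pt.bb.FDERIV[OF levi_civita_gauge[OF F s(1)]
        levi_civita_gauge[OF F s(2)]]])
      (simp add: fun_eq_iff pt.bb.diff_left pt.bb.diff_right frame_connection_skew)
  then show ?thesis
    by (rule has_derivative_transform_nhds)
      (use eventually_gauge[OF F] in eventually_elim, simp add: gauge_isometry)
qed

text \<open>In the gauge the form is a fixed multilinear map. The connection terms of the Leibniz
  rule add up to a \<open>diamond\<close>, which vanishes by
  \<open>frame_connection_diamond\<close>.\<close>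

lemma form_has_derivative:
  assumes F: "map_differentiable F p" and j: "j \<le> N"
    and s: "\<And>i. i < d j \<Longrightarrow> section_differentiable F (s i) p"
  shows "((\<lambda>q. \<alpha> j (F q) (\<lambda>i. s i q)) has_derivative
     (\<lambda>w. \<Sum>i<d j. \<alpha> j (F p) ((\<lambda>l. s l p)(i := levi_civita A g F (s i) p w)))) (at p)"
proof -
  note alt = alternating[OF j, of "F p"]
  have "((\<lambda>q. \<alpha> j (F p) (\<lambda>i. gauge (F p) (F q) (s i q))) has_derivative
     (\<lambda>w. \<Sum>i<d j. \<alpha> j (F p) ((\<lambda>l. s l p)(i := levi_civita A g F (s i) p w)))) (at p)"
  proof (rule has_derivative_eq_rhs[OF alternating_form_has_derivative[OF alt levi_civita_gauge[OF
      F s]]])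
    have "(\<Sum>i<d j. \<alpha> j (F p) ((\<lambda>l. s l p)(i := levi_civita A g F (s i) p w
          - frame_connection (F p) (differential A F p w) (s i p))))
       = (\<Sum>i<d j. \<alpha> j (F p) ((\<lambda>l. s l p)(i := levi_civita A g F (s i) p w)))
         - diamond (d j) (frame_connection (F p) (differential A F p w)) (\<alpha> j (F p)) (\<lambda>l. s l p)"
             for w
      unfolding diamond_def sum_subtractf[symmetric]
      by (intro sum.cong refl) (simp add: linear_diff[OF alternating_form_linear[OF alt]])
    then show "(\<lambda>w. \<Sum>i<d j. \<alpha> j (F p) ((\<lambda>i. gauge (F p) (F p) (s i p))(i := levi_civita A g F (s
        i) p w
          - frame_connection (F p) (differential A F p w) (s i p))))
       = (\<lambda>w. \<Sum>i<d j. \<alpha> j (F p) ((\<lambda>l. s l p)(i := levi_civita A g F (s i) p w)))"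
      by (simp only: gauge_self frame_connection_diamond[OF j] diff_zero)
  qed auto
  then show ?thesis
    by (rule has_derivative_transform_nhds)
      (use eventually_gauge[OF F] in eventually_elim, simp add: gauge_forms[OF _ j])
qed

end

section \<open>Calibrated submanifolds\<close>

context orthonormal_frame
begin

lemma proj_unique:
  assumes "subspace W" "w \<in> W" "v - w \<in> perp b W"
  shows "proj b W v = w"
  unfolding proj_def
proof (rule the_equality)
  fix w' assume w': "w' \<in> W \<and> v - w' \<in> perp b W"
  have "w' - w \<in> W" using w' assms by (blast intro: subspace_diff)
  moreover have "w' - w \<in> perp b W"
    using subspace_diff[OF subspace_perp assms(3), of "v - w'"] w' by simp
  ultimately show "w' = w" using eq_0_if_in_perp by fastforce
qed (use assms in auto)

lemma proj:
  assumes "subspace W"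
  shows "proj b W v \<in> W" "v - proj b W v \<in> perp b W"
proof -
  obtain w z where "w \<in> W" "z \<in> perp b W" "v = w + z" by (rule perp_decomp[OF assms])
  then have "w \<in> W" "v - w \<in> perp b W" by simp_all
  with proj_unique[OF assms this] show "proj b W v \<in> W" "v - proj b W v \<in> perp b W" by simp_all
qed

lemma proj_id: "subspace W \<Longrightarrow> v \<in> W \<Longrightarrow> proj b W v = v"
  by (rule proj_unique) (simp_all add: perp_def bb.zero_left)

lemma perp_eqI:
  assumes "v \<in> perp b W" "w \<in> perp b W" "\<And>z. z \<in> perp b W \<Longrightarrow> b v z = b w z"
  shows "v = w"
  using assms(3)[of "v - w"] assms(1,2) subspace_diff[OF subspace_perp, of v W w] b_self_eq_0[of
      "v - w"]
  by (simp add: bb.diff_left)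

end

context G_manifold
begin

lemma levi_civita_cong:
  assumes "\<forall>\<^sub>F q in nhds p. s q = s' q"
  shows "levi_civita A g F s p w = levi_civita A g F s' p w"
proof -
  have "\<forall>\<^sub>F q in nhds p. to_chart A c (F q) (s q) = to_chart A c (F q) (s' q)" for c
    using assms by eventually_elim simp
  from frechet_derivative_cong_nhds[OF this] show ?thesis
    by (simp add: levi_civita_def eventually_nhds_x_imp_x[OF assms])
qed

lemma section_differentiable_cong:
  assumes "\<forall>\<^sub>F q in nhds p. s q = s' q" "section_differentiable F s p"
  shows "section_differentiable F s' p"
  using assms(2) unfolding section_differentiable_def
  by (rule differentiable_transform_nhds) (use assms(1) in eventually_elim, simp)

lemma section_minus:
  assumes F: "map_differentiable F p" and s: "section_differentiable F s p"
      "section_differentiable F s' p"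
  shows "section_differentiable F (\<lambda>q. s q - s' q) p"
    and "levi_civita A g F (\<lambda>q. s q - s' q) p w = levi_civita A g F s p w - levi_civita A g F s' p
        w"
proof -
  define c where "c = chart_at A (F p)"
  have ev: "\<forall>\<^sub>F q in nhds p. to_chart A c (F q) (s q) - to_chart A c (F q) (s' q) = to_chart A c
      (F q) (s q - s' q)"
    using eventually_gauge[OF F] unfolding c_def
    by eventually_elim (simp add: linear_diff[OF linear_to_chart[OF chart_at(1)]])
  have d: "((\<lambda>q. to_chart A c (F q) (s q - s' q)) has_derivative
     (\<lambda>w. frechet_derivative (\<lambda>q. to_chart A c (F q) (s q)) (at p) w
        - frechet_derivative (\<lambda>q. to_chart A c (F q) (s' q)) (at p) w)) (at p)"
    by (rule has_derivative_transform_nhds[OF has_derivative_diff ev])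
      (use s in \<open>auto simp: section_differentiable_def c_def frechet_derivative_works[symmetric]\<close>)
  then show "section_differentiable F (\<lambda>q. s q - s' q) p"
    by (auto simp: section_differentiable_def c_def differentiable_def)
  show "levi_civita A g F (\<lambda>q. s q - s' q) p w = levi_civita A g F s p w - levi_civita A g F s' p w"
    unfolding levi_civita_def Let_def c_def[symmetric] frechet_derivative_at[OF d, symmetric]
    by (simp add: linear_diff[OF christoffel_linear] c_def)
qed

end

section \<open>Coordinate fields along a submanifold\<close>

locale G_submanifold = G_manifold A g N d \<alpha> \<phi> V E + L: oriented_manifold B
  for A :: "('m::{t2_space, second_countable_topology}, 'n::finite) chart set"
    and g N d \<alpha> \<phi> V E
    and B :: "('l::{t2_space, second_countable_topology}, 'k::finite) chart set" +
  fixes \<iota> :: "'l \<Rightarrow> 'm"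
  assumes sub: "submanifold A B \<iota>"
begin

abbreviation "dinc \<equiv> tangent_map A B \<iota>"
abbreviation "TL \<equiv> tangent_space A B \<iota>"
abbreviation "prT \<equiv> proj_T A g B \<iota>"
abbreviation "prN \<equiv> proj_N A g B \<iota>"

lemma isCont_inclusion: "isCont \<iota> y"
  using sub by (auto simp: submanifold_def smooth_map_def continuous_on_eq_continuous_at)

lemma inj_tangent_map: "inj (dinc y)"
  using sub by (simp add: submanifold_def)

lemma inclusion_smooth:
  "c \<in> B \<Longrightarrow> c' \<in> A \<Longrightarrow> smooth_on (cmap c' \<circ> \<iota> \<circ> cinv c) (cmap c ` (cdom c \<inter> \<iota> -` cdom c'))"
  using sub by (auto simp: submanifold_def smooth_map_def)

lemma map_differentiable_inclusion:
  assumes \<kappa>: "L.map_differentiable \<kappa> p"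
  shows "map_differentiable (\<iota> \<circ> \<kappa>) p"
    and "differential A (\<iota> \<circ> \<kappa>) p w = dinc (\<kappa> p) (differential B \<kappa> p w)"
proof -
  define y c c' where "y = \<kappa> p" and "c = chart_at B y" and "c' = chart_at A (\<iota> y)"
  define f where "f = cmap c' \<circ> \<iota> \<circ> cinv c"
  have c: "c \<in> B" "y \<in> cdom c" and c': "c' \<in> A" "\<iota> y \<in> cdom c'"
    by (auto simp: c_def c'_def L.chart_at chart_at)
  have "f differentiable at (cmap c y)"
    unfolding f_def by (rule smooth_on_differentiable[OF inclusion_smooth[OF c(1) c'(1)]]) (use c
        c' in auto)
  then have f: "(f has_derivative frechet_derivative f (at (cmap c y))) (at (cmap c y))"
    by (simp add: frechet_derivative_works[symmetric])
  have \<kappa>': "((cmap c \<circ> \<kappa>) has_derivative differential B \<kappa> p) (at p)"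
    using L.map_has_derivative[OF \<kappa> L.chart_at] by (simp add: c_def y_def)
  have "((f \<circ> (cmap c \<circ> \<kappa>)) has_derivative frechet_derivative f (at (cmap c y)) \<circ> differential B \<kappa>
      p) (at p)"
    by (rule diff_chain_at[OF \<kappa>']) (use f in \<open>simp add: y_def\<close>)
  moreover have "\<forall>\<^sub>F q in nhds p. (f \<circ> (cmap c \<circ> \<kappa>)) q = (cmap c' \<circ> (\<iota> \<circ> \<kappa>)) q"
    using L.map_differentiable_eventually[OF \<kappa> L.open_cdom[OF c(1)]] c(2) unfolding y_def[symmetric]
    by (auto elim!: eventually_mono simp: f_def L.cinv_cmap[OF c(1)])
  ultimately have d: "((cmap c' \<circ> (\<iota> \<circ> \<kappa>)) has_derivative frechet_derivative f (at (cmap c y)) \<circ>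
      differential B \<kappa> p) (at p)"
    by (rule has_derivative_transform_nhds)
  show "map_differentiable (\<iota> \<circ> \<kappa>) p"
    using d \<kappa> isCont_inclusion[of y]
    by (auto simp: map_differentiable_def L.map_differentiable_def y_def c'_def differentiable_def
        intro: continuous_at_compose)
  have "differential A (\<iota> \<circ> \<kappa>) p = frechet_derivative f (at (cmap c y)) \<circ> differential B \<kappa> p"
    using frechet_derivative_at[OF d] by (simp add: differential_def c'_def y_def)
  moreover have "dinc y = frechet_derivative f (at (cmap c y))"
    using c by (simp add: tangent_map_def differential_def L.cinv_cmap c_def[symmetric] c'_def
        f_def o_assoc)
  ultimately show "differential A (\<iota> \<circ> \<kappa>) p w = dinc (\<kappa> p) (differential B \<kappa> p w)"
    by (simp add: y_def)
qed

text \<open>The push-forward to \<open>z\<close> of the field with constant components v in the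
  chart at \<open>y\<close>. It varies smoothly with \<open>z\<close>, whereas \<open>dinc z\<close>
  refers to the preferred chart of \<open>z\<close>, which jumps.\<close>

definition coord_field :: "'l \<Rightarrow> 'l \<Rightarrow> real ^ 'k \<Rightarrow> real ^ 'n" where
  "coord_field y z v = differential A (\<iota> \<circ> cinv (chart_at B y)) (cmap (chart_at B y) z) v"

lemma coord_field_self: "coord_field y y = dinc y"
  by (simp add: coord_field_def tangent_map_def fun_eq_iff)

lemma linear_differential: "map_differentiable F p \<Longrightarrow> linear (differential A F p)"
  using map_has_derivative[OF _ chart_at] has_derivative_linear by fastforce

text \<open>The field factors through \<open>dinc z\<close>. The other factor, the differential of
  the inverse chart, has the differential of the chart as a left inverse, so it is injective and, by
  dimension, bijective.\<close>

lemma coord_field: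
  assumes z: "z \<in> cdom (chart_at B y)"
  shows "linear (coord_field y z)" and "inj (coord_field y z)"
    and "range (coord_field y z) = TL z"
proof -
  define c where "c = chart_at B y"
  have c: "c \<in> B" "cmap c z \<in> crange c" using z by (auto simp: c_def L.chart_at)
  note md = L.map_differentiable_cinv[OF c]
  have eq: "coord_field y z v = dinc z (differential B (cinv c) (cmap c z) v)" for v
    using map_differentiable_inclusion(2)[OF md, of v] z
    by (simp add: coord_field_def c_def[symmetric] L.cinv_cmap[OF c(1)])
  have lin': "linear (differential B (cinv c) (cmap c z))"
    using L.map_has_derivative[OF md L.chart_at] has_derivative_linear by fastforce
  have zc: "cinv c (cmap c z) = z" using z by (simp add: c_def L.cinv_cmap[OF L.chart_at(1)])
  have "((cmap c \<circ> cinv c) has_derivative (\<lambda>w. to_chart B c z (differential B (cinv c) (cmap c z)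
      w))) (at (cmap c z))"
    using L.map_has_derivative[OF md c(1)] z zc by (simp add: c_def)
  moreover have "((cmap c \<circ> cinv c) has_derivative id) (at (cmap c z))"
    by (rule has_derivative_transform_nhds[OF has_derivative_id])
      (use eventually_nhds_in_open[OF L.open_crange[OF c(1)] c(2)] in eventually_elim, simp add:
          L.cmap_cinv[OF c(1)])
  ultimately have "(\<lambda>w. to_chart B c z (differential B (cinv c) (cmap c z) w)) = id"
    by (rule has_derivative_unique)
  then have inj': "inj (differential B (cinv c) (cmap c z))"
    by (metis id_apply injI)
  then have surj': "surj (differential B (cinv c) (cmap c z))"
    by (rule linear_injective_imp_surjective[OF lin']) simp
  show "linear (coord_field y z)"
    unfolding coord_field_def[abs_def] c_def[symmetric]
    by (rule linear_differential[OF map_differentiable_inclusion(1)[OF md]])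
  show "inj (coord_field y z)"
    using inj_compose[OF inj_tangent_map inj'] by (simp add: eq[abs_def] o_def)
  show "range (coord_field y z) = TL z"
  proof -
    have "range (coord_field y z) = dinc z ` range (differential B (cinv c) (cmap c z))"
      by (simp only: eq[abs_def] image_image)
    then show ?thesis by (simp add: surj' tangent_space_def)
  qed
qed

lemma linear_tangent_map: "linear (dinc y)"
  using coord_field(1)[OF L.chart_at(2), of y] by (simp add: coord_field_self)

lemma subspace_tangent_space: "subspace (TL y)"
  unfolding tangent_space_def by (rule linear_subspace_image[OF linear_tangent_map subspace_UNIV])

definition coord_chart :: "'l \<Rightarrow> real ^ 'k \<Rightarrow> real ^ 'k \<Rightarrow> real ^ 'n" where
  "coord_chart y r = frechet_derivative (cmap (chart_at A (\<iota> y)) \<circ> \<iota> \<circ> cinv (chart_at B y)) (at r)"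

text \<open>The second derivative of the inclusion in charts: v is the argument of the first
  derivative, and the remaining argument is the direction of differentiation.\<close>

definition dcoord :: "'l \<Rightarrow> real ^ 'k \<Rightarrow> real ^ 'k \<Rightarrow> real ^ 'n" where
  "dcoord y v = frechet_derivative (\<lambda>r. coord_chart y r v) (at (L.center y))"

lemma to_chart_coord_field:
  assumes "z \<in> cdom (chart_at B y)" "\<iota> z \<in> cdom (chart_at A (\<iota> y))"
  shows "to_chart A (chart_at A (\<iota> y)) (\<iota> z) (coord_field y z v) = coord_chart y (cmap (chart_at B
      y) z) v"
proof -
  have md: "L.map_differentiable (cinv (chart_at B y)) (cmap (chart_at B y) z)"
    using assms(1) by (intro L.map_differentiable_cinv L.chart_at) auto
  have "((cmap (chart_at A (\<iota> y)) \<circ> (\<iota> \<circ> cinv (chart_at B y))) has_derivative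
      (\<lambda>w. to_chart A (chart_at A (\<iota> y)) (\<iota> z) (coord_field y z w))) (at (cmap (chart_at B y) z))"
    using map_has_derivative[OF map_differentiable_inclusion(1)[OF md] chart_at(1)] assms
    by (simp add: coord_field_def L.cinv_cmap[OF L.chart_at(1)])
  from fun_cong[OF frechet_derivative_at[OF this], of v]
  show ?thesis by (simp add: coord_chart_def o_assoc)
qed

lemma coord_domain:
  "L.center y \<in> cmap (chart_at B y) ` (cdom (chart_at B y) \<inter> \<iota> -` cdom (chart_at A (\<iota> y)))"
  using L.chart_at chart_at by auto

lemma coord_chart_has_derivative:
  "((\<lambda>r. coord_chart y r v) has_derivative dcoord y v) (at (L.center y))"
  using smooth_on_differentiable_frechet[OF inclusion_smooth[OF L.chart_at(1) chart_at(1)]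
      coord_domain]
  by (simp add: dcoord_def coord_chart_def frechet_derivative_works[symmetric])

lemma linear_coord_chart:
  "\<forall>\<^sub>F r in nhds (L.center y). linear (coord_chart y r)"
proof -
  note sm = inclusion_smooth[OF L.chart_at(1)[of y] chart_at(1)[of "\<iota> y"]]
  show ?thesis
    using eventually_nhds_in_open[OF smooth_on_open[OF sm] coord_domain]
  proof eventually_elim
    case (elim r)
    from smooth_on_differentiable[OF sm elim] show ?case
      unfolding coord_chart_def by (rule linear_frechet_derivative)
  qed
qed

lemma eventually_coord:
  assumes \<kappa>: "L.map_differentiable \<kappa> p"
  shows "\<forall>\<^sub>F q in nhds p. \<kappa> q \<in> cdom (chart_at B (\<kappa> p)) \<and> \<iota> (\<kappa> q) \<in> cdom (chart_at A (\<iota> (\<kappa> p))) \<and>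
      \<iota> (\<kappa> q) \<in> V (\<iota> (\<kappa> p))"
  using L.map_differentiable_eventually[OF \<kappa> L.open_cdom[OF L.chart_at(1)] L.chart_at(2)]
    eventually_gauge[OF map_differentiable_inclusion(1)[OF \<kappa>]]
  by eventually_elim simp

text \<open>The derivative of the coefficients contributes a tangential term. The other two terms
  involve the coefficients only through their value at \<open>p\<close> and carry the whole normal
  component.\<close>

lemma tangent_section:
  assumes \<kappa>: "L.map_differentiable \<kappa> p" and a: "(a has_derivative a') (at p)"
  shows "section_differentiable (\<iota> \<circ> \<kappa>) (\<lambda>q. coord_field (\<kappa> p) (\<kappa> q) (a q)) p"
    and "levi_civita A g (\<iota> \<circ> \<kappa>) (\<lambda>q. coord_field (\<kappa> p) (\<kappa> q) (a q)) p w =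
      dinc (\<kappa> p) (a' w) + dcoord (\<kappa> p) (a p) (differential B \<kappa> p w)
      + chr (\<iota> (\<kappa> p)) (dinc (\<kappa> p) (differential B \<kappa> p w)) (dinc (\<kappa> p) (a p))"
proof -
  define y c c' where "y = \<kappa> p" and "c = chart_at B y" and "c' = chart_at A (\<iota> y)"
  have \<kappa>': "((cmap c \<circ> \<kappa>) has_derivative differential B \<kappa> p) (at p)"
    using L.map_has_derivative[OF \<kappa> L.chart_at] by (simp add: c_def y_def)
  have H: "((\<lambda>q. coord_chart y (cmap c (\<kappa> q)) v) has_derivative (\<lambda>w. dcoord y v (differential B \<kappa>
      p w))) (at p)" for v
    using diff_chain_at[OF \<kappa>', of "\<lambda>r. coord_chart y r v" "dcoord y v"]
        coord_chart_has_derivative[of y v]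
    by (simp add: o_def c_def y_def)
  have "filterlim (cmap c \<circ> \<kappa>) (nhds ((cmap c \<circ> \<kappa>) p)) (nhds p)"
    using has_derivative_continuous[OF \<kappa>'] unfolding continuous_at tendsto_at_iff_tendsto_nhds .
  then have lin: "\<forall>\<^sub>F q in nhds p. linear (coord_chart y (cmap c (\<kappa> q)))"
    using linear_coord_chart[of y] unfolding filterlim_iff c_def y_def by fastforce
  have Hy: "coord_chart y (cmap c y) v = dinc y v" for v
    using to_chart_coord_field[OF L.chart_at(2) chart_at(2), of y v]
    by (simp add: coord_field_self c_def)
  have d: "((\<lambda>q. coord_chart y (cmap c (\<kappa> q)) (a q)) has_derivative
     (\<lambda>w. dinc y (a' w) + dcoord y (a p) (differential B \<kappa> p w))) (at p)"
    using has_derivative_linear_family[OF H lin a] by (simp add: Hy y_def[symmetric])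
  have ev: "\<forall>\<^sub>F q in nhds p. coord_chart y (cmap c (\<kappa> q)) (a q) = to_chart A c' ((\<iota> \<circ> \<kappa>) q)
      (coord_field y (\<kappa> q) (a q))"
    using eventually_coord[OF \<kappa>]
    by eventually_elim (simp add: to_chart_coord_field y_def c_def c'_def)
  note d' = has_derivative_transform_nhds[OF d ev]
  show "section_differentiable (\<iota> \<circ> \<kappa>) (\<lambda>q. coord_field (\<kappa> p) (\<kappa> q) (a q)) p"
    using d' unfolding section_differentiable_def differentiable_def c'_def y_def by auto
  show "levi_civita A g (\<iota> \<circ> \<kappa>) (\<lambda>q. coord_field (\<kappa> p) (\<kappa> q) (a q)) p w =
      dinc (\<kappa> p) (a' w) + dcoord (\<kappa> p) (a p) (differential B \<kappa> p w)
      + chr (\<iota> (\<kappa> p)) (dinc (\<kappa> p) (differential B \<kappa> p w)) (dinc (\<kappa> p) (a p))"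
    using fun_cong[OF frechet_derivative_at[OF d'], of w]
    by (simp add: levi_civita_def Let_def c'_def y_def coord_field_self
        map_differentiable_inclusion(2)[OF \<kappa>])
qed

text \<open>The covariant derivative at \<open>y\<close>, in the direction u, of the coordinate
  field with components v.\<close>

definition coord_derivative :: "'l \<Rightarrow> real ^ 'k \<Rightarrow> real ^ 'k \<Rightarrow> real ^ 'n" where
  "coord_derivative y u v = dcoord y v u + chr (\<iota> y) (dinc y u) (dinc y v)"

lemma coord_derivative_eq:
  "levi_civita A g (\<iota> \<circ> cinv (chart_at B y)) (\<lambda>q. differential A (\<iota> \<circ> cinv (chart_at B y)) q v)
     (L.center y) u = coord_derivative y u v"
proof -
  define c p where "c = chart_at B y" and "p = cmap c y"
  have c: "c \<in> B" "p \<in> crange c" "cinv c p = y"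
    using L.chart_at[of y] by (auto simp: c_def p_def L.cinv_cmap)
  have md: "L.map_differentiable (cinv c) p" by (rule L.map_differentiable_cinv[OF c(1,2)])
  have "\<forall>\<^sub>F q in nhds p. differential A (\<iota> \<circ> cinv c) q v = coord_field y (cinv c q) v"
    using eventually_nhds_in_open[OF L.open_crange[OF c(1)] c(2)]
    by eventually_elim (simp add: coord_field_def c_def[symmetric] L.cmap_cinv[OF c(1)])
  from levi_civita_cong[OF this, of "\<iota> \<circ> cinv c" u]
  show ?thesis
    using tangent_section(2)[OF md has_derivative_const[of v], of u] c(3) L.differential_cinv[of y
        u]
    by (simp add: linear_0[OF linear_tangent_map] coord_derivative_def c_def[symmetric]
        p_def[symmetric])
qed

lemma second_fundamental_form_eq:
  "second_fundamental_form A g B \<iota> y u v = prN y (coord_derivative y u v)"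
  by (simp add: second_fundamental_form_def Let_def coord_derivative_eq)

end

section \<open>The second fundamental form at calibrated tangent planes\<close>

locale parallel_compliant_submanifold = G_submanifold A g N d \<alpha> \<phi> V E B \<iota>
  for A :: "('m::{t2_space, second_countable_topology}, 'n::finite) chart set"
    and g N d \<alpha> \<phi> V E
    and B :: "('l::{t2_space, second_countable_topology}, 'k::finite) chart set" and \<iota> +
  assumes calibrated: "calibrated_submanifold A g B \<iota> (\<alpha> 0)"
    and compl: "compliant TYPE('k) g N \<alpha>"
    and transitive: "transitive_on_calibrated TYPE('k) g N \<alpha>"
begin

lemma tangent_space_span: "TL y = span (range (\<lambda>i. dinc y (axis i 1)))"
proof -
  have "range (dinc y) = dinc y ` span (range (\<lambda>i. axis i 1))"
  proof -
    have "(Basis :: (real ^ 'k) set) = range (\<lambda>i. axis i 1)" by (auto simp: Basis_vec_def)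
    then have "span (range (\<lambda>i. axis i 1) :: (real ^ 'k) set) = UNIV" by (metis span_Basis)
    then show ?thesis by simp
  qed
  also have "\<dots> = span (dinc y ` range (\<lambda>i. axis i 1))"
    by (rule linear_span_image[OF linear_tangent_map, symmetric])
  finally show ?thesis by (simp add: tangent_space_def image_image)
qed

text \<open>The gauge respects the metric and \<open>\<alpha> 0\<close>, hence calibrated bases. It
  brings the moving tangent planes into one vector space, where transitivity of the group
  applies.\<close>

lemma gauge_tangent_space_calibrated:
  assumes "\<iota> z \<in> V x"
  shows "gauge x (\<iota> z) ` TL z \<in> calibrated_planes TYPE('k) (g x) (\<alpha> 0 x)"
proof -
  define X where "X i = dinc z (axis i 1)" for i :: 'k
  have X: "calibrated (g (\<iota> z)) (\<alpha> 0 (\<iota> z)) X"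
    using calibrated by (simp add: calibrated_submanifold_def X_def[abs_def])
  have lin: "linear (gauge x (\<iota> z))" and inj: "inj (gauge x (\<iota> z))"
    using linear_gauge gauge_bij assms by (auto simp: bij_def)
  have "calibrated (g x) (\<alpha> 0 x) (\<lambda>i. gauge x (\<iota> z) (X i))"
    unfolding calibrated_def
  proof
    have X': "independent (range X)" "inj X" using X by (auto simp: calibrated_def plane_basis_def)
    have "independent (gauge x (\<iota> z) ` range X)"
      by (rule linear_independent_injective_image[OF lin X'(1) inj_on_subset[OF inj subset_UNIV]])
    with X'(2) show "plane_basis (\<lambda>i. gauge x (\<iota> z) (X i))"
      using inj_compose[OF inj] by (simp add: plane_basis_def o_def image_image)
    show "eval_basis (\<alpha> 0 x) (\<lambda>i. gauge x (\<iota> z) (X i)) = gram_vol (g x) (\<lambda>i. gauge x (\<iota> z) (X i))"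
      using X gauge_forms[OF assms le0, of "\<lambda>i. X (coord_enum i)"]
      by (simp add: calibrated_def eval_basis_def gram_vol_def gauge_isometry[OF assms])
  qed
  moreover have "gauge x (\<iota> z) ` TL z = span (range (\<lambda>i. gauge x (\<iota> z) (X i)))"
    unfolding tangent_space_span X_def[symmetric] linear_span_image[OF lin, symmetric] by (simp
        add: image_image)
  ultimately show ?thesis by (auto simp: calibrated_planes_def)
qed

text \<open>The tangent planes along a line in a chart, transported to the base point by the frame and
  corrected by the one-parameter group of its connection form, form a curve in the orbit of
  the tangent plane whose velocity is the covariant derivative.\<close>

lemma second_fundamental_form_in_lie_algebra:
  obtains M where "M \<in> infinitesimal_stabilizer (g (\<iota> y)) N d (\<lambda>j. \<alpha> j (\<iota> y))"
    "M \<in> mixed_part (g (\<iota> y)) (TL y)"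
    "\<And>v z. z \<in> perp (g (\<iota> y)) (TL y) \<Longrightarrow>
       g (\<iota> y) (M (dinc y v)) z = g (\<iota> y) (coord_derivative y u v) z"
proof -
  define x W c p where "x = \<iota> y" and "W = TL y" and "c = chart_at B y" and "p = cmap c y"
  define \<kappa> where "\<kappa> t = cinv c (p + t *\<^sub>R u)" for t :: real
  have c: "c \<in> B" "p \<in> crange c" "cinv c p = y"
    using L.chart_at[of y] by (auto simp: c_def p_def L.cinv_cmap)
  have \<kappa>0: "\<kappa> 0 = y" by (simp add: \<kappa>_def c)
  have cont: "isCont \<kappa> 0"
    unfolding \<kappa>_def by (intro isCont_o2[OF _ L.isCont_cinv[OF c(1)]] continuous_intros) (simp add:
        c)
  have line: "((\<lambda>t. p + t *\<^sub>R u) has_derivative (\<lambda>t. t *\<^sub>R u)) (at 0)"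
    by (auto intro!: derivative_eq_intros)
  have "isCont (\<lambda>t. p + t *\<^sub>R u) 0" by (intro continuous_intros)
  then have "\<forall>\<^sub>F t in nhds 0. p + t *\<^sub>R u \<in> crange c"
    by (rule eventually_nhds_isCont) (use L.open_crange[OF c(1)] c in auto)
  then have ev: "\<forall>\<^sub>F t in nhds 0. p + t *\<^sub>R u = (cmap c \<circ> \<kappa>) t"
    by eventually_elim (simp add: \<kappa>_def L.cmap_cinv[OF c(1)])
  note d\<kappa> = has_derivative_transform_nhds[OF line ev]
  have \<kappa>: "L.map_differentiable \<kappa> 0"
    unfolding L.map_differentiable_def \<kappa>0 c_def[symmetric] using cont d\<kappa> differentiable_def by blast
  have diff\<kappa>: "differential B \<kappa> 0 1 = u"
    using frechet_derivative_at[OF d\<kappa>] by (metis differential_def \<kappa>0 c_def scaleR_one)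
  note \<iota>\<kappa> = map_differentiable_inclusion(1)[OF \<kappa>]
  have x_eq: "(\<iota> \<circ> \<kappa>) 0 = x" by (simp add: \<kappa>0 x_def)
  \<comment> \<open>In the gauge, the velocity of a field is its covariant derivative minus this
    endomorphism. Acting with the one-parameter group of \<open>\<Theta>\<close> adds the missing
    term, and since the group lies in the stabilizer it does not leave the orbit.\<close>
  define \<Theta> where "\<Theta> = frame_connection x (differential A (\<iota> \<circ> \<kappa>) 0 1)"
  have \<Theta>: "\<Theta> \<in> infinitesimal_stabilizer (g x) N d (\<lambda>j. \<alpha> j x)"
    unfolding \<Theta>_def by (rule frame_connection_in_stabilizer)
  then have lin\<Theta>: "linear \<Theta>" by (simp add: infinitesimal_stabilizer_def)
  define e where "e t = op_exp (\<lambda>v. t *\<^sub>R \<Theta> v)" for t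
  have eS: "e t \<in> stabilizer (g x) N (\<lambda>j. \<alpha> j x)" for t
    unfolding e_def by (rule pt.op_exp_in_stabilizer[OF alternating \<Theta>])
  have e0: "e 0 v = v" for v unfolding e_def by (rule op_exp_0)
  have de: "((\<lambda>t. e t v) has_derivative (\<lambda>s. s *\<^sub>R \<Theta> (e 0 v))) (at 0)" for v
    unfolding e_def by (rule op_exp_has_derivative[OF lin\<Theta>])
  have lin_e: "\<forall>\<^sub>F t in nhds 0. linear (e t)"
    unfolding e_def by (intro always_eventually allI linear_op_exp linear_scaleR_comp lin\<Theta>)
  define T where "T t v = e t (gauge x (\<iota> (\<kappa> t)) (coord_field y (\<kappa> t) v))" for t v
  have T0: "T 0 v = dinc y v" for v
    by (simp add: T_def e0 \<kappa>0 coord_field_self x_def)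
  have der: "((\<lambda>t. T t v) has_vector_derivative coord_derivative y u v) (at 0)" for v
  proof -
    have s: "section_differentiable (\<iota> \<circ> \<kappa>) (\<lambda>t. coord_field y (\<kappa> t) v) 0"
      and lc: "levi_civita A g (\<iota> \<circ> \<kappa>) (\<lambda>t. coord_field y (\<kappa> t) v) 0 1 = coord_derivative y u v"
      using tangent_section[OF \<kappa> has_derivative_const[of v]]
      by (simp_all add: \<kappa>0 diff\<kappa> coord_derivative_def linear_0[OF linear_tangent_map])
    define \<sigma> where "\<sigma> t = gauge x (\<iota> (\<kappa> t)) (coord_field y (\<kappa> t) v)" for t
    have "(\<sigma> has_derivative (\<lambda>w. levi_civita A g (\<iota> \<circ> \<kappa>) (\<lambda>t. coord_field y (\<kappa> t) v) 0 w
        - frame_connection x (differential A (\<iota> \<circ> \<kappa>) 0 w) (\<sigma> 0))) (at 0)"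
      using levi_civita_gauge[OF \<iota>\<kappa> s] by (simp add: \<sigma>_def[abs_def] x_eq \<kappa>0 x_def)
    from has_derivative_linear_family[of e "\<lambda>v s. s *\<^sub>R \<Theta> (e 0 v)", OF de lin_e this]
    have "((\<lambda>t. e t (\<sigma> t)) has_derivative (\<lambda>w. e 0 (levi_civita A g (\<iota> \<circ> \<kappa>) (\<lambda>t. coord_field y (\<kappa>
        t) v) 0 w
        - frame_connection x (differential A (\<iota> \<circ> \<kappa>) 0 w) (\<sigma> 0)) + w *\<^sub>R \<Theta> (e 0 (\<sigma> 0)))) (at 0)" .
    then have d: "((\<lambda>t. T t v) has_derivative (\<lambda>w. levi_civita A g (\<iota> \<circ> \<kappa>) (\<lambda>t. coord_field y (\<kappa>
        t) v) 0 w
        - frame_connection x (differential A (\<iota> \<circ> \<kappa>) 0 w) (\<sigma> 0) + w *\<^sub>R \<Theta> (\<sigma> 0))) (at 0)" (is "(_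
            has_derivative ?D) _")
      by (simp add: T_def \<sigma>_def e0)
    have "?D w = w *\<^sub>R ?D 1" for w
      using linear_scale[OF has_derivative_linear[OF d], of w 1] by simp
    moreover have "?D 1 = coord_derivative y u v" by (simp add: lc \<Theta>_def)
    ultimately have "?D = (\<lambda>w. w *\<^sub>R coord_derivative y u v)" by (metis (no_types))
    then show ?thesis using d by (simp add: has_vector_derivative_def)
  qed
  have W_eq: "W = span (range (T 0))"
    using span_eq_iff[THEN iffD2, OF subspace_tangent_space[of y], symmetric]
    unfolding W_def T0[abs_def] tangent_space_def .
  have Wcal: "W \<in> calibrated_planes TYPE('k) (g x) (\<alpha> 0 x)"
    using gauge_tangent_space_calibrated[of y x] in_V by (simp add: x_def W_def image_def)
  have orbit: "\<forall>\<^sub>F t in at_right 0. \<exists>P\<in>stabilizer (g x) N (\<lambda>j. \<alpha> j x). P ` W = span (range (T t))"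
  proof -
    have "\<forall>\<^sub>F t in nhds 0. \<exists>P\<in>stabilizer (g x) N (\<lambda>j. \<alpha> j x). P ` W = span (range (T t))"
      using eventually_coord[OF \<kappa>] unfolding \<kappa>0 x_def[symmetric]
    proof eventually_elim
      case (elim t)
      then have "gauge x (\<iota> (\<kappa> t)) ` TL (\<kappa> t) \<in> calibrated_planes TYPE('k) (g x) (\<alpha> 0 x)"
        by (intro gauge_tangent_space_calibrated) auto
      then obtain P where P: "P \<in> stabilizer (g x) N (\<lambda>j. \<alpha> j x)"
          "P ` W = gauge x (\<iota> (\<kappa> t)) ` TL (\<kappa> t)"
        using transitive Wcal unfolding transitive_on_calibrated_def by blast
      have "T t = e t \<circ> (gauge x (\<iota> (\<kappa> t)) \<circ> coord_field y (\<kappa> t))"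
        by (simp add: T_def fun_eq_iff)
      then have range: "(e t \<circ> P) ` W = range (T t)"
        using P(2) coord_field(3)[of "\<kappa> t" y] elim by (simp only: image_comp[symmetric])
      have "subspace W" "linear P" "linear (e t)"
        using P(1) eS[of t] subspace_tangent_space by (auto simp: W_def stabilizer_def SO_def)
      then have "subspace ((e t \<circ> P) ` W)" by (intro linear_subspace_image linear_compose)
      then have "(e t \<circ> P) ` W = span (range (T t))" using range span_eq_iff by metis
      then show ?case using pt.stabilizer_compose[OF eS P(1)] by blast
    qed
    then show ?thesis by (simp add: eventually_nhds_conv_at eventually_at_split)
  qed
  have cmp: "{S \<in> lie_algebra (stabilizer (g x) N (\<lambda>j. \<alpha> j x)).
        \<forall>T\<in>lie_algebra (plane_stabilizer (g x) N (\<lambda>j. \<alpha> j x) W). so_inner S T = 0} \<subseteq> mixed_part (g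
            x) W"
    using compl Wcal unfolding compliant_def by blast
  \<comment> \<open>The family of spanning vectors is indexed by all of \<open>real ^ 'k\<close>, so
    one \<open>M\<close> serves every tangent vector v.\<close>
  obtain M where M: "M \<in> infinitesimal_stabilizer (g x) N d (\<lambda>j. \<alpha> j x)" "M \<in> mixed_part (g x) W"
      "\<And>v z. z \<in> perp (g x) W \<Longrightarrow> g x (M (T 0 v)) z = g x (coord_derivative y u v) z"
    using pt.orbit_tangent[OF alternating W_eq cmp der orbit] by blast
  show ?thesis
    by (rule that[of M]) (use M in \<open>simp_all add: x_def W_def T0\<close>)
qed

text \<open>The block of a mixed M from the tangent plane to its complement is the second
  fundamental form by assumption; skewness forces the other block to be the negative adjoint. These
  are the two blocks of B_u.\<close>

lemma B_op_eq:
  assumes M: "M \<in> mixed_part (g (\<iota> y)) (TL y)"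
    and A_M: "\<And>v z. z \<in> perp (g (\<iota> y)) (TL y) \<Longrightarrow>
       g (\<iota> y) (M (dinc y v)) z = g (\<iota> y) (coord_derivative y u v) z"
  shows "B_op A g B \<iota> y u = M"
proof
  fix X
  define x W where "x = \<iota> y" and "W = TL y"
  have subW: "subspace W" unfolding W_def by (rule subspace_tangent_space)
  have lin: "linear M" and skew: "\<And>v w. g x (M v) w = - g x v (M w)"
    and MW: "\<And>w. w \<in> W \<Longrightarrow> M w \<in> perp (g x) W" and MP: "\<And>z. z \<in> perp (g x) W \<Longrightarrow> M z \<in> W"
    using M by (auto simp: mixed_part_def x_def W_def)
  have tW: "dinc y v \<in> W" for v by (simp add: W_def tangent_space_def)
  have N: "prN y v \<in> perp (g x) W" for v
    using pt.proj(2)[OF subW] by (simp add: proj_N_def proj_T_def x_def W_def)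
  have sff: "second_fundamental_form A g B \<iota> y u v = M (dinc y v)" for v
  proof (rule pt.perp_eqI)
    show "second_fundamental_form A g B \<iota> y u v \<in> perp (g x) W"
      unfolding second_fundamental_form_eq by (rule N)
    show "M (dinc y v) \<in> perp (g x) W" by (rule MW[OF tW])
    fix z assume z: "z \<in> perp (g x) W"
    have "g x (prT y (coord_derivative y u v)) z = 0"
      using perpD[OF z pt.proj(1)[OF subW, of x]] by (simp add: proj_T_def x_def W_def pt.b_commute)
    then show "g x (second_fundamental_form A g B \<iota> y u v) z = g x (M (dinc y v)) z"
      using A_M[of z v] z
      by (simp add: second_fundamental_form_eq proj_N_def pt.bb.diff_left x_def W_def)
  qed
  have shape: "shape_adjoint A g B \<iota> y u \<xi> = - M \<xi>" if \<xi>: "\<xi> \<in> perp (g x) W" for \<xi>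
    unfolding shape_adjoint_def
  proof (rule the_equality)
    show "- M \<xi> \<in> TL y \<and> (\<forall>v. g (\<iota> y) (- M \<xi>) (dinc y v) = g (\<iota> y) \<xi> (second_fundamental_form A g
        B \<iota> y u v))"
      using MP[OF \<xi>] subspace_neg[OF subW] skew
      by (simp add: sff W_def x_def pt.bb.minus_left)
    fix \<tau> assume \<tau>: "\<tau> \<in> TL y \<and> (\<forall>v. g (\<iota> y) \<tau> (dinc y v) = g (\<iota> y) \<xi> (second_fundamental_form A g
        B \<iota> y u v))"
    \<comment> \<open>Uniqueness of the adjoint: this sum is tangential and orthogonal to every
      tangent vector, hence zero.\<close>
    have "\<tau> + M \<xi> \<in> W" using \<tau> MP[OF \<xi>] subW by (simp add: W_def subspace_add)
    moreover have "\<tau> + M \<xi> \<in> perp (g x) W"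
      using \<tau> skew by (auto simp: perp_def W_def tangent_space_def sff x_def pt.bb.add_left)
    ultimately have "\<tau> + M \<xi> = 0" by (rule pt.eq_0_if_in_perp)
    then show "\<tau> = - M \<xi>" by (simp add: eq_neg_iff_add_eq_0)
  qed
  have "prT y X \<in> W"
    using pt.proj(1)[OF subW] by (simp add: proj_T_def W_def)
  then have "dinc y (inv (dinc y) (prT y X)) = prT y X"
    unfolding W_def tangent_space_def by (rule f_inv_into_f)
  then show "B_op A g B \<iota> y u X = M X"
    using linear_add[OF lin, of "prN y X" "prT y X"]
    unfolding B_op_def sff shape[OF N] by (simp add: proj_N_def)
qed

lemma B_op:
  shows "B_op A g B \<iota> y u \<in> infinitesimal_stabilizer (g (\<iota> y)) N d (\<lambda>j. \<alpha> j (\<iota> y))"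
    and "B_op A g B \<iota> y u \<in> mixed_part (g (\<iota> y)) (TL y)"
    and "z \<in> perp (g (\<iota> y)) (TL y) \<Longrightarrow>
       g (\<iota> y) (B_op A g B \<iota> y u (dinc y v)) z = g (\<iota> y) (coord_derivative y u v) z"
  using second_fundamental_form_in_lie_algebra[of y u thesis for thesis] B_op_eq
  by (metis (no_types, lifting))+

end

section \<open>Differentiability of tangential and normal parts\<close>

context G_submanifold
begin

lemma perp_tangent_space_iff:
  "z \<in> perp (g (\<iota> y)) (TL y) \<longleftrightarrow> (\<forall>v. g (\<iota> y) z (dinc y v) = 0)"
  by (auto simp: perp_def tangent_space_def)

lemma proj_T: "prT y v \<in> TL y"
  and proj_N: "prN y v \<in> perp (g (\<iota> y)) (TL y)"
  using pt.proj[OF subspace_tangent_space] by (simp_all add: proj_T_def proj_N_def)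

lemma proj_T_add_N: "prT y v + prN y v = v"
  by (simp add: proj_N_def)

lemma inner_proj_N:
  assumes "z \<in> perp (g (\<iota> y)) (TL y)"
  shows "g (\<iota> y) (prN y v) z = g (\<iota> y) v z"
  using perpD[OF assms proj_T, of v] pt.b_commute[of "\<iota> y" z "prT y v"]
  by (simp add: proj_N_def pt.bb.diff_left)

lemma inner_proj_T:
  assumes "w \<in> TL y"
  shows "g (\<iota> y) (prT y v) w = g (\<iota> y) v w"
  using perpD[OF proj_N assms, of v] by (simp add: proj_N_def pt.bb.diff_left)

text \<open>The coefficients of the tangential part of a section solve the linear system given by the
  Gram matrix of the coordinate fields.\<close>

definition coord_gram :: "'l \<Rightarrow> 'l \<Rightarrow> real ^ 'k ^ 'k" where
  "coord_gram y z = (\<chi> i j. g (\<iota> z) (coord_field y z (axis i 1)) (coord_field y z (axis j 1)))"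

definition coord_coeff :: "'l \<Rightarrow> 'l \<Rightarrow> real ^ 'n \<Rightarrow> real ^ 'k" where
  "coord_coeff y z v = inv (coord_field y z) (prT z v)"

lemma coord_coeff:
  assumes "z \<in> cdom (chart_at B y)"
  shows "coord_field y z (coord_coeff y z v) = prT z v"
  unfolding coord_coeff_def
  by (rule f_inv_into_f) (simp add: coord_field(3)[OF assms] proj_T)

lemma coord_gram_mult:
  assumes z: "z \<in> cdom (chart_at B y)"
  shows "(coord_gram y z *v a) $ i = g (\<iota> z) (coord_field y z (axis i 1)) (coord_field y z a)"
proof -
  have "coord_field y z a = (\<Sum>j\<in>UNIV. (a $ j) *\<^sub>R coord_field y z (axis j 1))"
    by (rule linear_expand[OF coord_field(1)[OF z]])
  then show ?thesis
    by (simp add: coord_gram_def matrix_vector_mult_def pt.bb.sum_right pt.bb.scaleR_right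
        mult.commute)
qed

lemma coord_gram_coeff:
  assumes z: "z \<in> cdom (chart_at B y)"
  shows "coord_gram y z *v coord_coeff y z v = (\<chi> i. g (\<iota> z) (coord_field y z (axis i 1)) v)"
proof -
  have "coord_field y z (axis i 1) \<in> TL z" for i
    using coord_field(3)[OF z] by auto
  then show ?thesis
    by (simp add: vec_eq_iff coord_gram_mult[OF z] coord_coeff[OF z] pt.b_commute inner_proj_T)
qed

text \<open>A kernel vector of the Gram matrix gives a tangent vector of length zero, and the
  coordinate fields are independent.\<close>

lemma det_coord_gram:
  assumes z: "z \<in> cdom (chart_at B y)"
  shows "det (coord_gram y z) \<noteq> 0"
proof -
  have "inj ((*v) (coord_gram y z))"
  proof (rule linear_injective_0[OF matrix_vector_mul_linear, THEN iffD2], intro allI impI)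
    fix a assume "coord_gram y z *v a = 0"
    then have "g (\<iota> z) (coord_field y z (axis i 1)) (coord_field y z a) = 0" for i
      using coord_gram_mult[OF z, of a i] by simp
    moreover have "coord_field y z a = (\<Sum>j\<in>UNIV. (a $ j) *\<^sub>R coord_field y z (axis j 1))"
      by (rule linear_expand[OF coord_field(1)[OF z]])
    ultimately have "g (\<iota> z) (coord_field y z a) (coord_field y z a) = 0"
      by (metis (no_types, lifting) pt.bb.sum_left pt.bb.scaleR_left scaleR_zero_right sum.neutral)
    then have "coord_field y z a = coord_field y z 0"
      by (simp add: linear_0[OF coord_field(1)[OF z]])
    then show "a = 0" using coord_field(2)[OF z] by (simp add: inj_eq)
  qed
  then show ?thesis using det_nz_iff_inj[OF matrix_vector_mul_linear[of "coord_gram y z"]] by simp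
qed

lemma proj_T_section:
  assumes \<kappa>: "L.map_differentiable \<kappa> p" and s: "section_differentiable (\<iota> \<circ> \<kappa>) s p"
  shows "(\<lambda>q. coord_coeff (\<kappa> p) (\<kappa> q) (s q)) differentiable at p"
    and "\<forall>\<^sub>F q in nhds p. coord_field (\<kappa> p) (\<kappa> q) (coord_coeff (\<kappa> p) (\<kappa> q) (s q)) = prT (\<kappa> q) (s q)"
proof -
  note \<iota>\<kappa> = map_differentiable_inclusion(1)[OF \<kappa>]
  note cs = tangent_section(1)[OF \<kappa> has_derivative_const]
  note ev = L.map_differentiable_eventually[OF \<kappa> L.open_cdom[OF L.chart_at(1)] L.chart_at(2)]
  show "\<forall>\<^sub>F q in nhds p. coord_field (\<kappa> p) (\<kappa> q) (coord_coeff (\<kappa> p) (\<kappa> q) (s q)) = prT (\<kappa> q) (s q)"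
    using ev by eventually_elim (rule coord_coeff)
  show "(\<lambda>q. coord_coeff (\<kappa> p) (\<kappa> q) (s q)) differentiable at p"
  proof (rule differentiable_solve)
    show "(\<lambda>q. coord_gram (\<kappa> p) (\<kappa> q) $ i $ j) differentiable at p" for i j
      using metric_has_derivative[OF \<iota>\<kappa> cs cs] by (auto simp: coord_gram_def differentiable_def)
    show "det (coord_gram (\<kappa> p) (\<kappa> p)) \<noteq> 0" by (rule det_coord_gram[OF L.chart_at(2)])
    show "(\<lambda>q. \<chi> i. g (\<iota> (\<kappa> q)) (coord_field (\<kappa> p) (\<kappa> q) (axis i 1)) (s q)) differentiable at p"
      using metric_has_derivative[OF \<iota>\<kappa> cs s]
      by (intro differentiable_vec_lambda) (auto simp: differentiable_def)
    show "\<forall>\<^sub>F q in nhds p. coord_gram (\<kappa> p) (\<kappa> q) *v coord_coeff (\<kappa> p) (\<kappa> q) (s q)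
        = (\<chi> i. g (\<iota> (\<kappa> q)) (coord_field (\<kappa> p) (\<kappa> q) (axis i 1)) (s q))"
      using ev by eventually_elim (rule coord_gram_coeff)
  qed
qed

text \<open>The tangential part is a coordinate field with differentiable coefficients, which is the
  case covered by \<open>tangent_section\<close>; the normal part is the difference.\<close>

lemma proj_section_differentiable:
  assumes \<kappa>: "L.map_differentiable \<kappa> p" and s: "section_differentiable (\<iota> \<circ> \<kappa>) s p"
  shows "section_differentiable (\<iota> \<circ> \<kappa>) (\<lambda>q. prT (\<kappa> q) (s q)) p"
    and "section_differentiable (\<iota> \<circ> \<kappa>) (\<lambda>q. prN (\<kappa> q) (s q)) p"
proof -
  obtain a' where "((\<lambda>q. coord_coeff (\<kappa> p) (\<kappa> q) (s q)) has_derivative a') (at p)"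
    using proj_T_section(1)[OF \<kappa> s] by (auto simp: differentiable_def)
  from section_differentiable_cong[OF proj_T_section(2)[OF \<kappa> s] tangent_section(1)[OF \<kappa> this]]
  show T: "section_differentiable (\<iota> \<circ> \<kappa>) (\<lambda>q. prT (\<kappa> q) (s q)) p" .
  show "section_differentiable (\<iota> \<circ> \<kappa>) (\<lambda>q. prN (\<kappa> q) (s q)) p"
    unfolding proj_N_def by (rule section_minus(1)[OF map_differentiable_inclusion(1)[OF \<kappa>] s T])
qed

end

section \<open>The connection preserving the tangent and normal bundles\<close>

context parallel_compliant_submanifold
begin

text \<open>The hat connection discards the normal part of the derivative of the tangential
  component and the tangential part of the derivative of the normal one. Together they amount to B_u
  applied to the section.\<close>

lemma hat_nabla_eq:
  assumes \<kappa>: "L.map_differentiable \<kappa> p" and s: "section_differentiable (\<iota> \<circ> \<kappa>) s p"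
  shows "hat_nabla A g B \<iota> \<kappa> s p w =
    levi_civita A g (\<iota> \<circ> \<kappa>) s p w - B_op A g B \<iota> (\<kappa> p) (differential B \<kappa> p w) (s p)"
proof -
  define y u x W where "y = \<kappa> p" and "u = differential B \<kappa> p w" and "x = \<iota> y" and "W = TL y"
  define M where "M = B_op A g B \<iota> y u"
  define sT sN where "sT q = prT (\<kappa> q) (s q)" and "sN q = prN (\<kappa> q) (s q)" for q
  define a where "a q = coord_coeff y (\<kappa> q) (s q)" for q
  note \<iota>\<kappa> = map_differentiable_inclusion(1)[OF \<kappa>]
  have sT: "section_differentiable (\<iota> \<circ> \<kappa>) sT p" and sN: "section_differentiable (\<iota> \<circ> \<kappa>) sN p"
    using proj_section_differentiable[OF \<kappa> s] by (simp_all add: sT_def[abs_def] sN_def[abs_def])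
  have subW: "subspace W" unfolding W_def by (rule subspace_tangent_space)
  have linM: "linear M" and skew: "\<And>v w. g x (M v) w = - g x v (M w)"
    and MW: "\<And>w. w \<in> W \<Longrightarrow> M w \<in> perp (g x) W" and MP: "\<And>z. z \<in> perp (g x) W \<Longrightarrow> M z \<in> W"
    using B_op(2)[of y u] by (auto simp: mixed_part_def x_def W_def M_def)
  obtain a' where a: "(a has_derivative a') (at p)"
    using proj_T_section(1)[OF \<kappa> s] by (auto simp: differentiable_def a_def[abs_def] y_def)
  have ev: "\<forall>\<^sub>F q in nhds p. coord_field y (\<kappa> q) (a q) = sT q"
    using proj_T_section(2)[OF \<kappa> s] by (simp add: a_def sT_def y_def)
  have sTp: "dinc y (a p) = sT p"
    using eventually_nhds_x_imp_x[OF ev] by (simp add: y_def coord_field_self)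
  have lcT: "levi_civita A g (\<iota> \<circ> \<kappa>) sT p w = dinc y (a' w) + coord_derivative y u (a p)"
    using levi_civita_cong[OF ev, of "\<iota> \<circ> \<kappa>" w] tangent_section(2)[OF \<kappa> a, of w]
    by (simp add: coord_derivative_def y_def u_def add.assoc)
  have tW: "dinc y v \<in> W" for v by (simp add: W_def tangent_space_def)
  \<comment> \<open>Differentiated coefficients stay tangential, so the normal part comes from
    \<open>coord_derivative\<close>, which \<open>B_op\<close> represents.\<close>
  have NT: "prN y (levi_civita A g (\<iota> \<circ> \<kappa>) sT p w) = M (sT p)"
  proof (rule pt.perp_eqI[of _ x W])
    show "prN y (levi_civita A g (\<iota> \<circ> \<kappa>) sT p w) \<in> perp (g x) W"
      unfolding x_def W_def by (rule proj_N)
    show "M (sT p) \<in> perp (g x) W" unfolding sTp[symmetric] by (rule MW[OF tW])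
    fix z assume z: "z \<in> perp (g x) W"
    have "g x (dinc y (a' w)) z = 0" using perpD[OF z tW] by (simp add: pt.b_commute)
    then show "g x (prN y (levi_civita A g (\<iota> \<circ> \<kappa>) sT p w)) z = g x (M (sT p)) z"
      using inner_proj_N[of z y] B_op(3)[of z y u "a p"] z
      by (simp add: lcT pt.bb.add_left x_def W_def M_def sTp)
  qed
  \<comment> \<open>Normal sections are orthogonal to the coordinate fields. Differentiating this
    identity expresses the tangential part through \<open>coord_derivative\<close>, and skewness
    turns the result into \<open>M (sN p)\<close>.\<close>
  have TN: "prT y (levi_civita A g (\<iota> \<circ> \<kappa>) sN p w) = M (sN p)"
  proof -
    have sNp: "sN p \<in> perp (g x) W" using proj_N[of "\<kappa> p" "s p"] by (simp add: sN_def x_def W_def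
        y_def)
    have "g x (levi_civita A g (\<iota> \<circ> \<kappa>) sN p w) (dinc y v) = g x (M (sN p)) (dinc y v)" for v
    proof -
      have sv: "section_differentiable (\<iota> \<circ> \<kappa>) (\<lambda>q. coord_field y (\<kappa> q) v) p"
        and lcv: "levi_civita A g (\<iota> \<circ> \<kappa>) (\<lambda>q. coord_field y (\<kappa> q) v) p w = coord_derivative y u v"
        using tangent_section[OF \<kappa> has_derivative_const[of v]]
        by (simp_all add: coord_derivative_def y_def u_def linear_0[OF linear_tangent_map])
      have "\<forall>\<^sub>F q in nhds p. 0 = g ((\<iota> \<circ> \<kappa>) q) (sN q) (coord_field y (\<kappa> q) v)"
        using eventually_coord[OF \<kappa>]
      proof eventually_elim
        case (elim q)
        then have "coord_field y (\<kappa> q) v \<in> TL (\<kappa> q)"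
          using coord_field(3)[of "\<kappa> q" y] by (auto simp: y_def)
        then show ?case using perpD[OF proj_N, of _ "\<kappa> q" "s q"] by (simp add: sN_def)
      qed
      from fun_cong[OF has_derivative_unique[OF has_derivative_transform_nhds[OF
          has_derivative_const this]
          metric_has_derivative[OF \<iota>\<kappa> sN sv]], of w]
      have "g x (levi_civita A g (\<iota> \<circ> \<kappa>) sN p w) (dinc y v) + g x (sN p) (coord_derivative y u v)
          = 0"
        by (simp add: coord_field_self y_def x_def lcv[unfolded y_def])
      moreover have "g x (sN p) (coord_derivative y u v) = g x (sN p) (M (dinc y v))"
        using B_op(3)[of "sN p" y u v] sNp by (simp add: x_def W_def M_def pt.b_commute)
      ultimately show ?thesis using skew by simp
    qed
    then have "levi_civita A g (\<iota> \<circ> \<kappa>) sN p w - M (sN p) \<in> perp (g x) W"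
      by (simp add: perp_tangent_space_iff x_def W_def pt.bb.diff_left)
    then show ?thesis
      unfolding proj_T_def x_def[symmetric] W_def[symmetric] by (intro pt.proj_unique subW MP sNp)
  qed
  have "levi_civita A g (\<iota> \<circ> \<kappa>) (\<lambda>q. s q - sT q) p w = levi_civita A g (\<iota> \<circ> \<kappa>) s p w - levi_civita
      A g (\<iota> \<circ> \<kappa>) sT p w"
    by (rule section_minus(2)[OF \<iota>\<kappa> s sT])
  then have sum: "levi_civita A g (\<iota> \<circ> \<kappa>) s p w = levi_civita A g (\<iota> \<circ> \<kappa>) sT p w + levi_civita A g
      (\<iota> \<circ> \<kappa>) sN p w"
    by (simp add: sN_def[abs_def] sT_def proj_N_def)
  have sp: "s p = sT p + sN p" by (simp add: sT_def sN_def proj_T_add_N)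
  have "hat_nabla A g B \<iota> \<kappa> s p w = prT y (levi_civita A g (\<iota> \<circ> \<kappa>) sT p w)
      + prN y (levi_civita A g (\<iota> \<circ> \<kappa>) sN p w)"
    by (simp add: hat_nabla_def y_def sT_def[abs_def] sN_def[abs_def])
  also have "\<dots> = (levi_civita A g (\<iota> \<circ> \<kappa>) sT p w - M (sT p)) + (levi_civita A g (\<iota> \<circ> \<kappa>) sN p w - M
      (sN p))"
    using proj_T_add_N[of y "levi_civita A g (\<iota> \<circ> \<kappa>) sT p w", unfolded NT]
      proj_T_add_N[of y "levi_civita A g (\<iota> \<circ> \<kappa>) sN p w", unfolded TN]
    by (metis add.commute add_diff_cancel_right')
  finally show ?thesis by (simp add: sum sp linear_add[OF linM[unfolded M_def y_def u_def]] M_def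
      y_def u_def)
qed

lemma diamond_B_op:
  assumes "j \<le> N"
  shows "diamond (d j) (B_op A g B \<iota> y u) (\<alpha> j (\<iota> y)) X = 0"
  using B_op(1)[of y u] assms by (auto simp: infinitesimal_stabilizer_def)

lemma B_op_in_lie_algebra:
  "B_op A g B \<iota> y u \<in> lie_algebra (stabilizer (g (\<iota> y)) N (\<lambda>j. \<alpha> j (\<iota> y)))"
  using B_op(1) pt.lie_algebra_stabilizer[of N d "\<lambda>j. \<alpha> j (\<iota> y)" "\<iota> y", OF alternating] by blast

text \<open>Passing from the Levi-Civita to the hat connection changes the Leibniz sum by
  \<open>diamond\<close> of B_u, which is zero.\<close>

lemma form_hat_derivative:
  assumes \<kappa>: "L.map_differentiable \<kappa> p" and j: "j \<le> N"
    and s: "\<And>i. i < d j \<Longrightarrow> section_differentiable (\<iota> \<circ> \<kappa>) (s i) p"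
  shows "((\<lambda>q. \<alpha> j (\<iota> (\<kappa> q)) (\<lambda>i. s i q)) has_derivative
     (\<lambda>w. \<Sum>i<d j. \<alpha> j (\<iota> (\<kappa> p)) ((\<lambda>l. s l p)(i := hat_nabla A g B \<iota> \<kappa> (s i) p w)))) (at p)"
proof -
  note alt = alternating[OF j, of "\<iota> (\<kappa> p)"]
  have "(\<Sum>i<d j. \<alpha> j (\<iota> (\<kappa> p)) ((\<lambda>l. s l p)(i := hat_nabla A g B \<iota> \<kappa> (s i) p w)))
    = (\<Sum>i<d j. \<alpha> j (\<iota> (\<kappa> p)) ((\<lambda>l. s l p)(i := levi_civita A g (\<iota> \<circ> \<kappa>) (s i) p w)))
      - diamond (d j) (B_op A g B \<iota> (\<kappa> p) (differential B \<kappa> p w)) (\<alpha> j (\<iota> (\<kappa> p))) (\<lambda>l. s l p)" for w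
    unfolding diamond_def sum_subtractf[symmetric]
    by (intro sum.cong refl) (simp add: hat_nabla_eq[OF \<kappa> s] linear_diff[OF
        alternating_form_linear[OF alt]])
  then show ?thesis
    using form_has_derivative[OF map_differentiable_inclusion(1)[OF \<kappa>] j, of s] s
    by (simp add: diamond_B_op[OF j])
qed

lemma hat_parallel:
  assumes j: "j \<le> N"
  shows "hat_parallel_form A g B \<iota> (d j) (\<lambda>y. \<alpha> j (\<iota> y))"
  unfolding hat_parallel_form_def
proof (intro allI impI)
  fix U :: "'l set" and X :: "nat \<Rightarrow> 'l \<Rightarrow> real ^ 'n" and y u
  assume U: "open U" "y \<in> U" and X: "\<forall>i<d j. smooth_section B A \<iota> U (X i)"
  define c p where "c = chart_at B y" and "p = cmap c y"
  have c: "c \<in> B" "p \<in> crange c" "cinv c p = y" "y \<in> cdom c"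
    using L.chart_at[of y] by (auto simp: c_def p_def L.cinv_cmap)
  note md = L.map_differentiable_cinv[OF c(1,2)]
  have s: "section_differentiable (\<iota> \<circ> cinv c) (X i \<circ> cinv c) p" if i: "i < d j" for i
  proof -
    have "smooth_on (\<lambda>q. to_chart A (chart_at A (\<iota> y)) (\<iota> (cinv c q)) (X i (cinv c q)))
        (cmap c ` (U \<inter> cdom c \<inter> \<iota> -` cdom (chart_at A (\<iota> y))))"
      using X i c(1) chart_at(1) unfolding smooth_section_def by blast
    moreover have "p \<in> cmap c ` (U \<inter> cdom c \<inter> \<iota> -` cdom (chart_at A (\<iota> y)))"
      using U c chart_at(2) by (auto simp: p_def)
    ultimately show ?thesis
      by (auto dest: smooth_on_differentiable simp: section_differentiable_def c(3))
  qed
  from frechet_derivative_at[OF form_hat_derivative[OF md j s]]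
  have "frechet_derivative (\<lambda>q. \<alpha> j (\<iota> (cinv c q)) (\<lambda>i. X i (cinv c q))) (at p) u
     = (\<Sum>i<d j. \<alpha> j (\<iota> y) ((\<lambda>l. X l y)(i := hat_nabla A g B \<iota> (cinv c) (X i \<circ> cinv c) p u)))"
    by (simp add: c(3) fun_eq_iff)
  then show "hat_nabla_form A g B \<iota> (d j) (\<lambda>y. \<alpha> j (\<iota> y)) y u X = 0"
    by (simp add: hat_nabla_form_def Let_def c_def[symmetric] p_def[symmetric])
qed

end

section \<open>Holonomy\<close>

lemma tendsto_det:
  fixes M :: "'t \<Rightarrow> real ^ 'k::finite ^ 'k"
  assumes "\<And>i j. ((\<lambda>t. M t $ i $ j) \<longlongrightarrow> C $ i $ j) F"
  shows "((\<lambda>t. det (M t)) \<longlongrightarrow> det C) F"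
  unfolding det_def by (intro tendsto_sum tendsto_mult tendsto_const tendsto_prod assms)

text \<open>The counterpart of \<open>differentiable_solve\<close> for limits. It serves at break
  points and end points of a curve, where parallel sections are known only to be continuous.\<close>

lemma tendsto_solve:
  fixes M :: "'t \<Rightarrow> real ^ 'k::finite ^ 'k"
  assumes M: "\<And>i j. ((\<lambda>t. M t $ i $ j) \<longlongrightarrow> C $ i $ j) F" and det: "det C \<noteq> 0"
    and y: "(y \<longlongrightarrow> y') F" and eq: "\<forall>\<^sub>F t in F. M t *v x t = y t" and eq0: "C *v x' = y'"
  shows "(x \<longlongrightarrow> x') F"
proof -
  define X where "X M y = (\<chi> k. det (\<chi> i j. if j = k then y $ i else M $ i $ j) / det M)"
    for M :: "real ^ 'k ^ 'k" and y
  have dM: "((\<lambda>t. det (M t)) \<longlongrightarrow> det C) F" by (rule tendsto_det[OF M])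
  have "((\<lambda>t. det (\<chi> i j. if j = k then y t $ i else M t $ i $ j)) \<longlongrightarrow>
      det (\<chi> i j. if j = k then y' $ i else C $ i $ j)) F" for k
  proof (rule tendsto_det)
    show "((\<lambda>t. (\<chi> i j. if j = k then y t $ i else M t $ i $ j) $ i $ j) \<longlongrightarrow>
        (\<chi> i j. if j = k then y' $ i else C $ i $ j) $ i $ j) F" for i j
      using M tendsto_vec_nth[OF y] by (cases "j = k") simp_all
  qed
  then have "((\<lambda>t. X (M t) (y t)) \<longlongrightarrow> X C y') F"
    unfolding X_def by (intro tendsto_vec_lambda tendsto_divide dM det)
  moreover have "X C y' = x'" using cramer[OF det, of x' y'] eq0 by (simp add: X_def)
  moreover have "\<forall>\<^sub>F t in F. X (M t) (y t) = x t"
    using eq tendsto_imp_eventually_ne[OF dM det]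
    by eventually_elim (simp add: cramer X_def)
  ultimately show ?thesis using tendsto_cong by metis
qed

lemma alternating_form_tendsto:
  fixes \<beta> :: "'v::euclidean_space form"
  assumes alt: "alternating_form m \<beta>" and X: "\<And>i. i < m \<Longrightarrow> ((\<lambda>q. X q i) \<longlongrightarrow> X0 i) F"
  shows "((\<lambda>q. \<beta> (X q)) \<longlongrightarrow> \<beta> X0) F"
proof -
  have step: "((\<lambda>q. \<beta> (\<lambda>i. if i < k then X q i else Z i)) \<longlongrightarrow> \<beta> (\<lambda>i. if i < k then X0 i else Z i)) F"
    if "k \<le> m" for k Z
    using that
  proof (induction k arbitrary: Z)
    case (Suc k)
    then have km: "k < m" by simp
    have expand: "\<beta> (\<lambda>i. if i < Suc k then Y i else Z i)
        = (\<Sum>b\<in>Basis. (Y k \<bullet> b) * \<beta> (\<lambda>i. if i < k then Y i else (Z(k := b)) i))" for Y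
    proof -
      have "(\<lambda>i. if i < Suc k then Y i else Z i) = (\<lambda>i. if i < k then Y i else Z i)(k := Y k)"
        by (auto simp: fun_eq_iff less_Suc_eq)
      moreover have "(\<lambda>i. if i < k then Y i else (Z(k := b)) i) = (\<lambda>i. if i < k then Y i else Z
          i)(k := b)" for b
        by (auto simp: fun_eq_iff)
      ultimately show ?thesis
        using alternating_form_expand[OF alt km, of "\<lambda>i. if i < k then Y i else Z i" "Y k"] by
            (simp only:)
    qed
    show ?case
      unfolding expand by (intro tendsto_sum tendsto_mult tendsto_inner X km tendsto_const Suc.IH)
          (use km in simp)
  qed simp
  have eq: "\<beta> (\<lambda>i. if i < m then Y i else 0) = \<beta> Y" for Y
    by (rule alternating_form_cong[OF alt]) simp
  show ?thesis using step[of m "\<lambda>_. 0", OF order_refl] by (simp only: eq)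
qed

text \<open>The shape matches piecewise smooth curves: continuity on the closed interval bridges the
  finitely many points without a derivative, to which the end points are added.\<close>

lemma constant_of_zero_derivative:
  fixes f :: "real \<Rightarrow> real"
  assumes lim: "\<And>t. t \<in> {0..1} \<Longrightarrow> (f \<longlongrightarrow> f t) (at t within {0..1})" and S: "finite S"
    and der: "\<And>t. t \<in> {0<..<1} - S \<Longrightarrow> (f has_derivative (\<lambda>_. 0)) (at t)" and t: "t \<in> {0..1}"
  shows "f t = f 0"
proof (rule has_derivative_zero_unique_strong_interval[of "S \<union> {0, 1}" 0 1 f])
  show "continuous_on {0..1} f" using lim by (simp add: continuous_on_def)
  show "(f has_derivative (\<lambda>h. 0)) (at x within {0..1})" if "x \<in> {0..1} - (S \<union> {0, 1})" for x
    using der[of x] that by (auto intro: has_derivative_at_withinI)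
qed (use S t in auto)

text \<open>\<open>parallel_along\<close> constrains the derivative only in the direction 1, which
  determines a linear map on the line.\<close>

lemma has_derivative_real_eq_0:
  assumes "((f :: real \<Rightarrow> 'b::real_normed_vector) has_derivative D) (at t)" "D 1 = 0"
  shows "(f has_derivative (\<lambda>_. 0)) (at t)"
proof -
  have "D w = 0" for w using linear_scale[OF has_derivative_linear[OF assms(1)], of w 1] assms(2)
      by simp
  then have "D = (\<lambda>_. 0)" by auto
  then show ?thesis using assms(1) by simp
qed

lemma partition_interval:
  fixes a :: "nat \<Rightarrow> real"
  shows "a 0 \<le> t \<Longrightarrow> t < a r \<Longrightarrow> \<exists>i<r. a i \<le> t \<and> t < a (Suc i)"
proof (induction r)
  case (Suc r)
  then show ?case by (cases "t < a r") (auto intro: less_SucI)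
qed simp

section \<open>Piecewise smooth curves\<close>

context oriented_manifold
begin

text \<open>Continuity of the curve is hidden in \<open>smooth_on\<close>, which makes the set of
  parameters lying in the chart domain open. On it the curve is the inverse chart applied to its
  smooth coordinate expression.\<close>

lemma smooth_curve_differentiable:
  assumes \<sigma>: "smooth_curve A I \<sigma>" and t: "t \<in> I"
  shows "map_differentiable \<sigma> t"
proof -
  define c where "c = chart_at A (\<sigma> t)"
  have c: "c \<in> A" "\<sigma> t \<in> cdom c" by (auto simp: c_def chart_at)
  have sm: "smooth_on (cmap c \<circ> \<sigma>) (I \<inter> \<sigma> -` cdom c)"
    using \<sigma> c(1) by (simp add: smooth_curve_def)
  have d: "(cmap c \<circ> \<sigma>) differentiable at t" by (rule smooth_on_differentiable[OF sm]) (use t c in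
      auto)
  have "isCont (cinv c \<circ> (cmap c \<circ> \<sigma>)) t"
    by (intro continuous_at_compose differentiable_imp_continuous_within[OF d])
      (use isCont_cinv[OF c(1)] c in \<open>auto simp: o_def\<close>)
  moreover have "\<forall>\<^sub>F q in nhds t. (cinv c \<circ> (cmap c \<circ> \<sigma>)) q = \<sigma> q"
    using eventually_nhds_in_open[OF smooth_on_open[OF sm], of t] t c
    by (auto elim!: eventually_mono simp: cinv_cmap[OF c(1)])
  ultimately have "isCont \<sigma> t" using isCont_cong by blast
  then show ?thesis using d by (simp add: map_differentiable_def c_def)
qed

lemma map_differentiable_cong:
  assumes ev: "\<forall>\<^sub>F q in nhds p. F q = G q" and F: "map_differentiable F p"
  shows "map_differentiable G p"
proof -
  have "F p = G p" by (rule eventually_nhds_x_imp_x[OF ev])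
  moreover have "isCont G p" using F isCont_cong[OF ev] by (simp add: map_differentiable_def)
  moreover have "(cmap c \<circ> F) differentiable at p \<Longrightarrow> (cmap c \<circ> G) differentiable at p" for c ::
      "('m, 'n) chart"
    by (erule differentiable_transform_nhds) (use ev in eventually_elim, simp)
  ultimately show ?thesis using F by (simp add: map_differentiable_def)
qed

lemma piecewise_smooth_differentiable:
  assumes "piecewise_smooth A \<gamma>"
  obtains S where "finite S" "\<And>t. t \<in> {0<..<1} - S \<Longrightarrow> map_differentiable \<gamma> t"
proof -
  obtain r :: nat and a where a: "a 0 = 0" "a r = (1::real)"
    and pieces: "\<And>i. i < r \<Longrightarrow> \<exists>e \<sigma>. 0 < e \<and> smooth_curve A {a i - e <..< a (Suc i) + e} \<sigma> \<and>
              (\<forall>t\<in>{a i..a (Suc i)}. \<gamma> t = \<sigma> t)"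
    using assms unfolding piecewise_smooth_def by blast
  show ?thesis
  proof (rule that)
    show "finite (a ` {..r})" by simp
    fix t assume t: "t \<in> {0<..<1} - a ` {..r}"
    then obtain i where i: "i < r" "a i \<le> t" "t < a (Suc i)"
      using partition_interval[of a t r] a by auto
    then have "a i \<noteq> t" using t by auto
    then have ti: "t \<in> {a i<..<a (Suc i)}" using i by simp
    obtain e \<sigma> where e: "0 < e" and \<sigma>: "smooth_curve A {a i - e <..< a (Suc i) + e} \<sigma>"
      and eq: "\<And>t. t \<in> {a i..a (Suc i)} \<Longrightarrow> \<gamma> t = \<sigma> t"
      using pieces[OF i(1)] by blast
    have "\<forall>\<^sub>F q in nhds t. \<sigma> q = \<gamma> q"
      using eventually_nhds_in_open[OF open_greaterThanLessThan ti] by eventually_elim (simp add: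
          eq)
    moreover have "map_differentiable \<sigma> t"
      by (rule smooth_curve_differentiable[OF \<sigma>]) (use ti e in auto)
    ultimately show "map_differentiable \<gamma> t" by (rule map_differentiable_cong)
  qed
qed

end

lemma tendsto_within_subset:
  assumes "(f \<longlongrightarrow> l) (at t within T)" and "\<forall>\<^sub>F q in at t within S. q \<in> T"
  shows "(f \<longlongrightarrow> l) (at t within S)"
proof (rule filterlim_mono[OF assms(1) order_refl])
  show "at t within S \<le> at t within T"
  proof (rule filter_leI)
    fix P assume "eventually P (at t within T)"
    then show "eventually P (at t within S)"
      using assms(2) unfolding eventually_at_filter by eventually_elim auto
  qed
qed

section \<open>Quantities conserved along parallel sections\<close>

locale parallel_transport = parallel_compliant_submanifold A g N d \<alpha> \<phi> V E B \<iota>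
  for A :: "('m::{t2_space, second_countable_topology}, 'n::finite) chart set"
    and g N d \<alpha> \<phi> V E
    and B :: "('l::{t2_space, second_countable_topology}, 'k::finite) chart set" and \<iota> +
  fixes \<gamma> :: "real \<Rightarrow> 'l" and S :: "real set"
  assumes path: "continuous_on {0..1} \<gamma>" and finite_S: "finite S"
    and differentiable: "t \<in> {0<..<1} - S \<Longrightarrow> L.map_differentiable \<gamma> t"
begin

context
  fixes t0 :: real assumes t0: "t0 \<in> {0..1}"
begin

lemma curve_tendsto: "(\<gamma> \<longlongrightarrow> \<gamma> t0) (at t0 within {0..1})"
  using path t0 by (simp add: continuous_on_def)

lemma inclusion_tendsto: "((\<lambda>t. \<iota> (\<gamma> t)) \<longlongrightarrow> \<iota> (\<gamma> t0)) (at t0 within {0..1})"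
  by (rule isCont_tendsto_compose[OF isCont_inclusion curve_tendsto])

lemma eventually_along:
  "\<forall>\<^sub>F t in at t0 within {0..1}. \<gamma> t \<in> cdom (chart_at B (\<gamma> t0)) \<and> \<iota> (\<gamma> t) \<in> cdom (chart_at A (\<iota> (\<gamma>
      t0)))
     \<and> \<iota> (\<gamma> t) \<in> V (\<iota> (\<gamma> t0)) \<and> t \<in> {0..1}"
  by (intro eventually_conj topological_tendstoD[OF curve_tendsto] topological_tendstoD[OF
      inclusion_tendsto]
      L.open_cdom L.chart_at open_cdom chart_at open_V in_V)
    (simp add: eventually_at_filter)

lemma parallel_tendsto_chart:
  assumes s: "parallel_along A g B \<iota> \<gamma> s"
  shows "((\<lambda>t. to_chart A (chart_at A (\<iota> (\<gamma> t0))) (\<iota> (\<gamma> t)) (s t)) \<longlongrightarrow> s t0) (at t0 within {0..1})"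
proof -
  define c where "c = chart_at A (\<iota> (\<gamma> t0))"
  have "continuous_on {t \<in> {0..1}. \<iota> (\<gamma> t) \<in> cdom c} (\<lambda>t. to_chart A c (\<iota> (\<gamma> t)) (s t))"
    using s chart_at(1) unfolding parallel_along_def c_def by blast
  moreover have "t0 \<in> {t \<in> {0..1}. \<iota> (\<gamma> t) \<in> cdom c}" using t0 chart_at(2) by (simp add: c_def)
  ultimately have "((\<lambda>t. to_chart A c (\<iota> (\<gamma> t)) (s t)) \<longlongrightarrow> to_chart A c (\<iota> (\<gamma> t0)) (s t0))
      (at t0 within {t \<in> {0..1}. \<iota> (\<gamma> t) \<in> cdom c})"
    by (simp add: continuous_on_def)
  then show ?thesis
    unfolding c_def[symmetric] 
    by (rule tendsto_within_subset[THEN tendsto_eq_rhs]) (use eventually_along in \<open>auto elim: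
        eventually_mono simp: c_def\<close>)
qed

text \<open>As in \<open>section_differentiable_iff\<close>, the frame matrix is inverted; here it
  tends to the identity.\<close>

lemma gauge_tendsto:
  assumes s: "((\<lambda>t. to_chart A (chart_at A (\<iota> (\<gamma> t0))) (\<iota> (\<gamma> t)) (s t)) \<longlongrightarrow> s t0) (at t0 within
      {0..1})"
  shows "((\<lambda>t. gauge (\<iota> (\<gamma> t0)) (\<iota> (\<gamma> t)) (s t)) \<longlongrightarrow> s t0) (at t0 within {0..1})"
proof -
  define x c where "x = \<iota> (\<gamma> t0)" and "c = chart_at A x"
  have cm: "((\<lambda>t. cmap c (\<iota> (\<gamma> t))) \<longlongrightarrow> cmap c x) (at t0 within {0..1})"
    using isCont_tendsto_compose[OF isCont_cmap[OF chart_at] inclusion_tendsto] by (simp add: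
        c_def x_def)
  have fr: "((\<lambda>t. frame_chart x (cmap c (\<iota> (\<gamma> t))) v) \<longlongrightarrow> v) (at t0 within {0..1})" for v
    using isCont_tendsto_compose[OF has_derivative_continuous[OF frame_chart_has_derivative[of x
        v]] cm[unfolded c_def]]
    by (simp add: frame_chart_at c_def)
  show ?thesis
    unfolding x_def[symmetric]
  proof (rule tendsto_solve[where C = "mat 1"])
    show "((\<lambda>t. matrix (frame_chart x (cmap c (\<iota> (\<gamma> t)))) $ i $ j) \<longlongrightarrow> mat 1 $ i $ j) (at t0 within
        {0..1})" for i j
      using tendsto_vec_nth[OF fr[of "axis j 1"], of i] by (simp add: matrix_def mat_def axis_def)
    show "\<forall>\<^sub>F t in at t0 within {0..1}. matrix (frame_chart x (cmap c (\<iota> (\<gamma> t)))) *v gauge x (\<iota> (\<gamma>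
        t)) (s t)
        = to_chart A c (\<iota> (\<gamma> t)) (s t)"
      using eventually_along unfolding x_def[symmetric]
    proof eventually_elim
      case (elim t)
      then have "linear (frame_chart x (cmap c (\<iota> (\<gamma> t))))"
        by (intro linear_frame_chart) (auto simp: c_def cinv_cmap[OF chart_at(1)])
      then show ?case
        using frame_chart_gauge[of "\<iota> (\<gamma> t)" x "s t"] elim by (simp add: matrix_works c_def)
    qed
  qed (use s in \<open>simp_all add: x_def c_def\<close>)
qed

lemma coord_field_tendsto:
  "((\<lambda>t. gauge (\<iota> (\<gamma> t0)) (\<iota> (\<gamma> t)) (coord_field (\<gamma> t0) (\<gamma> t) v)) \<longlongrightarrow> dinc (\<gamma> t0) v) (at t0 within
      {0..1})"
proof -
  define y where "y = \<gamma> t0"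
  have cm: "((\<lambda>t. cmap (chart_at B y) (\<gamma> t)) \<longlongrightarrow> cmap (chart_at B y) y) (at t0 within {0..1})"
    using isCont_tendsto_compose[OF L.isCont_cmap[OF L.chart_at] curve_tendsto] by (simp add: y_def)
  have "coord_chart y (cmap (chart_at B y) y) v = dinc y v"
    using to_chart_coord_field[OF L.chart_at(2) chart_at(2), of y v] by (simp add: coord_field_self)
  then have "((\<lambda>t. coord_chart y (cmap (chart_at B y) (\<gamma> t)) v) \<longlongrightarrow> coord_field y y v) (at t0 within
      {0..1})"
    using isCont_tendsto_compose[OF has_derivative_continuous[OF coord_chart_has_derivative[of y
        v]] cm]
    by (simp add: coord_field_self)
  moreover have "\<forall>\<^sub>F t in at t0 within {0..1}. coord_chart y (cmap (chart_at B y) (\<gamma> t)) v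
      = to_chart A (chart_at A (\<iota> y)) (\<iota> (\<gamma> t)) (coord_field y (\<gamma> t) v)"
    using eventually_along by eventually_elim (simp add: to_chart_coord_field y_def)
  ultimately have "((\<lambda>t. to_chart A (chart_at A (\<iota> y)) (\<iota> (\<gamma> t)) (coord_field y (\<gamma> t) v)) \<longlongrightarrow>
      coord_field y y v) (at t0 within {0..1})"
    using tendsto_cong by fast
  from gauge_tendsto[of "\<lambda>t. coord_field y (\<gamma> t) v", folded y_def, OF this]
  show ?thesis by (simp add: y_def coord_field_self)
qed

lemma inner_tendsto:
  assumes s: "((\<lambda>t. gauge (\<iota> (\<gamma> t0)) (\<iota> (\<gamma> t)) (s t)) \<longlongrightarrow> v) (at t0 within {0..1})"
    and s': "((\<lambda>t. gauge (\<iota> (\<gamma> t0)) (\<iota> (\<gamma> t)) (s' t)) \<longlongrightarrow> v') (at t0 within {0..1})"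
  shows "((\<lambda>t. g (\<iota> (\<gamma> t)) (s t) (s' t)) \<longlongrightarrow> g (\<iota> (\<gamma> t0)) v v') (at t0 within {0..1})"
  using pt.bb.tendsto[OF s s', of "\<iota> (\<gamma> t0)"]
proof (rule Lim_transform_eventually)
  show "\<forall>\<^sub>F t in at t0 within {0..1}. g (\<iota> (\<gamma> t0)) (gauge (\<iota> (\<gamma> t0)) (\<iota> (\<gamma> t)) (s t)) (gauge (\<iota> (\<gamma>
      t0)) (\<iota> (\<gamma> t)) (s' t))
      = g (\<iota> (\<gamma> t)) (s t) (s' t)"
    using eventually_along by eventually_elim (simp add: gauge_isometry)
qed

text \<open>The Gram system is solved in the limit: inner products converge, hence so do the
  coefficients of the tangential part.\<close>

lemma proj_N_tendsto:
  assumes s: "((\<lambda>t. gauge (\<iota> (\<gamma> t0)) (\<iota> (\<gamma> t)) (s t)) \<longlongrightarrow> s t0) (at t0 within {0..1})"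
  shows "((\<lambda>t. gauge (\<iota> (\<gamma> t0)) (\<iota> (\<gamma> t)) (prN (\<gamma> t) (s t))) \<longlongrightarrow> prN (\<gamma> t0) (s t0))
    (at t0 within {0..1})"
proof -
  define y x where "y = \<gamma> t0" and "x = \<iota> y"
  note cf = coord_field_tendsto[folded y_def, folded x_def]
  note inner = inner_tendsto[folded y_def, folded x_def]
  have a: "((\<lambda>t. coord_coeff y (\<gamma> t) (s t)) \<longlongrightarrow> coord_coeff y y (s t0)) (at t0 within {0..1})"
  proof (rule tendsto_solve)
    show "((\<lambda>t. coord_gram y (\<gamma> t) $ i $ j) \<longlongrightarrow> coord_gram y y $ i $ j) (at t0 within {0..1})" for i j
      using inner[OF cf cf] by (simp add: coord_gram_def coord_field_self x_def)
    show "det (coord_gram y y) \<noteq> 0" by (rule det_coord_gram[OF L.chart_at(2)])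
    show "((\<lambda>t. \<chi> i. g (\<iota> (\<gamma> t)) (coord_field y (\<gamma> t) (axis i 1)) (s t)) \<longlongrightarrow>
        (\<chi> i. g (\<iota> y) (coord_field y y (axis i 1)) (s t0))) (at t0 within {0..1})"
      using inner[OF cf s[folded y_def, folded x_def]] by (intro tendsto_vec_lambda) (simp add:
          coord_field_self x_def)
    show "\<forall>\<^sub>F t in at t0 within {0..1}. coord_gram y (\<gamma> t) *v coord_coeff y (\<gamma> t) (s t)
        = (\<chi> i. g (\<iota> (\<gamma> t)) (coord_field y (\<gamma> t) (axis i 1)) (s t))"
      using eventually_along by eventually_elim (simp add: coord_gram_coeff y_def)
  qed (rule coord_gram_coeff[OF L.chart_at(2)])
  have "((\<lambda>t. gauge x (\<iota> (\<gamma> t)) (s t) - (\<Sum>i\<in>UNIV. (coord_coeff y (\<gamma> t) (s t) $ i) *\<^sub>R gauge x (\<iota>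
      (\<gamma> t)) (coord_field y (\<gamma> t) (axis i 1))))
     \<longlongrightarrow> s t0 - (\<Sum>i\<in>UNIV. (coord_coeff y y (s t0) $ i) *\<^sub>R dinc y (axis i 1))) (at t0 within {0..1})"
    by (intro tendsto_diff tendsto_sum tendsto_scaleR tendsto_vec_nth a cf s[folded y_def, folded
        x_def])
  moreover have "s t0 - (\<Sum>i\<in>UNIV. (coord_coeff y y (s t0) $ i) *\<^sub>R dinc y (axis i 1)) = prN y (s
      t0)"
    using coord_coeff[OF L.chart_at(2), of y "s t0"] linear_expand[OF linear_tangent_map[of y], of
        "coord_coeff y y (s t0)"]
    by (simp add: coord_field_self proj_N_def)
  moreover have "\<forall>\<^sub>F t in at t0 within {0..1}. gauge x (\<iota> (\<gamma> t)) (s t) - (\<Sum>i\<in>UNIV. (coord_coeff y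
      (\<gamma> t) (s t) $ i) *\<^sub>R gauge x (\<iota> (\<gamma> t)) (coord_field y (\<gamma> t) (axis i 1)))
     = gauge x (\<iota> (\<gamma> t)) (prN (\<gamma> t) (s t))"
    using eventually_along unfolding y_def[symmetric] x_def[symmetric]
  proof eventually_elim
    case (elim t)
    then have lin: "linear (gauge x (\<iota> (\<gamma> t)))" and z: "\<gamma> t \<in> cdom (chart_at B y)" by (auto intro:
        linear_gauge)
    have "linear (\<lambda>v. gauge x (\<iota> (\<gamma> t)) (coord_field y (\<gamma> t) v))"
      using linear_compose[OF coord_field(1)[OF z] lin] by (simp add: o_def)
    from linear_expand[OF this, of "coord_coeff y (\<gamma> t) (s t)"] show ?case
      by (simp add: coord_coeff[OF z] proj_N_def linear_diff[OF lin])
  qed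
  ultimately show ?thesis
    unfolding y_def[symmetric] x_def[symmetric] by (auto intro: Lim_transform_eventually)
qed

end

lemma parallel_section:
  assumes "parallel_along A g B \<iota> \<gamma> s"
  obtains S' where "finite S'" "S \<subseteq> S'"
    "\<And>t. t \<in> {0<..<1} - S' \<Longrightarrow> section_differentiable (\<iota> \<circ> \<gamma>) s t"
    "\<And>t. t \<in> {0<..<1} - S' \<Longrightarrow> hat_nabla A g B \<iota> \<gamma> s t 1 = 0"
proof -
  obtain S1 where "finite S1" "\<forall>t\<in>{0<..<1} - S1.
        (\<lambda>q. to_chart A (chart_at A (\<iota> (\<gamma> t))) (\<iota> (\<gamma> q)) (s q)) differentiable (at t) \<and>
        hat_nabla A g B \<iota> \<gamma> s t 1 = 0"
    using assms unfolding parallel_along_def by blast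
  then show ?thesis
    using finite_S by (intro that[of "S \<union> S1"]) (auto simp: section_differentiable_def)
qed

lemma parallel_gauge_tendsto:
  "t0 \<in> {0..1} \<Longrightarrow> parallel_along A g B \<iota> \<gamma> s \<Longrightarrow>
    ((\<lambda>t. gauge (\<iota> (\<gamma> t0)) (\<iota> (\<gamma> t)) (s t)) \<longlongrightarrow> s t0) (at t0 within {0..1})"
  by (intro gauge_tendsto parallel_tendsto_chart)

lemma parallel_form_constant:
  assumes j: "j \<le> N" and s: "\<And>i. parallel_along A g B \<iota> \<gamma> (s i)"
  shows "\<alpha> j (\<iota> (\<gamma> 1)) (\<lambda>i. s i 1) = \<alpha> j (\<iota> (\<gamma> 0)) (\<lambda>i. s i 0)"
proof -
  have "\<forall>i. \<exists>S'. finite S' \<and> S \<subseteq> S' \<and> (\<forall>t\<in>{0<..<1} - S'. section_differentiable (\<iota> \<circ> \<gamma>) (s i) t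
      \<and> hat_nabla A g B \<iota> \<gamma> (s i) t 1 = 0)"
    using parallel_section[OF s] by (metis (no_types, lifting))
  then obtain S' where S': "\<And>i. finite (S' i)" "\<And>i. S \<subseteq> S' i"
    and sd: "\<And>i t. t \<in> {0<..<1} - S' i \<Longrightarrow> section_differentiable (\<iota> \<circ> \<gamma>) (s i) t"
    and hn: "\<And>i t. t \<in> {0<..<1} - S' i \<Longrightarrow> hat_nabla A g B \<iota> \<gamma> (s i) t 1 = 0" by metis
  define f where "f t = \<alpha> j (\<iota> (\<gamma> t)) (\<lambda>i. s i t)" for t
  have "f 1 = f 0"
  proof (rule constant_of_zero_derivative)
    \<comment> \<open>There is one section for each natural number, but the form reads only its
      first \<open>d j\<close> slots, so finitely many exceptional sets suffice.\<close>
    show "finite (S \<union> (\<Union>i<d j. S' i))" using finite_S S' by auto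
    fix t assume t: "t \<in> {0<..<1} - (S \<union> (\<Union>i<d j. S' i))"
    show "(f has_derivative (\<lambda>_. 0)) (at t)"
      unfolding f_def
    proof (rule has_derivative_real_eq_0[OF form_hat_derivative[OF differentiable j]])
      have "hat_nabla A g B \<iota> \<gamma> (s i) t 1 = 0" if "i < d j" for i using hn t that by blast
      then show "(\<Sum>i<d j. \<alpha> j (\<iota> (\<gamma> t)) ((\<lambda>l. s l t)(i := hat_nabla A g B \<iota> \<gamma> (s i) t 1))) = 0"
        using linear_0[OF alternating_form_linear[OF alternating[OF j]]] by simp
    qed (use t sd in auto)
  next
    fix t :: real assume t: "t \<in> {0..1}"
    have "((\<lambda>q. \<alpha> j (\<iota> (\<gamma> t)) (\<lambda>i. gauge (\<iota> (\<gamma> t)) (\<iota> (\<gamma> q)) (s i q))) \<longlongrightarrow> f t) (at t within {0..1})"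
      unfolding f_def by (rule alternating_form_tendsto[OF alternating[OF j]
          parallel_gauge_tendsto[OF t s]])
    then show "(f \<longlongrightarrow> f t) (at t within {0..1})"
      by (rule Lim_transform_eventually)
        (use eventually_along[OF t] in eventually_elim, simp add: gauge_forms[OF _ j] f_def)
  qed auto
  then show ?thesis by (simp add: f_def)
qed

text \<open>The hat connection is metric, because it differs from the Levi-Civita connection by the
  skew B_u. Intermediate times are included for the sake of \<open>parallel_det_pos\<close>.\<close>

lemma parallel_inner_constant:
  assumes s: "parallel_along A g B \<iota> \<gamma> s" "parallel_along A g B \<iota> \<gamma> s'" and t: "t \<in> {0..1}"
  shows "g (\<iota> (\<gamma> t)) (s t) (s' t) = g (\<iota> (\<gamma> 0)) (s 0) (s' 0)"
proof -
  obtain S1 S2 where S1: "finite S1" "S \<subseteq> S1"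
      "\<And>t. t \<in> {0<..<1} - S1 \<Longrightarrow> section_differentiable (\<iota> \<circ> \<gamma>) s t \<and> hat_nabla A g B \<iota> \<gamma> s t 1 = 0"
    and S2: "finite S2" "\<And>t. t \<in> {0<..<1} - S2 \<Longrightarrow> section_differentiable (\<iota> \<circ> \<gamma>) s' t \<and> hat_nabla A
        g B \<iota> \<gamma> s' t 1 = 0"
    using parallel_section[OF s(1)] parallel_section[OF s(2)] by metis
  show ?thesis
  proof (rule constant_of_zero_derivative[where S = "S1 \<union> S2" and f = "\<lambda>t. g (\<iota> (\<gamma> t)) (s t) (s'
      t)", OF _ _ _ t])
    show "finite (S1 \<union> S2)" using S1 S2 by simp
    show "((\<lambda>t. g (\<iota> (\<gamma> t)) (s t) (s' t)) \<longlongrightarrow> g (\<iota> (\<gamma> t)) (s t) (s' t)) (at t within {0..1})" if "t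
        \<in> {0..1}" for t
      using inner_tendsto[OF that parallel_gauge_tendsto parallel_gauge_tendsto] that s by blast
    fix t assume t: "t \<in> {0<..<1} - (S1 \<union> S2)"
    have \<gamma>: "L.map_differentiable \<gamma> t" using t S1 by (intro differentiable) auto
    have sd: "section_differentiable (\<iota> \<circ> \<gamma>) s t" "section_differentiable (\<iota> \<circ> \<gamma>) s' t"
      and hn: "hat_nabla A g B \<iota> \<gamma> s t 1 = 0" "hat_nabla A g B \<iota> \<gamma> s' t 1 = 0"
      using S1(3) S2(2) t by auto
    have skew: "g x (B_op A g B \<iota> y u v) w = - g x v (B_op A g B \<iota> y u w)" if "x = \<iota> y" for x y u
        v w
      using B_op(1)[of y u] that by (auto simp: infinitesimal_stabilizer_def)
    show "((\<lambda>t. g (\<iota> (\<gamma> t)) (s t) (s' t)) has_derivative (\<lambda>_. 0)) (at t)"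
      by (rule has_derivative_real_eq_0[OF metric_has_derivative[OF
          map_differentiable_inclusion(1)[OF \<gamma>] sd, unfolded o_apply]])
        (use hn in \<open>auto simp: hat_nabla_eq[OF \<gamma> sd(1), unfolded o_def] hat_nabla_eq[OF \<gamma> sd(2),
            unfolded o_def] skew\<close>)
  qed
qed

text \<open>The derivative of the squared length is twice the pairing of the normal part with the
  hat derivative, which is zero. A vector is tangential exactly when this length vanishes, so
  transport preserves the tangent plane.\<close>

lemma parallel_normal_part_constant:
  assumes s: "parallel_along A g B \<iota> \<gamma> s"
  shows "g (\<iota> (\<gamma> 1)) (prN (\<gamma> 1) (s 1)) (prN (\<gamma> 1) (s 1))
    = g (\<iota> (\<gamma> 0)) (prN (\<gamma> 0) (s 0)) (prN (\<gamma> 0) (s 0))"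
proof -
  obtain S1 where S1: "finite S1" "S \<subseteq> S1"
      "\<And>t. t \<in> {0<..<1} - S1 \<Longrightarrow> section_differentiable (\<iota> \<circ> \<gamma>) s t \<and> hat_nabla A g B \<iota> \<gamma> s t 1 = 0"
    using parallel_section[OF s] by metis
  define sN where "sN t = prN (\<gamma> t) (s t)" for t
  have "g (\<iota> (\<gamma> 1)) (sN 1) (sN 1) = g (\<iota> (\<gamma> 0)) (sN 0) (sN 0)"
  proof (rule constant_of_zero_derivative[where S = S1 and f = "\<lambda>t. g (\<iota> (\<gamma> t)) (sN t) (sN t)" and
      t = 1])
    show "((\<lambda>t. g (\<iota> (\<gamma> t)) (sN t) (sN t)) \<longlongrightarrow> g (\<iota> (\<gamma> t)) (sN t) (sN t)) (at t within {0..1})" if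
        "t \<in> {0..1}" for t
      unfolding sN_def
      by (intro inner_tendsto proj_N_tendsto parallel_gauge_tendsto that s)
    fix t assume t: "t \<in> {0<..<1} - S1"
    have \<gamma>: "L.map_differentiable \<gamma> t" using t S1 by (intro differentiable) auto
    have sd: "section_differentiable (\<iota> \<circ> \<gamma>) s t" and hn: "hat_nabla A g B \<iota> \<gamma> s t 1 = 0"
      using S1(3) t by auto
    have sN: "section_differentiable (\<iota> \<circ> \<gamma>) sN t"
      unfolding sN_def[abs_def] by (rule proj_section_differentiable(2)[OF \<gamma> sd])
    define D where "D = levi_civita A g (\<iota> \<circ> \<gamma>) sN t 1"
    have sum: "prT (\<gamma> t) (levi_civita A g (\<iota> \<circ> \<gamma>) (\<lambda>q. prT (\<gamma> q) (s q)) t 1)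
        + prN (\<gamma> t) D = 0"
      using hn by (simp add: hat_nabla_def D_def sN_def[abs_def])
    have sNt: "sN t \<in> perp (g (\<iota> (\<gamma> t))) (TL (\<gamma> t))"
      unfolding sN_def by (rule proj_N)
    have "g (\<iota> (\<gamma> t)) (prN (\<gamma> t) D) (sN t) = 0"
      using arg_cong[OF sum, of "\<lambda>v. g (\<iota> (\<gamma> t)) v (sN t)"] perpD[OF sNt proj_T] pt.b_commute[of
          "\<iota> (\<gamma> t)" "sN t"]
      by (simp add: pt.bb.add_left pt.bb.zero_left)
    then have "g (\<iota> (\<gamma> t)) D (sN t) = 0" by (simp add: inner_proj_N[OF sNt])
    then show "((\<lambda>t. g (\<iota> (\<gamma> t)) (sN t) (sN t)) has_derivative (\<lambda>_. 0)) (at t)"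
      by (intro has_derivative_real_eq_0[OF metric_has_derivative[OF
          map_differentiable_inclusion(1)[OF \<gamma>] sN sN, unfolded o_apply]])
        (simp add: D_def o_def pt.b_commute)
  qed (use S1 in auto)
  then show ?thesis by (simp add: sN_def)
qed

text \<open>The columns are written in preferred charts that jump along the curve, so the
  determinant itself need not be continuous. Its sign is: changes of chart have positive
  determinant, and constant inner products keep the columns independent.\<close>

lemma parallel_det_pos:
  fixes s :: "'n \<Rightarrow> real \<Rightarrow> real ^ 'n"
  assumes s: "\<And>i. parallel_along A g B \<iota> \<gamma> (s i)" and s0: "\<And>i. s i 0 = axis i 1"
  shows "0 < det (\<chi> i j. s j 1 $ i)"
proof -
  define Mt where "Mt t = (\<chi> i j. s j t $ i)" for t
  have Mt_mult: "Mt t *v a = (\<Sum>j\<in>UNIV. (a $ j) *\<^sub>R s j t)" for t a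
    by (simp add: vec_eq_iff Mt_def matrix_vector_mult_def mult.commute)
  have nz: "det (Mt t) \<noteq> 0" if t: "t \<in> {0..1}" for t
  proof -
    have "inj ((*v) (Mt t))"
    proof (rule linear_injective_0[OF matrix_vector_mul_linear, THEN iffD2], intro allI impI)
      fix a assume a: "Mt t *v a = 0"
      have Mt0: "Mt 0 *v a = a"
        using basis_expansion[of a] by (simp add: Mt_mult s0 scalar_mult_eq_scaleR)
      have "g (\<iota> (\<gamma> t)) (Mt t *v a) (Mt t *v a) = g (\<iota> (\<gamma> 0)) (Mt 0 *v a) (Mt 0 *v a)"
        by (simp add: Mt_mult pt.bb.sum_left pt.bb.sum_right pt.bb.scaleR_left pt.bb.scaleR_right
            parallel_inner_constant[OF s s t])
      then show "a = 0" by (simp add: a Mt0 pt.bb.zero_left)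
    qed
    then show ?thesis using det_nz_iff_inj[OF matrix_vector_mul_linear[of "Mt t"]] by simp
  qed
  have "continuous_on {0..1} (\<lambda>t. sgn (det (Mt t)))"
    unfolding continuous_on_def
  proof
    fix t :: real assume t: "t \<in> {0..1}"
    define c where "c = chart_at A (\<iota> (\<gamma> t))"
    have "((\<lambda>q. det (\<chi> i j. to_chart A c (\<iota> (\<gamma> q)) (s j q) $ i)) \<longlongrightarrow> det (Mt t)) (at t within {0..1})"
      by (rule tendsto_det)
        (use tendsto_vec_nth[OF parallel_tendsto_chart[OF t s]] in \<open>simp add: Mt_def c_def\<close>)
    then have "((\<lambda>q. sgn (det (\<chi> i j. to_chart A c (\<iota> (\<gamma> q)) (s j q) $ i))) \<longlongrightarrow> sgn (det (Mt t)))
        (at t within {0..1})"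
      by (rule tendsto_sgn[OF _ nz[OF t]])
    moreover have "\<forall>\<^sub>F q in at t within {0..1}. sgn (det (\<chi> i j. to_chart A c (\<iota> (\<gamma> q)) (s j q) $
        i)) = sgn (det (Mt q))"
      using eventually_along[OF t] unfolding c_def[symmetric]
    proof eventually_elim
      case (elim q)
      then have z: "\<iota> (\<gamma> q) \<in> cdom c" and c: "c \<in> A" by (auto simp: c_def chart_at)
      have "(\<chi> i j. to_chart A c (\<iota> (\<gamma> q)) (s j q) $ i) = matrix (to_chart A c (\<iota> (\<gamma> q))) ** Mt q"
      proof -
        have "to_chart A c (\<iota> (\<gamma> q)) (s j q) = matrix (to_chart A c (\<iota> (\<gamma> q))) *v s j q" for j
          by (simp add: matrix_works linear_to_chart[OF c z])
        then show ?thesis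
          by (simp add: vec_eq_iff matrix_matrix_mult_def matrix_vector_mult_def Mt_def)
      qed
      then show ?case using det_to_chart[OF c z] by (simp add: det_mul sgn_mult)
    qed
    ultimately show "((\<lambda>q. sgn (det (Mt q))) \<longlongrightarrow> sgn (det (Mt t))) (at t within {0..1})"
      by (rule Lim_transform_eventually)
  qed
  moreover have "(\<lambda>t. sgn (det (Mt t))) ` {0..1} \<subseteq> {-1, 0, 1}" by (auto simp: sgn_if)
  ultimately have "(\<lambda>t. sgn (det (Mt t))) constant_on {0..1}"
    by (intro continuous_finite_range_constant) (auto intro: finite_subset)
  then have "sgn (det (Mt 1)) = sgn (det (Mt 0))" by (auto simp: constant_on_def)
  moreover have "Mt 0 = mat 1" by (simp add: vec_eq_iff Mt_def s0 mat_def axis_def)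
  ultimately have "0 < det (Mt 1)" by (simp add: sgn_if split: if_splits)
  then show ?thesis by (simp add: Mt_def)
qed

end

section \<open>The holonomy group inside the plane stabilizer\<close>

context parallel_compliant_submanifold
begin

lemma restricted_holonomy_subset:
  "restricted_holonomy A g B \<iota> y
     \<subseteq> plane_stabilizer (g (\<iota> y)) N (\<lambda>j. \<alpha> j (\<iota> y)) (TL y)"
proof
  fix P assume "P \<in> restricted_holonomy A g B \<iota> y"
  then obtain \<gamma> where lin: "linear P" and pw: "piecewise_smooth B \<gamma>" and loop: "\<gamma> 0 = y" "\<gamma> 1 = y"
    and hom: "homotopic_paths UNIV \<gamma> (\<lambda>_. y)"
    and tr: "\<And>v. \<exists>s. parallel_along A g B \<iota> \<gamma> s \<and> s 0 = v \<and> s 1 = P v"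
    unfolding restricted_holonomy_def by blast
  obtain S where S: "finite S" "\<And>t. t \<in> {0<..<1} - S \<Longrightarrow> L.map_differentiable \<gamma> t"
    using L.piecewise_smooth_differentiable[OF pw] by metis
  \<comment> \<open>The homotopy of paths supplies the continuity of the loop.\<close>
  interpret parallel_transport A g N d \<alpha> \<phi> V E B \<iota> \<gamma> S
    using homotopic_paths_imp_path[OF hom] S by unfold_locales (auto simp: path_def)
  obtain s where s: "\<And>v. parallel_along A g B \<iota> \<gamma> (s v)" "\<And>v. s v 0 = v" "\<And>v. s v 1 = P v"
    using tr by metis
  have iso: "g (\<iota> y) (P v) (P w) = g (\<iota> y) v w" for v w
    using parallel_inner_constant[OF s(1) s(1), of 1 v w] by (simp add: s loop)
  have forms: "\<alpha> j (\<iota> y) (\<lambda>i. P (X i)) = \<alpha> j (\<iota> y) X" if "j \<le> N" for j X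
    using parallel_form_constant[OF that s(1), of X] by (simp add: s loop)
  \<comment> \<open>The columns of P are the end values of the parallel sections that start at the
    standard basis. Positivity then selects the value 1 among the two possible determinants of an
    isometry.\<close>
  have "matrix P = (\<chi> i j. s (axis j 1) 1 $ i)" by (simp add: matrix_def s)
  then have "0 < det (matrix P)"
    using parallel_det_pos[of "\<lambda>i. s (axis i 1)"] s loop by simp
  then have det: "det (matrix P) = 1"
    using pt.isometry_det[OF lin iso] by auto
  have "P v \<in> TL y" if v: "v \<in> TL y" for v
  proof -
    have "prN y v = 0"
      using pt.proj_id[OF subspace_tangent_space v] by (simp add: proj_N_def proj_T_def)
    then have "prN y (P v) = 0"
      using parallel_normal_part_constant[OF s(1), of v] by (simp add: s loop pt.bb.zero_left)
    then show ?thesis using proj_T[of y "P v"] by (simp add: proj_N_def)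
  qed
  then have "P ` TL y = TL y"
    by (intro pt.isometry_image_eq[OF lin pt.isometry_inj[OF lin iso]] subspace_tangent_space) auto
  then show "P \<in> plane_stabilizer (g (\<iota> y)) N (\<lambda>j. \<alpha> j (\<iota> y)) (TL y)"
    using lin iso forms det by (simp add: plane_stabilizer_def stabilizer_def SO_def)
qed

end

lemma lie_algebra_mono: "G \<subseteq> H \<Longrightarrow> lie_algebra G \<subseteq> lie_algebra H"
  by (auto simp: lie_algebra_def)

text \<open>A neighbourhood and a frame are chosen for each point, while the model forms \<phi> are
  common to all of them.\<close>

lemma G_structure_frames:
  assumes "G_structure A g N d \<alpha>"
  obtains \<phi> V E where "\<And>x. open (V x)" "\<And>x. x \<in> V x"
    "\<And>x v. smooth_section A A id (V x) (\<lambda>z. E x z v)"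
    "\<And>x z. z \<in> V x \<Longrightarrow> orthonormal_frame (g z) (E x z)"
    "\<And>x z j X. z \<in> V x \<Longrightarrow> j \<le> N \<Longrightarrow> \<alpha> j z (\<lambda>i. E x z (X i)) = \<phi> j X"
proof -
  obtain \<phi> where "\<forall>x. \<exists>V E. open V \<and> x \<in> V \<and> (\<forall>v. smooth_section A A id V (\<lambda>y. E y v)) \<and>
          (\<forall>y\<in>V. linear (E y) \<and> (\<forall>v w. g y (E y v) (E y w) = v \<bullet> w) \<and> 0 < det (matrix (E y)) \<and>
             (\<forall>j\<le>N. \<forall>X. \<alpha> j y (\<lambda>i. E y (X i)) = \<phi> j X))"
    using assms unfolding G_structure_def by blast
  from choice[OF this] obtain V where "\<forall>x. \<exists>E. open (V x) \<and> x \<in> V x \<and> (\<forall>v. smooth_section A A id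
      (V x) (\<lambda>y. E y v)) \<and>
          (\<forall>y\<in>V x. linear (E y) \<and> (\<forall>v w. g y (E y v) (E y w) = v \<bullet> w) \<and> 0 < det (matrix (E y)) \<and>
             (\<forall>j\<le>N. \<forall>X. \<alpha> j y (\<lambda>i. E y (X i)) = \<phi> j X))" ..
  from choice[OF this] obtain E where "\<forall>x. open (V x) \<and> x \<in> V x \<and> (\<forall>v. smooth_section A A id (V x)
      (\<lambda>y. E x y v)) \<and>
          (\<forall>y\<in>V x. linear (E x y) \<and> (\<forall>v w. g y (E x y v) (E x y w) = v \<bullet> w) \<and> 0 < det (matrix (E x
              y)) \<and>
             (\<forall>j\<le>N. \<forall>X. \<alpha> j y (\<lambda>i. E x y (X i)) = \<phi> j X))" ..
  then show ?thesis by (intro that[of V E \<phi>]) (auto simp: orthonormal_frame_def)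
qed

theorem theorem3p5:
  fixes A :: "('m::{t2_space, second_countable_topology}, 'n::finite) chart set"
    and g :: "'m \<Rightarrow> real ^ 'n \<Rightarrow> real ^ 'n \<Rightarrow> real"
    and N :: nat
    and d :: "nat \<Rightarrow> nat"
    and \<alpha> :: "nat \<Rightarrow> 'm \<Rightarrow> (real ^ 'n) form"
    and B :: "('l::{t2_space, second_countable_topology}, 'k::finite) chart set"
    and \<iota> :: "'l \<Rightarrow> 'm"
  assumes "oriented_atlas A"
    and "riemannian_metric A g"
    and "\<forall>j\<le>N. differential_form A (d j) (\<alpha> j)"
    and "d 0 = CARD('k)"
    and "calibration TYPE('k) A g (\<alpha> 0)"
    and "G_structure A g N d \<alpha>"
    and "transitive_on_calibrated TYPE('k) g N \<alpha>"
    and "parallel_compliant TYPE('k) A g N d \<alpha>"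
    and "oriented_atlas B"
    and "submanifold A B \<iota>"
    and "calibrated_submanifold A g B \<iota> (\<alpha> 0)"
  shows "(\<forall>j\<le>N. hat_parallel_form A g B \<iota> (d j) (\<lambda>y. \<alpha> j (\<iota> y))) \<and>
    (\<forall>j\<le>N. \<forall>y u X. diamond (d j) (B_op A g B \<iota> y u) (\<alpha> j (\<iota> y)) X = 0) \<and>
    (\<forall>y. restricted_holonomy A g B \<iota> y
           \<subseteq> plane_stabilizer (g (\<iota> y)) N (\<lambda>j. \<alpha> j (\<iota> y)) (tangent_space A B \<iota> y)) \<and>
    (\<forall>y. lie_algebra (restricted_holonomy A g B \<iota> y)
           \<subseteq> lie_algebra
               (plane_stabilizer (g (\<iota> y)) N (\<lambda>j. \<alpha> j (\<iota> y)) (tangent_space A B \<iota> y))) \<and>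
    (\<forall>y u. B_op A g B \<iota> y u \<in> lie_algebra (stabilizer (g (\<iota> y)) N (\<lambda>j. \<alpha> j (\<iota> y))))"
proof -
  obtain \<phi> V E where frames: "\<And>x. open (V x)" "\<And>x. x \<in> V x"
    "\<And>x v. smooth_section A A id (V x) (\<lambda>z. E x z v)"
    "\<And>x z. z \<in> V x \<Longrightarrow> orthonormal_frame (g z) (E x z)"
    "\<And>x z j X. z \<in> V x \<Longrightarrow> j \<le> N \<Longrightarrow> \<alpha> j z (\<lambda>i. E x z (X i)) = \<phi> j X"
    using G_structure_frames[OF assms(6)] by metis
  have "parallel_compliant_submanifold A g N d \<alpha> \<phi> V E B \<iota>"
    by (intro parallel_compliant_submanifold.intro parallel_compliant_submanifold_axioms.intro
        G_submanifold.intro G_submanifold_axioms.intro G_manifold.intro G_manifold_axioms.intro oriented_manifold.intro)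
      (use assms frames in \<open>auto simp: differential_form_def parallel_compliant_def\<close>)
  then interpret parallel_compliant_submanifold A g N d \<alpha> \<phi> V E B \<iota> .
  show ?thesis
    using hat_parallel diamond_B_op restricted_holonomy_subset lie_algebra_mono[OF restricted_holonomy_subset]
      B_op_in_lie_algebra
    by blast
qed

end
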